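(* Let $p$ be an odd prime. If $n<0$ is an integer with $n\equiv0,1\pmod4$, then $$\sum_{Q\in\mathcal Q_{p,n}/\Gamma_0(p)}\frac1{|\Gamma_0(p)_Q|}=\frac{4(p+1)}p\,H_{1,p}(-n)-\frac{2(p+1)}{p-1}\,H_{p,p}(-n).$$
   Context: $\mathcal Q_{p,n}=\{ax^2+bxy+cy^2:a,b,c\in\mathbb Z,\ p\mid a,\ b^2-4ac=n\}$ (positive and negative definite forms are both included), with the usual action of $\Gamma_0(p)$; $\Gamma_0(p)_Q$ is the stabilizer of $Q$, taken modulo $\{\pm1\}$. Generalized Hurwitz class numbers (Pei--Wang): for an integer $N>0$ with $-N=tm^2$, $t$ a fundamental discriminant, $m\in\mathbb N$, $\chi_t=\left(\frac t\cdot\right)$ the Kronecker symbol, $\mu$ the Möbius function, $$H_{1,p}(N)=L(0,\chi_t)\,\frac{1-\chi_t(p)p^{-1}}{1-p^{-2}}\sum_{\substack{a\mid m\\ \gcd(a,p)=1}}\mu(a)\chi_t(a)\sum_{\substack{d\mid\frac ma\\ \gcd\left(\frac m{ad},p\right)=1}}d,$$ $$H_{p,p}(N)=L(0,\chi_t)\,(1-\chi_t(p))\sum_{\substack{a\mid m\\ \gcd(a,p)=1}}\mu(a)\chi_t(a)\sum_{\substack{d\mid\frac ma\\ \gcd(d,p)=1}}d.$$ *)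

theory Defs
  imports
    "HOL-Complex_Analysis.Complex_Analysis"
    "HOL-Computational_Algebra.Squarefree"
    "HOL-Number_Theory.Number_Theory"
begin

unbundle no Formal_Power_Series.fps_syntax

section \<open>Binary quadratic forms of level p\<close>

text \<open>The triple \<open>(a, b, c)\<close> stands for the form \<open>a x\<^sup>2 + b x y + c y\<^sup>2\<close>.\<close>

type_synonym bqf = "int \<times> int \<times> int"

fun bqf_eval :: "bqf \<Rightarrow> int \<Rightarrow> int \<Rightarrow> int" where
  "bqf_eval (a, b, c) x y = a * x\<^sup>2 + b * x * y + c * y\<^sup>2"

fun bqf_disc :: "bqf \<Rightarrow> int" where
  "bqf_disc (a, b, c) = b\<^sup>2 - 4 * a * c"

definition bqf_level :: "nat \<Rightarrow> int \<Rightarrow> bqf set" where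
  "bqf_level p n = {(a, b, c). int p dvd a \<and> bqf_disc (a, b, c) = n}"

definition Gamma0 :: "nat \<Rightarrow> (int ^ 2 ^ 2) set" where
  "Gamma0 p = {A. det A = 1 \<and> int p dvd A $ 2 $ 1}"

text \<open>The right action by linear substitution of the variables; see \<open>bqf_eval_act\<close>.\<close>

fun bqf_act :: "bqf \<Rightarrow> int ^ 2 ^ 2 \<Rightarrow> bqf" where
  "bqf_act (a, b, c) A =
     (a * (A$1$1)\<^sup>2 + b * A$1$1 * A$2$1 + c * (A$2$1)\<^sup>2,
      2 * a * A$1$1 * A$1$2 + b * (A$1$1 * A$2$2 + A$1$2 * A$2$1) + 2 * c * A$2$1 * A$2$2,
      a * (A$1$2)\<^sup>2 + b * A$1$2 * A$2$2 + c * (A$2$2)\<^sup>2)"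

definition bqf_equiv :: "nat \<Rightarrow> int \<Rightarrow> (bqf \<times> bqf) set" where
  "bqf_equiv p n = {(Q, R). Q \<in> bqf_level p n \<and> (\<exists>A\<in>Gamma0 p. R = bqf_act Q A)}"

definition bqf_classes :: "nat \<Rightarrow> int \<Rightarrow> bqf set set" where
  "bqf_classes p n = bqf_level p n // bqf_equiv p n"

text \<open>The stabilizer of \<open>Q\<close> in \<open>\<Gamma>\<^sub>0(p)\<close>, modulo \<open>{1, -1}\<close>.\<close>

definition Gamma0_stab :: "nat \<Rightarrow> bqf \<Rightarrow> (int ^ 2 ^ 2) set set" where
  "Gamma0_stab p Q = {A \<in> Gamma0 p. bqf_act Q A = Q} // {(A, B). B = A \<or> B = - A}"

subsection \<open>The class sum is well defined\<close>

lemma bqf_eval_act: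
  "bqf_eval (bqf_act Q A) x y = bqf_eval Q (A$1$1 * x + A$1$2 * y) (A$2$1 * x + A$2$2 * y)"
  by (cases Q) (simp add: power2_eq_square algebra_simps)

lemma mat2_mult:
  fixes A B :: "int ^ 2 ^ 2"
  shows "(A ** B) $ i $ j = A $ i $ 1 * B $ 1 $ j + A $ i $ 2 * B $ 2 $ j"
  by (simp add: matrix_matrix_mult_def sum_2)

lemma bqf_act_mult: "bqf_act Q (A ** B) = bqf_act (bqf_act Q A) B"
  by (cases Q) (simp add: mat2_mult power2_eq_square algebra_simps)

lemma bqf_act_one [simp]: "bqf_act Q (mat 1) = Q"
  by (cases Q) (simp add: mat_def)

lemma bqf_act_uminus [simp]: "bqf_act Q (- A) = bqf_act Q A"
  by (cases Q) simp

lemma bqf_disc_act: "bqf_disc (bqf_act Q A) = (det A)\<^sup>2 * bqf_disc Q"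
  by (cases Q) (simp add: det_2 power2_eq_square algebra_simps)

definition adj2 :: "int ^ 2 ^ 2 \<Rightarrow> int ^ 2 ^ 2" where
  "adj2 A = vector [vector [A$2$2, - A$1$2], vector [- A$2$1, A$1$1]]"

lemma adj2_nth [simp]:
  "adj2 A $ 1 $ 1 = A$2$2" "adj2 A $ 1 $ 2 = - A$1$2"
  "adj2 A $ 2 $ 1 = - A$2$1" "adj2 A $ 2 $ 2 = A$1$1"
  by (simp_all add: adj2_def)

lemma adj2_inverse:
  assumes "det A = 1"
  shows "A ** adj2 A = mat 1" "adj2 A ** A = mat 1"
  using assms by (simp_all add: vec_eq_iff forall_2 mat2_mult mat_def det_2 algebra_simps)

lemma det_adj2 [simp]: "det (adj2 A) = det A"
  by (simp add: det_2 algebra_simps)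

lemma Gamma0_mult: "A \<in> Gamma0 p \<Longrightarrow> B \<in> Gamma0 p \<Longrightarrow> A ** B \<in> Gamma0 p"
  by (simp add: Gamma0_def det_mul mat2_mult)

lemma Gamma0_one: "mat 1 \<in> Gamma0 p"
  by (simp add: Gamma0_def mat_def det_2)

lemma Gamma0_adj2: "A \<in> Gamma0 p \<Longrightarrow> adj2 A \<in> Gamma0 p"
  by (simp add: Gamma0_def)

lemma bqf_level_act:
  assumes "Q \<in> bqf_level p n" "A \<in> Gamma0 p"
  shows "bqf_act Q A \<in> bqf_level p n"
proof -
  obtain a b c where Q: "Q = (a, b, c)" by (cases Q)
  have "bqf_disc (bqf_act Q A) = n"
    using assms by (simp only: bqf_disc_act) (simp add: Gamma0_def bqf_level_def Q)
  moreover have "int p dvd fst (bqf_act Q A)"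
    using assms by (simp add: Gamma0_def bqf_level_def Q power2_eq_square)
  ultimately show ?thesis
    by (cases "bqf_act Q A") (simp add: bqf_level_def)
qed

lemma equiv_bqf_equiv: "equiv (bqf_level p n) (bqf_equiv p n)"
proof (rule equivI)
  show "bqf_equiv p n \<subseteq> bqf_level p n \<times> bqf_level p n"
    using bqf_level_act by (auto simp: bqf_equiv_def simp del: bqf_act.simps)
  show "refl_on (bqf_level p n) (bqf_equiv p n)"
    unfolding refl_on_def bqf_equiv_def using Gamma0_one[of p]
    by (auto intro!: bexI[of _ "mat 1"])
  show "sym (bqf_equiv p n)"
  proof (rule symI)
    fix Q R assume "(Q, R) \<in> bqf_equiv p n"
    then obtain A where A: "Q \<in> bqf_level p n" "A \<in> Gamma0 p" "R = bqf_act Q A"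
      by (auto simp: bqf_equiv_def)
    have "bqf_act R (adj2 A) = Q"
      using A adj2_inverse(1)[of A] by (simp add: bqf_act_mult[symmetric] Gamma0_def)
    with A show "(R, Q) \<in> bqf_equiv p n"
      using Gamma0_adj2[of A p] bqf_level_act[of Q p n A] by (force simp: bqf_equiv_def)
  qed
  show "trans (bqf_equiv p n)"
  proof (rule transI)
    fix Q R S assume "(Q, R) \<in> bqf_equiv p n" "(R, S) \<in> bqf_equiv p n"
    then obtain A B where "Q \<in> bqf_level p n" "A \<in> Gamma0 p" "B \<in> Gamma0 p"
      "S = bqf_act (bqf_act Q A) B"
      unfolding bqf_equiv_def by blast
    hence "Q \<in> bqf_level p n" "A ** B \<in> Gamma0 p" "S = bqf_act Q (A ** B)"
      by (simp_all only: bqf_act_mult Gamma0_mult)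
    thus "(Q, S) \<in> bqf_equiv p n" unfolding bqf_equiv_def by blast
  qed
qed

lemma card_Gamma0_stab_act:
  assumes A: "A \<in> Gamma0 p"
  shows "card (Gamma0_stab p (bqf_act Q A)) = card (Gamma0_stab p Q)"
proof -
  let ?r = "{(A, B). B = A \<or> B = - A} :: ((int ^ 2 ^ 2) \<times> (int ^ 2 ^ 2)) set"
  define c where "c = (\<lambda>B. adj2 A ** (B ** A))"
  define d where "d = (\<lambda>B. A ** (B ** adj2 A))"
  have dA: "det A = 1" using A by (simp add: Gamma0_def)
  note inv = adj2_inverse[OF dA]
  have dc: "d (c B) = B" for B
    by (simp add: c_def d_def matrix_mul_assoc inv) (simp add: matrix_mul_assoc[symmetric] inv)
  have cd: "c (d B) = B" for B
    by (simp add: c_def d_def matrix_mul_assoc inv) (simp add: matrix_mul_assoc[symmetric] inv)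
  have cu: "c (- B) = - c B" and du: "d (- B) = - d B" for B
    by (simp_all add: c_def d_def vec_eq_iff forall_2 mat2_mult algebra_simps)
  let ?S = "{B \<in> Gamma0 p. bqf_act Q B = Q}"
  let ?T = "{B \<in> Gamma0 p. bqf_act (bqf_act Q A) B = bqf_act Q A}"
  have QA: "bqf_act (bqf_act Q A) (adj2 A) = Q"
    by (simp add: bqf_act_mult[symmetric] inv)
  have cS: "c B \<in> ?T" if "B \<in> ?S" for B
    using that A by (auto simp: c_def bqf_act_mult QA intro!: Gamma0_mult Gamma0_adj2)
  have dT: "d B \<in> ?S" if "B \<in> ?T" for B
    using that A by (auto simp: d_def bqf_act_mult QA intro!: Gamma0_mult Gamma0_adj2)
  have T: "?T = c ` ?S"
    using cS dT cd by (metis (no_types, lifting) image_eqI image_subsetI subsetI subset_antisym)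
  have cl: "?r `` {B} = {B, - B}" for B by auto
  have q: "X // ?r = (\<lambda>B. {B, - B}) ` X" for X
    by (auto simp: quotient_def cl)
  have "Gamma0_stab p (bqf_act Q A) = (\<lambda>B. {c B, - c B}) ` ?S"
    unfolding Gamma0_stab_def q T image_image ..
  also have "\<dots> = (`) c ` Gamma0_stab p Q"
    unfolding Gamma0_stab_def q image_image by (simp add: cu)
  finally have "Gamma0_stab p (bqf_act Q A) = (`) c ` Gamma0_stab p Q" .
  moreover have "inj c" using dc by (metis injI)
  ultimately show ?thesis
    by (metis card_image inj_on_subset inj_on_image subset_UNIV)
qed

lemma card_Gamma0_stab_class:
  assumes "C \<in> bqf_classes p n" "Q \<in> C" "R \<in> C"
  shows "card (Gamma0_stab p Q) = card (Gamma0_stab p R)"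
proof -
  have "(Q, R) \<in> bqf_equiv p n"
    using assms quotient_eq_iff[OF equiv_bqf_equiv] unfolding bqf_classes_def by blast
  then obtain A where "A \<in> Gamma0 p" "R = bqf_act Q A"
    unfolding bqf_equiv_def by blast
  thus ?thesis by (simp only: card_Gamma0_stab_act)
qed

lemma bqf_reduce:
  assumes "bqf_disc Q < 0"
  obtains A a b c where "det A = 1" "bqf_act Q A = (a, b, c)" "\<bar>b\<bar> \<le> \<bar>a\<bar>" "\<bar>a\<bar> \<le> \<bar>c\<bar>"
proof -
  have "\<exists>A. det A = 1 \<and> (\<forall>B. det B = 1 \<longrightarrow> nat \<bar>fst (bqf_act Q A)\<bar> \<le> nat \<bar>fst (bqf_act Q B)\<bar>)"
    by (rule ex_has_least_nat[where k = "mat 1"]) simp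
  then obtain A where A: "det A = 1"
    and least: "\<And>B. det B = 1 \<Longrightarrow> \<bar>fst (bqf_act Q A)\<bar> \<le> \<bar>fst (bqf_act Q B)\<bar>"
    by fastforce
  obtain a b c where abc: "bqf_act Q A = (a, b, c)" by (cases "bqf_act Q A")
  have "bqf_disc (bqf_act Q A) < 0" using assms A by (simp add: bqf_disc_act)
  hence a0: "a \<noteq> 0" using abc by auto
  define q where "q = (b + \<bar>a\<bar>) div (2 * \<bar>a\<bar>)"
  define k where "k = - q * sgn a"
  have "2 * \<bar>a\<bar> * q + (b + \<bar>a\<bar>) mod (2 * \<bar>a\<bar>) = b + \<bar>a\<bar>" by (simp add: q_def)
  moreover have "0 \<le> (b + \<bar>a\<bar>) mod (2 * \<bar>a\<bar>)" "(b + \<bar>a\<bar>) mod (2 * \<bar>a\<bar>) < 2 * \<bar>a\<bar>"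
    using a0 by simp_all
  moreover have "2 * a * k = - (2 * \<bar>a\<bar> * q)"
    by (simp add: k_def abs_sgn)
  ultimately have b: "\<bar>b + 2 * a * k\<bar> \<le> \<bar>a\<bar>" by linarith
  define T :: "int ^ 2 ^ 2" where "T = vector [vector [1, k], vector [0, 1]]"
  define S :: "int ^ 2 ^ 2" where "S = vector [vector [0, -1], vector [1, 0]]"
  define c' where "c' = a * k\<^sup>2 + b * k + c"
  have T: "det T = 1" and S: "det S = 1" by (simp_all add: T_def S_def det_2)
  have QT: "bqf_act Q (A ** T) = (a, b + 2 * a * k, c')"
    by (simp add: bqf_act_mult abc T_def c'_def algebra_simps)
  have "bqf_act Q ((A ** T) ** S) = bqf_act (a, b + 2 * a * k, c') S"
    by (simp only: bqf_act_mult[of Q "A ** T"] QT)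
  hence "fst (bqf_act Q ((A ** T) ** S)) = c'" by (simp add: S_def)
  moreover have "\<bar>fst (bqf_act Q A)\<bar> \<le> \<bar>fst (bqf_act Q ((A ** T) ** S))\<bar>"
    using A T S by (intro least) (simp add: det_mul)
  ultimately have "\<bar>a\<bar> \<le> \<bar>c'\<bar>" using abc by simp
  moreover have "det (A ** T) = 1" using A T by (simp add: det_mul)
  ultimately show thesis using that QT b by blast
qed

lemma bqf_reduced_bound:
  assumes "bqf_disc (a, b, c) = n" "n < 0" "\<bar>b\<bar> \<le> \<bar>a\<bar>" "\<bar>a\<bar> \<le> \<bar>c\<bar>"
  shows "\<bar>a\<bar> \<le> -n" "\<bar>b\<bar> \<le> -n" "\<bar>c\<bar> \<le> -n"
proof -
  have eq: "4 * (a * c) = b\<^sup>2 - n" using assms(1) by simp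
  have "0 < a * c" using eq assms(2) zero_le_power2[of b] by linarith
  hence ac: "a * c = \<bar>a\<bar> * \<bar>c\<bar>" and nz: "a \<noteq> 0" "c \<noteq> 0"
    by (simp_all add: abs_mult[symmetric]) auto
  have "b\<^sup>2 = \<bar>b\<bar> * \<bar>b\<bar>" by (simp add: power2_eq_square)
  also have "\<dots> \<le> \<bar>a\<bar> * \<bar>c\<bar>" using assms by (intro mult_mono) auto
  finally have le: "\<bar>a\<bar> * \<bar>c\<bar> \<le> -n" using eq ac \<open>0 < a * c\<close> by linarith
  have "\<bar>a\<bar> * 1 \<le> \<bar>a\<bar> * \<bar>c\<bar>" "1 * \<bar>c\<bar> \<le> \<bar>a\<bar> * \<bar>c\<bar>"
    using nz by (intro mult_mono; simp)+
  thus "\<bar>a\<bar> \<le> -n" "\<bar>b\<bar> \<le> -n" "\<bar>c\<bar> \<le> -n" using le assms(3) by linarith+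
qed

theorem finite_bqf_classes:
  assumes "p > 0" "n < 0"
  shows "finite (bqf_classes p n)"
proof -
  let ?B = "{n..-n} \<times> {n..-n} \<times> {n..-n}"
  have "\<exists>A. det A = 1 \<and> bqf_act Q A \<in> ?B" if Q: "Q \<in> bqf_level p n" for Q
  proof -
    have d: "bqf_disc Q = n" using Q by (auto simp: bqf_level_def)
    then obtain A a b c where A: "det A = 1" "bqf_act Q A = (a, b, c)" "\<bar>b\<bar> \<le> \<bar>a\<bar>" "\<bar>a\<bar> \<le> \<bar>c\<bar>"
      using bqf_reduce[of Q] assms(2) by metis
    have "bqf_disc (a, b, c) = n" using bqf_disc_act[of Q A] A d by simp
    from bqf_reduced_bound[OF this assms(2) A(3,4)] A(1,2) show ?thesis
      by (intro exI[of _ A]) auto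
  qed
  then obtain f where f: "\<And>Q. Q \<in> bqf_level p n \<Longrightarrow> det (f Q) = 1"
      "\<And>Q. Q \<in> bqf_level p n \<Longrightarrow> bqf_act Q (f Q) \<in> ?B"
    by metis
  define key where "key = (\<lambda>Q. (bqf_act Q (f Q), f Q $ 2 $ 1 mod int p, f Q $ 2 $ 2 mod int p))"
  have "key ` bqf_level p n \<subseteq> ?B \<times> {0..<int p} \<times> {0..<int p}"
  proof (rule image_subsetI)
    fix Q assume "Q \<in> bqf_level p n"
    thus "key Q \<in> ?B \<times> {0..<int p} \<times> {0..<int p}"
      using f(2)[of Q] assms(1) unfolding key_def by simp
  qed
  hence fin: "finite (key ` bqf_level p n)"
    by (rule finite_subset) simp
  have eq: "bqf_equiv p n `` {Q} = bqf_equiv p n `` {R}"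
    if Q: "Q \<in> bqf_level p n" and R: "R \<in> bqf_level p n" and k: "key Q = key R" for Q R
  proof -
    define g where "g = f Q ** adj2 (f R)"
    have "bqf_act Q g = bqf_act (bqf_act R (f R)) (adj2 (f R))"
      using k by (simp add: g_def bqf_act_mult key_def)
    also have "\<dots> = R" using f(1)[OF R] by (simp add: bqf_act_mult[symmetric] adj2_inverse)
    finally have "R = bqf_act Q g" by simp
    moreover have "g \<in> Gamma0 p"
    proof -
      have "[f Q $ 2 $ 1 * f R $ 2 $ 2 = f R $ 2 $ 1 * f Q $ 2 $ 2] (mod int p)"
        using k by (intro cong_mult) (simp_all add: key_def cong_def)
      hence "int p dvd g $ 2 $ 1"
        by (simp add: g_def mat2_mult cong_iff_dvd_diff algebra_simps)
      thus ?thesis using f(1)[OF Q] f(1)[OF R] by (simp add: Gamma0_def g_def det_mul)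
    qed
    ultimately have "(Q, R) \<in> bqf_equiv p n" using Q by (auto simp: bqf_equiv_def)
    thus ?thesis using equiv_class_eq[OF equiv_bqf_equiv] by blast
  qed
  have "bqf_classes p n =
      (\<lambda>k. bqf_equiv p n `` {inv_into (bqf_level p n) key k}) ` key ` bqf_level p n"
  proof -
    have "bqf_equiv p n `` {Q} = bqf_equiv p n `` {inv_into (bqf_level p n) key (key Q)}"
      if "Q \<in> bqf_level p n" for Q
      using that by (intro eq) (auto simp: inv_into_into f_inv_into_f)
    thus ?thesis by (auto simp: bqf_classes_def quotient_def image_image simp del: Image_singleton_iff)
  qed
  thus ?thesis using fin by simp
qed

lemma finite_Gamma0_stab:
  assumes "bqf_disc Q < 0"
  shows "finite (Gamma0_stab p Q)"
proof -
  obtain a b c where Q: "Q = (a, b, c)" by (cases Q)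
  have bound: "\<bar>x\<bar> \<le> 4 * u\<^sup>2 * (1 + \<bar>b\<bar>) \<and> \<bar>y\<bar> \<le> 4 * u\<^sup>2 * (1 + \<bar>b\<bar>)"
    if e: "u * x\<^sup>2 + b * x * y + v * y\<^sup>2 = u" and d: "b\<^sup>2 - 4 * u * v < 0" for u v x y :: int
  proof -
    have u0: "u \<noteq> 0" using d by auto
    have "4 * u\<^sup>2 = 4 * u * (u * x\<^sup>2 + b * x * y + v * y\<^sup>2)"
      unfolding e by (simp add: power2_eq_square)
    also have "\<dots> = (2 * u * x + b * y)\<^sup>2 + (4 * u * v - b\<^sup>2) * y\<^sup>2"
      by (simp add: power2_eq_square algebra_simps)
    finally have s: "4 * u\<^sup>2 = (2 * u * x + b * y)\<^sup>2 + (4 * u * v - b\<^sup>2) * y\<^sup>2" .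
    have sq: "\<bar>z\<bar> \<le> z\<^sup>2" for z :: int
      by (metis abs_ge_zero abs_le_zero_iff abs_of_nonneg mult_le_cancel_left1 not_less
          power2_abs power2_eq_square zero_le_power2 zero_less_abs_iff int_one_le_iff_zero_less)
    have "1 * y\<^sup>2 \<le> (4 * u * v - b\<^sup>2) * y\<^sup>2" using d by (intro mult_right_mono) auto
    hence y: "\<bar>y\<bar> \<le> 4 * u\<^sup>2" and w: "\<bar>2 * u * x + b * y\<bar> \<le> 4 * u\<^sup>2"
      using s sq[of y] sq[of "2 * u * x + b * y"] zero_le_power2[of y]
        zero_le_power2[of "2 * u * x + b * y"] by linarith+
    have by': "\<bar>b * y\<bar> \<le> \<bar>b\<bar> * (4 * u\<^sup>2)"
      unfolding abs_mult using y by (intro mult_left_mono) auto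
    have "1 * \<bar>x\<bar> \<le> \<bar>2 * u\<bar> * \<bar>x\<bar>" using u0 by (intro mult_right_mono) auto
    hence "\<bar>x\<bar> \<le> \<bar>2 * u * x\<bar>" by (simp add: abs_mult)
    also have "\<dots> \<le> 4 * u\<^sup>2 + \<bar>b\<bar> * (4 * u\<^sup>2)" using w by' by linarith
    finally have "\<bar>x\<bar> \<le> 4 * u\<^sup>2 * (1 + \<bar>b\<bar>)" by (simp add: algebra_simps)
    moreover have "4 * u\<^sup>2 * 1 \<le> 4 * u\<^sup>2 * (1 + \<bar>b\<bar>)" by (intro mult_left_mono) auto
    ultimately show ?thesis using y by simp
  qed
  define M where "M = 4 * a\<^sup>2 * (1 + \<bar>b\<bar>) + 4 * c\<^sup>2 * (1 + \<bar>b\<bar>)"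
  let ?S = "{A \<in> Gamma0 p. bqf_act Q A = Q}"
  let ?e = "\<lambda>A :: int ^ 2 ^ 2. (A$1$1, A$1$2, A$2$1, A$2$2)"
  have "?e ` ?S \<subseteq> {-M..M} \<times> {-M..M} \<times> {-M..M} \<times> {-M..M}"
  proof (rule image_subsetI)
    fix A assume A: "A \<in> ?S"
    have "\<bar>A$1$1\<bar> \<le> 4 * a\<^sup>2 * (1 + \<bar>b\<bar>) \<and> \<bar>A$2$1\<bar> \<le> 4 * a\<^sup>2 * (1 + \<bar>b\<bar>)"
      using A assms Q by (intro bound[where v = c]) auto
    moreover have "\<bar>A$2$2\<bar> \<le> 4 * c\<^sup>2 * (1 + \<bar>b\<bar>) \<and> \<bar>A$1$2\<bar> \<le> 4 * c\<^sup>2 * (1 + \<bar>b\<bar>)"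
      using A assms Q by (intro bound[where v = a]) (auto simp: algebra_simps)
    moreover have "0 \<le> 4 * a\<^sup>2 * (1 + \<bar>b\<bar>)" "0 \<le> 4 * c\<^sup>2 * (1 + \<bar>b\<bar>)" by simp_all
    ultimately have "\<bar>A$1$1\<bar> \<le> M" "\<bar>A$1$2\<bar> \<le> M" "\<bar>A$2$1\<bar> \<le> M" "\<bar>A$2$2\<bar> \<le> M"
      unfolding M_def by linarith+
    thus "?e A \<in> {-M..M} \<times> {-M..M} \<times> {-M..M} \<times> {-M..M}" by (simp add: abs_le_iff)
  qed
  hence "finite (?e ` ?S)" by (rule finite_subset) simp
  moreover have "inj_on ?e ?S" by (auto simp: inj_on_def vec_eq_iff forall_2)
  ultimately have "finite ?S" by (rule finite_imageD)
  thus ?thesis by (simp add: Gamma0_stab_def quotient_def)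
qed

section \<open>Kronecker symbol and Dirichlet L-functions\<close>

definition fundamental_discriminant :: "int \<Rightarrow> bool" where
  "fundamental_discriminant t \<longleftrightarrow>
     [t = 1] (mod 4) \<and> squarefree t \<or>
     (\<exists>k. t = 4 * k \<and> ([k = 2] (mod 4) \<or> [k = 3] (mod 4)) \<and> squarefree k)"

definition kronecker_prime :: "int \<Rightarrow> nat \<Rightarrow> int" where
  "kronecker_prime t q =
     (if q = 2 then (if even t then 0 else if t mod 8 \<in> {1, 7} then 1 else - 1)
      else Legendre t (int q))"

definition kronecker :: "int \<Rightarrow> nat \<Rightarrow> int" where
  "kronecker t n =
     (if n = 0 then (if \<bar>t\<bar> = 1 then 1 else 0)
      else prod_mset (image_mset (kronecker_prime t) (prime_factorization n)))"

definition moebius :: "nat \<Rightarrow> int" where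
  "moebius n = (if squarefree n then (- 1) ^ card (prime_factors n) else 0)"

text \<open>The analytic continuation of \<open>\<Sum>\<^sub>n \<chi>(n) n\<^sup>-\<^sup>s\<close> to the whole plane. This is meant for
  nonprincipal characters only, whose L-functions are entire.\<close>

definition dirichlet_L_continuation :: "(nat \<Rightarrow> int) \<Rightarrow> (complex \<Rightarrow> complex) \<Rightarrow> bool" where
  "dirichlet_L_continuation chi f \<longleftrightarrow>
     f holomorphic_on UNIV \<and>
     (\<forall>s. Re s > 1 \<longrightarrow> (\<lambda>n. of_int (chi (Suc n)) / of_nat (Suc n) powr s) sums f s)"

definition dirichlet_L :: "(nat \<Rightarrow> int) \<Rightarrow> complex \<Rightarrow> complex" where
  "dirichlet_L chi = (THE f. dirichlet_L_continuation chi f)"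

lemma dirichlet_L_continuation_unique:
  assumes "dirichlet_L_continuation chi f" "dirichlet_L_continuation chi g"
  shows "f = g"
proof
  fix s
  have "f w = g w" if "w \<in> {s. Re s > 1}" for w
    using assms that sums_unique2 unfolding dirichlet_L_continuation_def by blast
  moreover have "open {s. Re s > 1}" by (simp add: open_halfspace_Re_gt)
  moreover have "{s. Re s > 1} \<noteq> {}" by (auto intro!: exI[of _ 2])
  ultimately show "f s = g s"
    using assms unfolding dirichlet_L_continuation_def
    by (intro analytic_continuation_open[of "{s. Re s > 1}" UNIV f g s]) auto
qed

section \<open>Generalized Hurwitz class numbers\<close>

text \<open>For \<open>N > 0\<close> with \<open>-N \<equiv> 0, 1 (mod 4)\<close> the decomposition \<open>-N = t m\<^sup>2\<close> with \<open>t\<close> a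
  fundamental discriminant and \<open>m > 0\<close> exists and is unique; see \<open>ex1_disc_decomp\<close>.\<close>

definition disc_decomp :: "int \<Rightarrow> int \<times> nat \<Rightarrow> bool" where
  "disc_decomp N = (\<lambda>(t, m). fundamental_discriminant t \<and> m > 0 \<and> - N = t * (int m)\<^sup>2)"

lemma sq_dvd_fundamental_discriminant:
  assumes "fundamental_discriminant t" "v\<^sup>2 dvd t" "v > 0"
  shows "v = 1 \<or> (v = 2 \<and> (\<exists>k. t = 4 * k \<and> ([k = 2] (mod 4) \<or> [k = 3] (mod 4))))"
proof (cases "squarefree t")
  case True
  hence "v dvd 1" using assms(2) by (simp add: squarefree_def)
  thus ?thesis using assms(3) by simp
next
  case False
  then obtain k where k: "t = 4 * k" "[k = 2] (mod 4) \<or> [k = 3] (mod 4)" and sq: "squarefree k"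
    using assms(1) unfolding fundamental_discriminant_def by blast
  show ?thesis
  proof (cases "even v")
    case True
    then obtain w where w: "v = 2 * w" by auto
    have "w\<^sup>2 dvd k" using assms(2) by (simp add: w k(1) power_mult_distrib)
    hence "w dvd 1" using sq by (simp add: squarefree_def)
    thus ?thesis using k w assms(3) by auto
  next
    case False
    hence "coprime (v\<^sup>2) (2\<^sup>2)" by (simp only: coprime_power_left_iff coprime_power_right_iff) simp
    hence "coprime (v\<^sup>2) 4" by (simp only: power2_eq_square) simp
    hence "v\<^sup>2 dvd k" using assms(2) k(1) coprime_dvd_mult_right_iff by blast
    hence "v dvd 1" using sq by (simp add: squarefree_def)
    thus ?thesis using assms(3) by simp
  qed
qed

lemma fundamental_discriminant_mod_4:
  "fundamental_discriminant t \<Longrightarrow> t mod 4 = 0 \<or> t mod 4 = 1"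
  by (auto simp: fundamental_discriminant_def cong_def)

lemma disc_decomp_unique:
  assumes "disc_decomp N (t, m)" "disc_decomp N (t', m')"
  shows "t = t' \<and> m = m'"
proof -
  have t: "fundamental_discriminant t" "m > 0" "- N = t * (int m)\<^sup>2"
    and t': "fundamental_discriminant t'" "m' > 0" "- N = t' * (int m')\<^sup>2"
    using assms by (auto simp: disc_decomp_def)
  define g where "g = gcd (int m) (int m')"
  have "g > 0" using t(2) by (simp add: g_def)
  obtain u v where uv: "int m = u * g" "int m' = v * g" "coprime u v"
    using gcd_coprime_exists[of "int m" "int m'"] \<open>g > 0\<close> unfolding g_def by (metis less_irrefl)
  have uv0: "u > 0" "v > 0"
    using t(2) t'(2) uv \<open>g > 0\<close> by (metis of_nat_0_less_iff zero_less_mult_pos2)+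
  have "(t * u\<^sup>2) * g\<^sup>2 = (t' * v\<^sup>2) * g\<^sup>2"
    using t(3) t'(3) unfolding uv(1,2) power_mult_distrib mult.assoc by linarith
  hence e: "t * u\<^sup>2 = t' * v\<^sup>2" using \<open>g > 0\<close> by simp
  have c: "coprime (u\<^sup>2) (v\<^sup>2)" using uv(3) by simp
  have "v\<^sup>2 dvd t * u\<^sup>2" "u\<^sup>2 dvd t' * v\<^sup>2" using e by (metis dvd_triv_right)+
  hence d: "v\<^sup>2 dvd t" "u\<^sup>2 dvd t'"
    using c by (simp_all add: coprime_dvd_mult_left_iff coprime_commute)
  note U = sq_dvd_fundamental_discriminant[OF t'(1) d(2) uv0(1)]
    and V = sq_dvd_fundamental_discriminant[OF t(1) d(1) uv0(2)]
  note M = fundamental_discriminant_mod_4[OF t(1)] fundamental_discriminant_mod_4[OF t'(1)]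
  have "\<not> (u = 2 \<and> v = 2)" using uv(3) by auto
  moreover have False if "u = 1" "v = 2"
    using V M e that by (auto simp: cong_def)
  moreover have False if "u = 2" "v = 1"
    using U M e that by (auto simp: cong_def)
  ultimately have "u = 1" "v = 1" using U V by auto
  thus ?thesis using e uv by simp
qed

lemma disc_decomp_exists:
  assumes "N > 0" "- N mod 4 = 0 \<or> - N mod 4 = 1"
  shows "\<exists>t m. disc_decomp N (t, m)"
  using assms
proof (induction "nat N" arbitrary: N rule: less_induct)
  case less
  have step: ?case
    if q: "q > 1" and N: "N = q\<^sup>2 * M" and M: "- M mod 4 = 0 \<or> - M mod 4 = 1" for q M
  proof -
    have "M > 0" using N less.prems(1) q by (simp add: zero_less_mult_iff)
    moreover have "1 * M < q\<^sup>2 * M"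
      using q \<open>M > 0\<close> by (intro mult_strict_right_mono) auto
    ultimately obtain t m where "disc_decomp M (t, m)"
      using less.hyps[of M] M N less.prems(1) by (metis mult_1 nat_mono_iff)
    hence "disc_decomp N (t, nat q * m)"
      using q N by (simp add: disc_decomp_def power_mult_distrib minus_mult_right del: mult_minus_right)
    thus ?thesis by blast
  qed
  have odd_sq: "[q\<^sup>2 = 1] (mod 4)" if oq: "odd q" for q :: int
  proof -
    obtain k where "q = 2 * k + 1" using oq by (rule oddE)
    hence "q\<^sup>2 - 1 = 4 * (k\<^sup>2 + k)" by (simp add: power2_eq_square algebra_simps)
    thus ?thesis by (simp add: cong_iff_dvd_diff)
  qed
  have nonunit: "\<exists>q. q > 1 \<and> q\<^sup>2 dvd x" if nsq: "\<not> squarefree x" for x :: int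
  proof -
    obtain q where q: "q\<^sup>2 dvd x" "\<not> q dvd 1" using nsq unfolding squarefree_def by blast
    show ?thesis
    proof (cases "q = 0")
      case True
      thus ?thesis using q by (intro exI[of _ 2]) auto
    next
      case False
      thus ?thesis using q by (intro exI[of _ "\<bar>q\<bar>"]) auto
    qed
  qed
  have triv: "disc_decomp N (- N, 1)" if "fundamental_discriminant (- N)"
    using that by (simp add: disc_decomp_def)
  show ?case
  proof (cases "- N mod 4 = 1")
    case True
    show ?thesis
    proof (cases "squarefree (- N)")
      case sf: True
      thus ?thesis using True triv by (auto simp: fundamental_discriminant_def cong_def)
    next
      case False
      then obtain q where q: "q > 1" "q\<^sup>2 dvd - N" using nonunit by blast
      then obtain M where M: "N = q\<^sup>2 * M" by auto
      have "odd N" using True by presburger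
      hence "odd q" using M by auto
      have "[q\<^sup>2 * - M = 1 * - M] (mod 4)" by (intro cong_mult odd_sq \<open>odd q\<close>) simp
      hence "- M mod 4 = 1" using True M by (simp add: cong_def)
      thus ?thesis using step q(1) M by blast
    qed
  next
    case False
    hence "4 dvd N" using less.prems(2) by presburger
    then obtain K where K: "N = 4 * K" by auto
    show ?thesis
    proof (cases "- K mod 4 = 0 \<or> - K mod 4 = 1")
      case True
      thus ?thesis using step[of 2 K] K by simp
    next
      case K4: False
      hence K23: "- K mod 4 = 2 \<or> - K mod 4 = 3" by presburger
      show ?thesis
      proof (cases "squarefree (- K)")
        case True
        hence "fundamental_discriminant (- N)"
          using K K23 unfolding fundamental_discriminant_def
          by (intro disjI2 exI[of _ "- K"]) (auto simp: cong_def)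
        thus ?thesis using triv by blast
      next
        case False
        then obtain q where q: "q > 1" "q\<^sup>2 dvd - K" using nonunit by blast
        then obtain M where M: "K = q\<^sup>2 * M" by auto
        have "N = q\<^sup>2 * (4 * M)" using K M by simp
        thus ?thesis using step[of q "4 * M"] q(1) by simp
      qed
    qed
  qed
qed

lemma ex1_disc_decomp:
  assumes "N > 0" "- N mod 4 = 0 \<or> - N mod 4 = 1"
  shows "\<exists>!tm. disc_decomp N tm"
  using disc_decomp_exists[OF assms] disc_decomp_unique by (metis surj_pair)

definition disc_fund :: "int \<Rightarrow> int" where
  "disc_fund N = fst (THE tm. disc_decomp N tm)"

definition disc_cond :: "int \<Rightarrow> nat" where
  "disc_cond N = snd (THE tm. disc_decomp N tm)"

definition hurwitz_1p :: "nat \<Rightarrow> int \<Rightarrow> complex" where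
  "hurwitz_1p p N =
     (let t = disc_fund N; m = disc_cond N; chi = kronecker t in
      dirichlet_L chi 0 * ((1 - of_int (chi p) / of_nat p) / (1 - 1 / (of_nat p)\<^sup>2)) *
      (\<Sum>a | a dvd m \<and> coprime a p. of_int (moebius a) * of_int (chi a) *
         (\<Sum>d | d dvd m div a \<and> coprime (m div (a * d)) p. of_nat d)))"

definition hurwitz_pp :: "nat \<Rightarrow> int \<Rightarrow> complex" where
  "hurwitz_pp p N =
     (let t = disc_fund N; m = disc_cond N; chi = kronecker t in
      dirichlet_L chi 0 * (1 - of_int (chi p)) *
      (\<Sum>a | a dvd m \<and> coprime a p. of_int (moebius a) * of_int (chi a) *
         (\<Sum>d | d dvd m div a \<and> coprime d p. of_nat d)))"

end

theory Submission
  imports Defs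
begin

text \<open>
  Write \<open>M(n)\<close> for the sum of \<open>1/|Stab|\<close> over the \<open>SL\<^sub>2(\<int>)\<close>-classes of all forms of
  discriminant \<open>n\<close>, with stabilizers in \<open>SL\<^sub>2(\<int>)\<close>. Counting integer matrices that carry one
  form to another, once from each side, expresses the level \<open>p\<close> sum through the number of roots
  of a form modulo \<open>p\<close>, relates \<open>M(n q\<^sup>2)\<close> to \<open>M(n)\<close> and \<open>M(n / q\<^sup>2)\<close> (index \<open>q\<close>
  sublattices), and shows that the weighted number of representations of \<open>N\<close> by the forms of
  fundamental discriminant \<open>t\<close> is \<open>2 \<Sum>\<^sub>d\<^sub>|\<^sub>N \<chi>\<^sub>t(d)\<close>.

  It remains to see that \<open>M(t) = L(0, \<chi>\<^sub>t)\<close>. Put \<open>T(\<epsilon>) = \<Sum>\<^sub>v exp(-\<epsilon>|Q(v)|)\<close>, the sum over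
  the lattice including \<open>v = 0\<close>. The combination \<open>4 T(4 \<epsilon>) - T(\<epsilon>)\<close> is a sum of lattice sums
  with alternating signs, so it is \<open>O(\<surd>\<epsilon>)\<close> by third differences; no Poisson summation is needed.
  On the other side it equals, after summing over classes,
  \<open>3 M(t) + 2 \<Sum>\<^sub>N (\<Sum>\<^sub>d\<^sub>|\<^sub>N \<chi>\<^sub>t(d)) (4 exp(-4 \<epsilon> N) - exp(-\<epsilon> N))\<close>, and the Lambert series tends
  to \<open>- 3/2 L(0, \<chi>\<^sub>t)\<close> by Abel summation. The same repeated summation by parts continues
  \<open>L(s, \<chi>\<^sub>t)\<close> to the whole plane.
\<close>

section \<open>Periodicity of the Kronecker symbol\<close>

text \<open>Near \<epsilon> = 0 each theta series behaves like c/\<epsilon>, with c from the area of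
  an ellipse, and the Lambert series of the divisor sums like L(1)/\<epsilon>. The weight 4 at 4
  \<epsilon> cancels both poles at once, so neither the area, nor L(1), nor a functional equation
  enters; only constant terms are compared. On the theta side the constant comes from v = 0, which
  contributes 4 - 1 = 3; on the other side it comes from \<zeta>(0) L(0) with \<zeta>(0) = -1/2.

  On the algebraic side the obstacle is that classes have no canonical representatives, which makes
  maps between sets of classes awkward. Instead, the number of matrices carrying a fixed Q to R,
  weighted by 1/|Stab(R)| and summed over representatives R, is 1
  (\<open>transporter_class_sum\<close>). Inserting this 1 and exchanging two class sums turns every
  correspondence into a count of cosets.

  The masses, the representation numbers, the divisor sums and the sums in the Hurwitz numbers all
  obey recursions along the powers of a prime, so the identities between them follow by induction,
  one prime factor at a time.\<close>

lemma eq_of_cong_of_trichotomy: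
  fixes x y :: int
  assumes "[x = y] (mod m)" "m > 2" "x \<in> {-1, 0, 1}" "y \<in> {-1, 0, 1}"
  shows "x = y"
proof -
  have "m dvd x - y" using assms(1) by (simp add: cong_iff_dvd_diff)
  moreover have "\<bar>x - y\<bar> < m" using assms by auto
  ultimately show ?thesis using zdvd_imp_le[of m "\<bar>x - y\<bar>"] by (cases "x = y") auto
qed

lemma Legendre_range: "Legendre a p \<in> {-1, 0, 1}"
  by (simp add: Legendre_def)

lemma Legendre_cong: "[a = b] (mod p) \<Longrightarrow> Legendre a p = Legendre b p"
  by (simp add: Legendre_def QuadRes_def cong_def)

text \<open>Euler's criterion makes the two sides congruent modulo p, and values in {-1, 0, 1} that
  agree modulo p > 2 are equal.\<close>

lemma Legendre_mult:
  assumes "prime p" "2 < p"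
  shows "Legendre (a * b) (int p) = Legendre a (int p) * Legendre b (int p)"
proof (rule eq_of_cong_of_trichotomy[where m = "int p"])
  have "[Legendre (a * b) (int p) = (a * b) ^ ((p - 1) div 2)] (mod int p)"
    using euler_criterion[OF assms] .
  moreover have "[Legendre a (int p) * Legendre b (int p) = (a * b) ^ ((p - 1) div 2)] (mod int p)"
    unfolding power_mult_distrib
    using euler_criterion[OF assms, of a] euler_criterion[OF assms, of b] by (rule cong_mult)
  ultimately show "[Legendre (a * b) (int p) = Legendre a (int p) * Legendre b (int p)] (mod int p)"
    using cong_trans cong_sym by blast
  show "Legendre (a * b) (int p) \<in> {-1, 0, 1}" by (rule Legendre_range)
  show "Legendre a (int p) * Legendre b (int p) \<in> {-1, 0, 1}"
    using Legendre_range[of a "int p"] Legendre_range[of b "int p"] by auto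
qed (use assms in auto)

lemma int_mod_eq_iff: "int p mod numeral k = numeral l \<longleftrightarrow> p mod numeral k = numeral l"
  "int p mod numeral k = 1 \<longleftrightarrow> p mod numeral k = 1"
proof -
  have "int p mod numeral k = int (p mod numeral k)" by (simp add: zmod_int)
  thus "int p mod numeral k = numeral l \<longleftrightarrow> p mod numeral k = numeral l"
    "int p mod numeral k = 1 \<longleftrightarrow> p mod numeral k = 1"
    by (metis of_nat_eq_iff of_nat_numeral, metis of_nat_eq_iff of_nat_1)
qed

lemma Legendre_minus_one:
  assumes "prime p" "2 < p"
  shows "Legendre (- 1) (int p) = (if p mod 4 = 1 then 1 else - 1)"
proof -
  have "odd p" using assms prime_odd_nat by blast
  hence "(-1 :: int) ^ ((p - 1) div 2) = (if p mod 4 = 1 then 1 else - 1)"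
  proof (cases "p mod 4 = 1")
    case True
    hence "even ((p - 1) div 2)" by presburger
    thus ?thesis using True by simp
  next
    case False
    hence "odd ((p - 1) div 2)" using \<open>odd p\<close> by presburger
    thus ?thesis using False by simp
  qed
  thus ?thesis
    using euler_criterion[OF assms, of "-1"] assms Legendre_range[of "-1" "int p"]
    by (intro eq_of_cong_of_trichotomy[where m = "int p"]) auto
qed

text \<open>Gauss's lemma with H = (p - 1)/2: the multiples 2 x with 0 < x \<le> H need no reduction
  modulo p, and those beyond H are the ones with x > H div 2. Their number H - H div 2 is even
  exactly when p is 1 or 7 modulo 8.\<close>

lemma Legendre_two:
  assumes "prime p" "2 < p"
  shows "Legendre 2 (int p) = (if p mod 8 \<in> {1, 7} then 1 else - 1)"
proof -
  have "odd p" using assms prime_odd_nat by blast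
  interpret GAUSS p 2
    using assms by unfold_locales (auto simp: cong_0_iff zdvd_not_zless)
  define H where "H = (int p - 1) div 2"
  have H: "int p = 2 * H + 1" using \<open>odd p\<close> unfolding H_def by presburger
  have "C = (\<lambda>x. 2 * x) ` {0<..H}"
    unfolding C_def B_def A_def H_def[symmetric] image_image
    by (rule image_cong) (use H in auto)
  hence "E = (\<lambda>x. 2 * x) ` {H div 2<..H}"
    unfolding E_def H_def[symmetric] using H assms(2) by (auto simp: image_iff) 
  hence "card E = card {H div 2<..H}"
    by (simp add: card_image inj_on_def)
  hence c: "card E = nat (H - H div 2)" by simp
  have "even (card E) \<longleftrightarrow> even (H - H div 2)" 
    unfolding c using H assms(2) by (subst even_nat_iff) auto
  also have "\<dots> \<longleftrightarrow> int p mod 8 = 1 \<or> int p mod 8 = 7"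
    unfolding H by presburger
  also have "\<dots> \<longleftrightarrow> p mod 8 \<in> {1, 7}" by (simp add: int_mod_eq_iff)
  finally show ?thesis using gauss_lemma by (auto simp: minus_one_power_iff)
qed

section \<open>Multiplicativity of the Kronecker symbol in both arguments\<close>

lemma kronecker_one [simp]: "kronecker t 1 = 1" "kronecker t (Suc 0) = 1"
  by (simp_all add: kronecker_def)

lemma kronecker_prime_eq: "prime q \<Longrightarrow> kronecker t q = kronecker_prime t q"
  by (simp add: kronecker_def prime_factorization_prime prime_gt_0_nat)

lemma kronecker_mult_right:
  "a > 0 \<Longrightarrow> b > 0 \<Longrightarrow> kronecker t (a * b) = kronecker t a * kronecker t b"
  by (simp add: kronecker_def prime_factorization_mult)

text \<open>Peeling off one prime factor at a time. In this way \<open>kronecker t\<close> is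
  recognised as an explicit periodic function: only values at primes have to be matched.\<close>

lemma kronecker_eqI:
  assumes "f 1 = 1" "\<And>a b. a > 0 \<Longrightarrow> b > 0 \<Longrightarrow> f (a * b) = f a * f b"
    "\<And>q. prime q \<Longrightarrow> f q = kronecker_prime t q" "n > 0"
  shows "kronecker t n = f n"
  using assms(4)
proof (induction n rule: prime_divisors_induct)
  case (factor q x)
  hence "x > 0" "q > 0" by (auto simp: prime_gt_0_nat)
  thus ?case using factor assms(2)[of q x] assms(3)[of q]
    by (simp add: kronecker_mult_right kronecker_prime_eq)
qed (use assms(1) in auto)

lemma mod8_mult_pm1:
  fixes s t :: int
  assumes "odd s" "odd t"
  shows "(s * t) mod 8 \<in> {1, 7} \<longleftrightarrow> (s mod 8 \<in> {1, 7} \<longleftrightarrow> t mod 8 \<in> {1, 7})"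
proof -
  have "s mod 8 \<in> {1,3,5,7}" "t mod 8 \<in> {1,3,5,7}" using assms by auto presburger+
  moreover have "(s * t) mod 8 = ((s mod 8) * (t mod 8)) mod 8" by (simp add: mod_mult_eq)
  ultimately show ?thesis by auto
qed

lemma kronecker_prime_mult:
  assumes "prime q"
  shows "kronecker_prime (s * t) q = kronecker_prime s q * kronecker_prime t q"
proof (cases "q = 2")
  case True
  thus ?thesis using mod8_mult_pm1[of s t] by (auto simp: kronecker_prime_def)
next
  case False
  hence "q > 2" using prime_ge_2_nat[OF assms] by simp
  thus ?thesis using Legendre_mult[OF assms] by (simp add: kronecker_prime_def)
qed

lemma kronecker_mult_left:
  assumes "n > 0"
  shows "kronecker (s * t) n = kronecker s n * kronecker t n"
  using assms
  by (intro kronecker_eqI[where f = "\<lambda>n. kronecker s n * kronecker t n"])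
     (simp_all add: kronecker_mult_right kronecker_prime_eq kronecker_prime_mult)

text \<open>M is some period, not necessarily the conductor, which makes the property stable under
  products. The parity of \<psi> is carried along because for t < 0 it forces the sum over a period
  to vanish.\<close>

definition periodic_kronecker :: "int \<Rightarrow> bool" where
  "periodic_kronecker t \<longleftrightarrow> (\<exists>\<psi> M. M > 0 \<and> (\<forall>x. \<psi> (x + int M) = \<psi> x) \<and>
     (\<forall>x. \<psi> (- x) = sgn t * \<psi> x) \<and> (\<forall>n>0. kronecker t n = \<psi> (int n)))"

lemma periodic_add_mult:
  fixes \<psi> :: "int \<Rightarrow> 'a"
  assumes "\<And>x. \<psi> (x + int M) = \<psi> x"
  shows "\<psi> (x + int M * int k) = \<psi> x"
proof (induction k)
  case (Suc k)
  thus ?case using assms[of "x + int M * int k"] by (simp add: algebra_simps)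
qed auto

lemma periodic_kronecker_mult:
  assumes "periodic_kronecker s" "periodic_kronecker t"
  shows "periodic_kronecker (s * t)"
proof -
  obtain \<psi> M where 1: "M > 0" "\<And>x. \<psi> (x + int M) = \<psi> x"
     "\<And>x. \<psi> (- x) = sgn s * \<psi> x" "\<And>n. n > 0 \<Longrightarrow> kronecker s n = \<psi> (int n)"
    using assms(1) unfolding periodic_kronecker_def by blast
  obtain \<phi> N where 2: "N > 0" "\<And>x. \<phi> (x + int N) = \<phi> x"
     "\<And>x. \<phi> (- x) = sgn t * \<phi> x" "\<And>n. n > 0 \<Longrightarrow> kronecker t n = \<phi> (int n)"
    using assms(2) unfolding periodic_kronecker_def by blast
  have "\<psi> (x + int (M * N)) = \<psi> x" "\<phi> (x + int (M * N)) = \<phi> x" for x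
    using periodic_add_mult[of \<psi> M x N, OF 1(2)] periodic_add_mult[of \<phi> N x M, OF 2(2)]
    by (simp_all add: mult.commute)
  thus ?thesis unfolding periodic_kronecker_def using 1 2
    by (intro exI[of _ "\<lambda>x. \<psi> x * \<phi> x"] exI[of _ "M * N"])
       (simp add: kronecker_mult_left sgn_mult)
qed

section \<open>Characters of prime discriminants and their products\<close>

lemma Legendre_one: "prime p \<Longrightarrow> Legendre 1 (int p) = 1"
proof -
  assume "prime p"
  moreover have "QuadRes (int p) 1" unfolding QuadRes_def by (rule exI[of _ 1]) simp
  ultimately show ?thesis using prime_gt_1_nat[of p] by (simp add: Legendre_def cong_0_iff)
qed

lemma periodic_kronecker_one: "periodic_kronecker 1"
proof -
  have "kronecker 1 n = 1" if "n > 0" for n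
    using that by (intro kronecker_eqI) (auto simp: kronecker_prime_def Legendre_one)
  thus ?thesis unfolding periodic_kronecker_def
    by (intro exI[of _ "\<lambda>_. 1"] exI[of _ 1]) auto
qed

text \<open>For odd p the prime discriminant (-1)^((p - 1)/2) p, which is 1 modulo 4.\<close>

definition odd_prime_disc :: "nat \<Rightarrow> int" where
  "odd_prime_disc p = (if p mod 4 = 1 then int p else - int p)"

text \<open>Quadratic reciprocity with the signs absorbed into the discriminant: when p is 3 modulo
  4, the factor \<open>Legendre (- 1) (int q)\<close> cancels the sign of the reciprocity law. The
  case q = 2 is the supplementary law for 2, and at q = p both sides vanish.\<close>

lemma kronecker_prime_odd_prime_disc:
  assumes p: "prime p" "2 < p" and q: "prime q"
  shows "kronecker_prime (odd_prime_disc p) q = Legendre (int q) (int p)"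
proof -
  have "odd p" using p prime_odd_nat by blast
  show ?thesis
  proof (cases "q = 2")
    case True
    have "(- int p) mod 8 = 1 \<or> (- int p) mod 8 = 7 \<longleftrightarrow> int p mod 8 = 1 \<or> int p mod 8 = 7"
      by presburger
    thus ?thesis using \<open>odd p\<close> Legendre_two[OF p] True
      by (simp add: kronecker_prime_def odd_prime_disc_def int_mod_eq_iff)
  next
    case False
    hence q2: "q > 2" using prime_ge_2_nat[OF q] by simp
    have "odd q" using q q2 prime_odd_nat by blast
    show ?thesis
    proof (cases "q = p")
      case True
      thus ?thesis using False by (auto simp: kronecker_prime_def odd_prime_disc_def Legendre_def cong_0_iff)
    next
      case pq: False
      have qr: "Legendre (int p) (int q) * Legendre (int q) (int p) =
          (- 1) ^ ((p - 1) div 2 * ((q - 1) div 2))"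
        using Quadratic_Reciprocity[OF p q q2] pq by auto
      have e1: "even ((p - 1) div 2) \<longleftrightarrow> p mod 4 = 1" using \<open>odd p\<close> by presburger
      have e2: "even ((q - 1) div 2) \<longleftrightarrow> q mod 4 = 1" using \<open>odd q\<close> by presburger
      have m: "Legendre (- int p) (int q) = Legendre (- 1) (int q) * Legendre (int p) (int q)"
        using Legendre_mult[OF q q2, of "-1" "int p"] by simp
      have "\<not> q dvd p" "\<not> p dvd q" using pq p q primes_dvd_imp_eq by blast+
      hence "Legendre (int p) (int q) \<in> {-1, 1}" "Legendre (int q) (int p) \<in> {-1, 1}"
        by (auto simp: Legendre_def cong_0_iff)
      thus ?thesis
        using qr m Legendre_minus_one[OF q q2] False e1 e2
        by (auto simp: kronecker_prime_def odd_prime_disc_def minus_one_power_iff split: if_splits)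
    qed
  qed
qed

lemma periodic_kronecker_odd_prime_disc:
  assumes p: "prime p" "2 < p"
  shows "periodic_kronecker (odd_prime_disc p)"
  unfolding periodic_kronecker_def
proof (intro exI[of _ "\<lambda>x. Legendre x (int p)"] exI[of _ p] conjI allI impI)
  show "Legendre (x + int p) (int p) = Legendre x (int p)" for x
    by (rule Legendre_cong) (simp add: cong_def)
  show "Legendre (- x) (int p) = sgn (odd_prime_disc p) * Legendre x (int p)" for x
    using Legendre_mult[OF p, of "-1" x] Legendre_minus_one[OF p] p
    by (simp add: odd_prime_disc_def)
  show "kronecker (odd_prime_disc p) n = Legendre (int n) (int p)" if "n > 0" for n
    using kronecker_prime_odd_prime_disc[OF p] that
    by (intro kronecker_eqI[where f = "\<lambda>n. Legendre (int n) (int p)"])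
       (auto simp: Legendre_mult[OF p] Legendre_one p)
qed (use p in auto)

text \<open>\<open>chi4\<close> and \<open>chi8\<close> are the characters of the discriminants -4
  and 8; their product belongs to -8.\<close>

definition chi4 :: "int \<Rightarrow> int" where
  "chi4 x = (if even x then 0 else if x mod 4 = 1 then 1 else - 1)"

definition chi8 :: "int \<Rightarrow> int" where
  "chi8 x = (if even x then 0 else if x mod 8 \<in> {1, 7} then 1 else - 1)"

lemma chi4_mult: "chi4 (x * y) = chi4 x * chi4 y"
proof (cases "odd x \<and> odd y")
  case True
  hence "x mod 4 \<in> {1,3}" "y mod 4 \<in> {1,3}" by auto presburger+
  moreover have "(x * y) mod 4 = ((x mod 4) * (y mod 4)) mod 4" by (simp add: mod_mult_eq)
  ultimately show ?thesis using True by (auto simp: chi4_def)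
qed (auto simp: chi4_def)

lemma chi8_mult: "chi8 (x * y) = chi8 x * chi8 y"
  using mod8_mult_pm1[of x y] by (auto simp: chi8_def)

text \<open>The period 8, twice the minimal one, is shared with \<open>chi8\<close> and hence with
  the product.\<close>

lemma chi4_period: "chi4 (x + 8) = chi4 x"
proof -
  have "(x + 8) mod 4 = x mod 4" by presburger
  thus ?thesis by (simp add: chi4_def)
qed

lemma chi8_period: "chi8 (x + 8) = chi8 x"
  by (simp add: chi8_def)

lemma chi4_minus: "chi4 (- x) = - chi4 x"
proof -
  have "odd x \<Longrightarrow> (- x) mod 4 = 1 \<longleftrightarrow> x mod 4 \<noteq> 1" by presburger
  thus ?thesis by (simp add: chi4_def)
qed

lemma chi8_minus: "chi8 (- x) = chi8 x"
proof -
  have "(- x) mod 8 = 1 \<or> (- x) mod 8 = 7 \<longleftrightarrow> x mod 8 = 1 \<or> x mod 8 = 7" by presburger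
  thus ?thesis by (simp add: chi8_def)
qed

lemma Legendre_even_disc:
  assumes q: "prime q" "2 < q"
  shows "Legendre (- 1) (int q) = chi4 (int q)" "Legendre 2 (int q) = chi8 (int q)"
    "Legendre 4 (int q) = 1"
proof -
  have "odd q" using q prime_odd_nat by blast
  show 1: "Legendre (- 1) (int q) = chi4 (int q)" "Legendre 2 (int q) = chi8 (int q)"
    using Legendre_minus_one[OF q] Legendre_two[OF q] \<open>odd q\<close> by (simp_all add: chi4_def chi8_def int_mod_eq_iff)
  have "Legendre 4 (int q) = Legendre 2 (int q) * Legendre 2 (int q)"
    using Legendre_mult[OF q, of 2 2] by simp
  thus "Legendre 4 (int q) = 1" using 1(2) \<open>odd q\<close> by (simp add: chi8_def)
qed

lemma periodic_kronecker_even_prime_disc: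
  "periodic_kronecker (- 4)" "periodic_kronecker 8" "periodic_kronecker (- 8)"
proof -
  have *: "kronecker t n = f (int n)"
    if "n > 0" "f 1 = 1" "\<And>x y. f (x * y) = f x * f y" "f 2 = 0" "even t"
      "\<And>q. prime q \<Longrightarrow> 2 < q \<Longrightarrow> Legendre t (int q) = f (int q)" for f n t
  proof (rule kronecker_eqI[where f = "\<lambda>n. f (int n)"])
    show "f (int q) = kronecker_prime t q" if "prime q" for q
      using that \<open>f 2 = 0\<close> \<open>even t\<close> \<open>\<And>q. prime q \<Longrightarrow> 2 < q \<Longrightarrow> Legendre t (int q) = f (int q)\<close>[of q]
        prime_ge_2_nat[of q] by (cases "q = 2") (auto simp: kronecker_prime_def)
  qed (use that in auto)
  have L4: "Legendre (-4) (int q) = chi4 (int q)" and L8: "Legendre 8 (int q) = chi8 (int q)"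
    and L8': "Legendre (-8) (int q) = chi4 (int q) * chi8 (int q)" if "prime q" "2 < q" for q
    using Legendre_mult[OF that, of "-1" 4] Legendre_mult[OF that, of 2 4]
      Legendre_mult[OF that, of "-1" 8] Legendre_even_disc[OF that] by simp_all
  show "periodic_kronecker (- 4)"
    unfolding periodic_kronecker_def
    by (intro exI[of _ chi4] exI[of _ 8])
       (auto simp: chi4_period chi4_minus L4 chi4_mult intro!: *, auto simp: chi4_def)
  show "periodic_kronecker 8"
    unfolding periodic_kronecker_def
    by (intro exI[of _ chi8] exI[of _ 8])
       (auto simp: chi8_period chi8_minus L8 chi8_mult intro!: *, auto simp: chi8_def)
  show "periodic_kronecker (- 8)"
    unfolding periodic_kronecker_def
    by (intro exI[of _ "\<lambda>x. chi4 x * chi8 x"] exI[of _ 8])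
       (auto simp: chi8_period chi8_minus chi4_period chi4_minus L8' chi8_mult chi4_mult
          intro!: *[of _ "\<lambda>x. chi4 x * chi8 x"], auto simp: chi4_def chi8_def)
qed

text \<open>Splitting off \<open>odd_prime_disc p\<close> for a prime p dividing a leaves a smaller
  cofactor that is again 1 modulo 4. The descent stops at absolute value 1, where a = 1 because -1
  is 3 modulo 4.\<close>

lemma periodic_kronecker_1_mod_4:
  assumes "a mod 4 = 1"
  shows "periodic_kronecker a"
  using assms
proof (induction "nat \<bar>a\<bar>" arbitrary: a rule: less_induct)
  case less
  show ?case
  proof (cases "\<bar>a\<bar> = 1")
    case True
    hence "a = 1 \<or> a = - 1" by linarith
    hence "a = 1" using less.prems by auto
    thus ?thesis by (simp add: periodic_kronecker_one)
  next
    case False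
    hence "nat \<bar>a\<bar> \<noteq> 1" by linarith
    then obtain p where p: "prime p" "p dvd nat \<bar>a\<bar>"
      using prime_factor_nat by blast
    have "odd a" using less.prems by presburger
    have pa: "int p dvd a" using p(2) by (simp add: int_dvd_int_iff[symmetric])
    hence "odd p" using \<open>odd a\<close> by auto
    hence p2: "p > 2" using prime_ge_2_nat[OF p(1)] by (cases "p = 2") auto
    have "odd_prime_disc p dvd a" using pa by (simp add: odd_prime_disc_def)
    then obtain b where b: "a = odd_prime_disc p * b" by blast
    have m: "odd_prime_disc p mod 4 = 1"
    proof (cases "int p mod 4 = 1")
      case False
      moreover have "odd (int p)" using \<open>odd p\<close> by simp
      ultimately have "(- int p) mod 4 = 1" by presburger
      thus ?thesis using False by (simp add: odd_prime_disc_def int_mod_eq_iff)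
    qed (simp add: odd_prime_disc_def int_mod_eq_iff)
    have "a mod 4 = ((odd_prime_disc p mod 4) * (b mod 4)) mod 4"
      unfolding b by (simp add: mod_mult_eq)
    hence bm: "b mod 4 = 1" using m less.prems by simp
    hence "b \<noteq> 0" by auto
    have "\<bar>odd_prime_disc p\<bar> = int p" by (simp add: odd_prime_disc_def)
    hence "\<bar>a\<bar> = int p * \<bar>b\<bar>" by (simp add: b abs_mult)
    moreover have "1 * \<bar>b\<bar> < int p * \<bar>b\<bar>" using p2 \<open>b \<noteq> 0\<close> by (intro mult_strict_right_mono) auto
    ultimately have "nat \<bar>b\<bar> < nat \<bar>a\<bar>" by linarith
    from less.hyps[OF this bm] show ?thesis
      unfolding b by (intro periodic_kronecker_mult periodic_kronecker_odd_prime_disc p(1) p2)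
  qed
qed

text \<open>A fundamental discriminant t = 4 k is -4, 8 or -8 times an integer that is 1 modulo 4;
  which of the three applies depends on k modulo 4 and, when k = 2 l, on l modulo 4.\<close>

lemma periodic_kronecker_fundamental:
  assumes "fundamental_discriminant t"
  shows "periodic_kronecker t"
proof -
  consider "t mod 4 = 1" | k where "t = 4 * k" "k mod 4 = 3" | k where "t = 4 * k" "k mod 4 = 2"
    using assms by (auto simp: fundamental_discriminant_def cong_def)
  thus ?thesis
  proof cases
    case 1
    thus ?thesis by (rule periodic_kronecker_1_mod_4)
  next
    case (2 k)
    have "periodic_kronecker (- 4 * (- k))"
      using 2 by (intro periodic_kronecker_mult periodic_kronecker_even_prime_disc
          periodic_kronecker_1_mod_4) presburger
    thus ?thesis using 2 by simp
  next
    case (3 k)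
    hence "even k" by presburger
    then obtain l where l: "k = 2 * l" by blast
    hence "odd l" using 3(2) by presburger
    show ?thesis
    proof (cases "l mod 4 = 1")
      case True
      hence "periodic_kronecker (8 * l)"
        by (intro periodic_kronecker_mult periodic_kronecker_even_prime_disc
          periodic_kronecker_1_mod_4)
      thus ?thesis using 3 l by simp
    next
      case False
      hence "(- l) mod 4 = 1" using \<open>odd l\<close> by presburger
      hence "periodic_kronecker (- 8 * - l)"
        by (intro periodic_kronecker_mult periodic_kronecker_even_prime_disc
          periodic_kronecker_1_mod_4)
      thus ?thesis using 3 l by simp
    qed
  qed
qed

text \<open>For t < 0 the function \<psi> is odd. The reflection of n to M - n therefore negates the
  sum over the n below M, and \<psi>(M) = \<psi>(0) = 0.\<close>

lemma kronecker_periodic_zero_sum: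
  assumes "fundamental_discriminant t" "t < 0"
  obtains M where "M > 0" "\<And>n. n > 0 \<Longrightarrow> kronecker t (n + M) = kronecker t n"
    "(\<Sum>n=1..M. kronecker t n) = 0"
proof -
  obtain \<psi> M where 1: "M > 0" "\<And>x. \<psi> (x + int M) = \<psi> x"
     "\<And>x. \<psi> (- x) = - \<psi> x" "\<And>n. n > 0 \<Longrightarrow> kronecker t n = \<psi> (int n)"
    using periodic_kronecker_fundamental[OF assms(1)] assms(2)
    unfolding periodic_kronecker_def by auto
  have "\<psi> 0 = 0" using 1(3)[of 0] by simp
  hence "\<psi> (int M) = 0" using 1(2)[of 0] by simp
  have refl: "\<psi> (int (M - n)) = - \<psi> (int n)" if "n < M" for n
    using 1(2)[of "- int n"] 1(3)[of "int n"] that by simp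
  have "(\<Sum>n\<in>{1..<M}. \<psi> (int n)) = (\<Sum>n\<in>{1..<M}. \<psi> (int (M - n)))"
    by (rule sum.reindex_bij_witness[where i = "\<lambda>n. M - n" and j = "\<lambda>n. M - n"]) auto
  also have "\<dots> = - (\<Sum>n\<in>{1..<M}. \<psi> (int n))"
    unfolding sum_negf[symmetric] by (rule sum.cong) (simp_all add: refl del: of_nat_diff)
  finally have "(\<Sum>n\<in>{1..<M}. \<psi> (int n)) = 0" by simp
  moreover have "{1..M} = insert M {1..<M}" using 1(1) by auto
  ultimately have "(\<Sum>n=1..M. \<psi> (int n)) = 0" using \<open>\<psi> (int M) = 0\<close> by simp
  hence "(\<Sum>n=1..M. kronecker t n) = 0" using 1(4) by (simp cong: sum.cong_simp)
  thus thesis using that[of M] 1 by simp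
qed

section \<open>Dirichlet series with periodic coefficients of mean zero\<close>

definition zero_mean_periodic :: "nat \<Rightarrow> (nat \<Rightarrow> real) \<Rightarrow> bool" where
  "zero_mean_periodic M f \<longleftrightarrow> M > 0 \<and> (\<forall>n. f (n + M) = f n) \<and> (\<Sum>n<M. f n) = 0"

text \<open>The partial sums of f, shifted by a constant so that their mean over a period is zero;
  thereby the construction can be iterated. The value at 0 is minus the mean of the partial sums,
  that is, minus the Cesaro value of the series of f, and hence minus L(0).\<close>

definition antidiff :: "nat \<Rightarrow> (nat \<Rightarrow> real) \<Rightarrow> nat \<Rightarrow> real" where
  "antidiff M f n = (\<Sum>k<n. f (Suc k)) - (\<Sum>m<M. \<Sum>k<m. f (Suc k)) / real M"

lemma antidiff_Suc: "antidiff M f (Suc n) - antidiff M f n = f (Suc n)"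
  by (simp add: antidiff_def)

text \<open>Vanishing of the sum of f over a period is what makes the partial sums periodic; the
  subtracted constant restores mean zero.\<close>

lemma zero_mean_periodic_antidiff:
  assumes "zero_mean_periodic M f"
  shows "zero_mean_periodic M (antidiff M f)"
proof -
  have M: "M > 0" and per: "\<And>n. f (n + M) = f n" and zero: "(\<Sum>n<M. f n) = 0"
    using assms by (auto simp: zero_mean_periodic_def)
  have "(\<Sum>k<n + M. f (Suc k)) = (\<Sum>k<n. f (Suc k))" for n
  proof (induction n)
    case 0
    have "(\<Sum>k<M. f (Suc k)) + f 0 = (\<Sum>k<Suc M. f k)"
      by (subst sum.lessThan_Suc_shift) simp
    also have "\<dots> = f 0" using zero per[of 0] by simp
    finally show ?case by simp
  next
    case (Suc n)
    thus ?case using per[of "Suc n"] by simp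
  qed
  moreover have "(\<Sum>n<M. antidiff M f n) = 0"
    using M by (simp add: antidiff_def sum_subtractf)
  ultimately show ?thesis using M by (simp add: zero_mean_periodic_def antidiff_def)
qed

lemma zero_mean_periodic_bounded:
  assumes "zero_mean_periodic M f"
  obtains B where "B > 0" "\<And>n. \<bar>f n\<bar> \<le> B"
proof -
  have M: "M > 0" and per: "\<And>n. f (n + M) = f n"
    using assms by (auto simp: zero_mean_periodic_def)
  have mult: "f (r + j * M) = f r" for r j
  proof (induction j)
    case (Suc j)
    thus ?case using per[of "r + j * M"] by (simp add: algebra_simps)
  qed simp
  have "\<bar>f n\<bar> \<le> (\<Sum>k<M. \<bar>f k\<bar>)" for n
  proof -
    have "f n = f (n mod M)" using mult[of "n mod M" "n div M"] by simp
    moreover have "\<bar>f (n mod M)\<bar> \<le> (\<Sum>k<M. \<bar>f k\<bar>)"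
      using M by (intro member_le_sum[of "n mod M" "{..<M}" "\<lambda>k. \<bar>f k\<bar>"]) auto
    ultimately show ?thesis by simp
  qed
  hence "\<bar>f n\<bar> \<le> (\<Sum>k<M. \<bar>f k\<bar>) + 1" for n by (simp add: add_increasing2)
  moreover have "(\<Sum>k<M. \<bar>f k\<bar>) + 1 > 0" by (simp add: sum_nonneg add_nonneg_pos)
  ultimately show thesis by (rule that[rotated])
qed

lemma summation_by_parts_partial:
  fixes u :: "nat \<Rightarrow> 'a :: real_normed_field"
  shows "(\<Sum>n<N. of_real (f (Suc n)) * u (Suc n)) =
    of_real (antidiff M f N) * u (Suc N) - of_real (antidiff M f 0) * u 1 +
    (\<Sum>n<N. of_real (antidiff M f (Suc n)) * (u (Suc n) - u (Suc (Suc n))))"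
proof (induction N)
  case (Suc N)
  have "of_real (f (Suc N)) = (of_real (antidiff M f (Suc N)) - of_real (antidiff M f N) :: 'a)"
    unfolding of_real_diff[symmetric] antidiff_Suc ..
  thus ?case unfolding sum.lessThan_Suc Suc by (simp only: ring_distribs) simp
qed simp

lemma summation_by_parts:
  fixes u :: "nat \<Rightarrow> 'a :: real_normed_field"
  assumes "zero_mean_periodic M f" "u \<longlonglongrightarrow> 0"
    "(\<lambda>n. of_real (antidiff M f (Suc n)) * (u (Suc n) - u (Suc (Suc n)))) sums S"
  shows "(\<lambda>n. of_real (f (Suc n)) * u (Suc n)) sums (S - of_real (antidiff M f 0) * u 1)"
proof -
  obtain B where B: "\<And>n. \<bar>antidiff M f n\<bar> \<le> B"
    using zero_mean_periodic_bounded[OF zero_mean_periodic_antidiff[OF assms(1)]] by metis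
  have u: "(\<lambda>n. u (Suc n)) \<longlonglongrightarrow> 0" using assms(2) by (rule LIMSEQ_Suc)
  have "(\<lambda>n. of_real (antidiff M f n) * u (Suc n)) \<longlonglongrightarrow> 0"
  proof (rule Lim_null_comparison)
    show "\<forall>\<^sub>F n in sequentially. norm (of_real (antidiff M f n) * u (Suc n)) \<le> B * norm (u (Suc n))"
      using B by (auto simp: norm_mult intro!: always_eventually mult_right_mono)
    show "(\<lambda>n. B * norm (u (Suc n))) \<longlonglongrightarrow> 0"
      using tendsto_mult_right_zero[OF tendsto_norm_zero[OF u]] .
  qed
  hence "(\<lambda>N. of_real (antidiff M f N) * u (Suc N) - of_real (antidiff M f 0) * u 1 +
    (\<Sum>n<N. of_real (antidiff M f (Suc n)) * (u (Suc n) - u (Suc (Suc n)))))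
    \<longlonglongrightarrow> 0 - of_real (antidiff M f 0) * u 1 + S"
    using assms(3) by (intro tendsto_intros) (auto simp: sums_def)
  thus ?thesis unfolding sums_def summation_by_parts_partial[of f u _ M] by simp
qed

section \<open>Iterated differences of a complex power\<close>

primrec diff_power :: "nat \<Rightarrow> complex \<Rightarrow> real \<Rightarrow> complex" where
  "diff_power 0 s x = of_real x powr (- s)"
| "diff_power (Suc k) s x = diff_power k s x - diff_power k s (x + 1)"

lemma diff_power_has_vector_derivative:
  "x > 0 \<Longrightarrow> (diff_power k s has_vector_derivative (- s * diff_power k (s + 1) x)) (at x within A)"
  for A :: "real set"
proof (induction k arbitrary: x A)
  case 0
  have "((\<lambda>z. z powr (- s)) has_field_derivative (- s * of_real x powr (- s - 1))) (at (of_real x))"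
    using 0 by (intro has_field_derivative_powr) (auto simp: complex_nonpos_Reals_iff)
  hence "((\<lambda>y. of_real y powr (- s)) has_vector_derivative (- s * of_real x powr (- s - 1))) (at x within A)"
    by (rule has_vector_derivative_real_field)
  moreover have "diff_power 0 s = (\<lambda>y. of_real y powr (- s))" by (simp add: fun_eq_iff)
  ultimately show ?case by simp
next
  case (Suc k)
  have "((\<lambda>y. diff_power k s (y + 1)) has_vector_derivative (- s * diff_power k (s + 1) (x + 1))) (at x within A)"
  proof -
    have "((\<lambda>y. y + 1) has_vector_derivative 1) (at x within A)"
      by (auto intro!: derivative_eq_intros)
    from vector_diff_chain_within[OF this, of "diff_power k s"] Suc show ?thesis
      by (simp add: o_def)
  qed
  from has_vector_derivative_diff[OF Suc.IH[OF Suc.prems] this]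
  have "((\<lambda>y. diff_power k s y - diff_power k s (y + 1)) has_vector_derivative
    (- s * diff_power k (s + 1) x - - s * diff_power k (s + 1) (x + 1))) (at x within A)" .
  moreover have "diff_power (Suc k) s = (\<lambda>y. diff_power k s y - diff_power k s (y + 1))"
    by (simp add: fun_eq_iff)
  ultimately show ?case by (simp add: right_diff_distrib)
qed

text \<open>The derivative of \<open>diff_power k s\<close> is -s times
  \<open>diff_power k (s + 1)\<close>. The mean value inequality on [x, x + 1] thus leads from k at
  s + 1 to k + 1 at s with the exponent unchanged and one more factor |s|; hence s is generalized in
  the induction. The sign condition makes the power of x decreasing, so its value at x serves for
  the whole interval.\<close>

lemma diff_power_bound:
  assumes "x > 0" "Re s + real k \<ge> 0"
  shows "norm (diff_power k s x) \<le> (\<Prod>i<k. norm (s + of_nat i)) * x powr - (Re s + real k)"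
  using assms
proof (induction k arbitrary: s x)
  case 0
  thus ?case by (simp add: norm_powr_real_powr)
next
  case (Suc k)
  define B where "B = norm s * ((\<Prod>i<k. norm (s + 1 + of_nat i)) * x powr - (Re s + real (Suc k)))"
  have "norm (diff_power k s (x + 1) - diff_power k s x) \<le> B * norm (x + 1 - x)"
  proof (rule differentiable_bound[of "{x..x + 1}" "diff_power k s" "\<lambda>y h. h *\<^sub>R (- s * diff_power k (s + 1) y)"])
    fix y assume y: "y \<in> {x..x + 1}"
    show "(diff_power k s has_derivative (\<lambda>h. h *\<^sub>R (- s * diff_power k (s + 1) y))) (at y within {x..x + 1})"
      using diff_power_has_vector_derivative[of y k s "{x..x+1}"] y Suc.prems
      unfolding has_vector_derivative_def by simp
    have "norm (diff_power k (s + 1) y) \<le> (\<Prod>i<k. norm (s + 1 + of_nat i)) * y powr - (Re (s + 1) + real k)"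
      using y Suc.prems by (intro Suc.IH) auto
    also have "y powr - (Re (s + 1) + real k) \<le> x powr - (Re (s + 1) + real k)"
      using y Suc.prems by (intro powr_mono2') auto
    finally have "norm (diff_power k (s + 1) y) \<le> (\<Prod>i<k. norm (s + 1 + of_nat i)) * x powr - (Re (s + 1) + real k)"
      by (simp add: mult_left_mono prod_nonneg)
    hence "norm (- s * diff_power k (s + 1) y) \<le> B"
      unfolding B_def norm_mult norm_minus_cancel
      by (intro mult_left_mono) (simp_all add: add_ac)
    moreover have "onorm (\<lambda>h. h *\<^sub>R (- s * diff_power k (s + 1) y)) \<le> norm (- s * diff_power k (s + 1) y)"
      by (rule onorm_le) (simp add: norm_mult mult.commute)
    ultimately show "onorm (\<lambda>h. h *\<^sub>R (- s * diff_power k (s + 1) y)) \<le> B" by linarith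
  qed auto
  moreover have "B = (\<Prod>i<Suc k. norm (s + of_nat i)) * x powr - (Re s + real (Suc k))"
    by (subst prod.lessThan_Suc_shift) (simp add: B_def algebra_simps)
  ultimately show ?case by (simp add: norm_minus_commute)
qed

lemma holomorphic_diff_power: "x > 0 \<Longrightarrow> (\<lambda>s. diff_power k s x) holomorphic_on A"
proof (induction k arbitrary: x)
  case 0
  thus ?case by (auto intro!: holomorphic_intros)
next
  case (Suc k)
  thus ?case by (auto intro!: holomorphic_intros)
qed

text \<open>At s = 0 the power is the constant 1, so every difference vanishes. This reduces the
  value of the continuation at 0 to one boundary term.\<close>

lemma diff_power_zero: "x > 0 \<Longrightarrow> k > 0 \<Longrightarrow> diff_power k 0 x = 0"
proof (induction k arbitrary: x)
  case (Suc k)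
  moreover have "complex_of_real x + 1 \<noteq> 0"
    using Suc.prems by (metis add_pos_pos of_real_1 of_real_add of_real_eq_0_iff less_irrefl zero_less_one)
  ultimately show ?case by (cases "k = 0") auto
qed auto

section \<open>Continuation to the whole plane by repeated summation by parts\<close>

context
  fixes M :: nat and f :: "nat \<Rightarrow> real"
  assumes f: "zero_mean_periodic M f"
begin

definition iter_antidiff :: "nat \<Rightarrow> nat \<Rightarrow> real" where
  "iter_antidiff k = (antidiff M ^^ k) f"

lemma zero_mean_iter_antidiff: "zero_mean_periodic M (iter_antidiff k)"
  by (induction k) (auto simp: iter_antidiff_def f zero_mean_periodic_antidiff)

text \<open>What remains of the L-series after k summations by parts, without the boundary terms.
  Each step gains a power of n, so the series converges for Re s > 1 - k.\<close>

definition diff_series :: "nat \<Rightarrow> complex \<Rightarrow> complex" where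
  "diff_series k s = (\<Sum>n. of_real (iter_antidiff k (Suc n)) * diff_power k s (real (Suc n)))"

text \<open>Uniform in s through a bound R on the modulus and a lower bound \<sigma> on the real
  part, so that one estimate serves both for convergence at a point and for the Weierstrass test on
  a disc.\<close>

lemma diff_series_term_bound:
  obtains B where "B > 0" "\<And>n s R \<sigma>. norm s \<le> R \<Longrightarrow> \<sigma> \<le> Re s \<Longrightarrow> 0 \<le> \<sigma> + real k \<Longrightarrow>
    norm (of_real (iter_antidiff k (Suc n)) * diff_power k s (real (Suc n))) \<le>
    B * (\<Prod>i<k. R + real i) * real (Suc n) powr - (\<sigma> + real k)"
proof -
  obtain B where B: "B > 0" "\<And>n. \<bar>iter_antidiff k n\<bar> \<le> B"
    using zero_mean_periodic_bounded[OF zero_mean_iter_antidiff] by metis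
  have "norm (of_real (iter_antidiff k (Suc n)) * diff_power k s (real (Suc n))) \<le>
    B * ((\<Prod>i<k. R + real i) * real (Suc n) powr - (\<sigma> + real k))"
    if *: "norm s \<le> R" "\<sigma> \<le> Re s" "0 \<le> \<sigma> + real k" for n s R \<sigma>
  proof -
    have "norm (diff_power k s (real (Suc n))) \<le>
        (\<Prod>i<k. norm (s + of_nat i)) * real (Suc n) powr - (Re s + real k)"
      using * by (intro diff_power_bound) auto
    also have "\<dots> \<le> (\<Prod>i<k. R + real i) * real (Suc n) powr - (\<sigma> + real k)"
    proof (intro mult_mono prod_mono powr_mono conjI)
      show "norm (s + of_nat i) \<le> R + real i" for i
        using norm_triangle_ineq[of s "of_nat i"] * by simp
      show "0 \<le> (\<Prod>i<k. R + real i)"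
        using * norm_ge_zero[of s] by (intro prod_nonneg) (auto intro: add_nonneg_nonneg order_trans[of 0 "norm s"])
    qed (use * in auto)
    finally show ?thesis unfolding norm_mult
      using B by (intro mult_mono) auto
  qed
  thus thesis using that[of B] B by (simp add: mult.assoc)
qed

lemma summable_diff_series:
  assumes "Re s > 1 - real k"
  shows "summable (\<lambda>n. of_real (iter_antidiff k (Suc n)) * diff_power k s (real (Suc n)))"
proof -
  obtain B where B: "\<And>n s R \<sigma>. norm s \<le> R \<Longrightarrow> \<sigma> \<le> Re s \<Longrightarrow> 0 \<le> \<sigma> + real k \<Longrightarrow>
    norm (of_real (iter_antidiff k (Suc n)) * diff_power k s (real (Suc n))) \<le>
    B * (\<Prod>i<k. R + real i) * real (Suc n) powr - (\<sigma> + real k)"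
    by (rule diff_series_term_bound) blast
  have "summable (\<lambda>n. real (Suc n) powr - (Re s + real k))"
    using assms by (subst summable_Suc_iff) (simp add: summable_real_powr_iff)
  hence "summable (\<lambda>n. B * (\<Prod>i<k. norm s + real i) * real (Suc n) powr - (Re s + real k))"
    by (rule summable_mult)
  thus ?thesis by (rule summable_comparison_test'[where N = 0]) (rule B, use assms in auto)
qed

lemma diff_series_step:
  assumes "Re s > 1 - real k"
  shows "diff_series k s = diff_series (Suc k) s - of_real (iter_antidiff (Suc k) 0) * diff_power k s 1"
proof -
  have lim: "(\<lambda>n. diff_power k s (real n)) \<longlonglongrightarrow> 0"
  proof (rule Lim_null_comparison)
    show "\<forall>\<^sub>F n in sequentially. norm (diff_power k s (real n)) \<le>
        (\<Prod>i<k. norm (s + of_nat i)) * real n powr - (Re s + real k)"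
      using eventually_gt_at_top[of 0] by eventually_elim (rule diff_power_bound, use assms in auto)
    have "(\<lambda>n. real n powr - (Re s + real k)) \<longlonglongrightarrow> 0"
      using assms by (intro tendsto_neg_powr filterlim_real_sequentially) auto
    thus "(\<lambda>n. (\<Prod>i<k. norm (s + of_nat i)) * real n powr - (Re s + real k)) \<longlonglongrightarrow> 0"
      by (rule tendsto_mult_right_zero)
  qed
  have "(\<lambda>n. of_real (iter_antidiff (Suc k) (Suc n)) * diff_power (Suc k) s (real (Suc n))) sums diff_series (Suc k) s"
    unfolding diff_series_def using assms by (intro summable_sums summable_diff_series) auto
  hence "(\<lambda>n. of_real (antidiff M (iter_antidiff k) (Suc n)) *
      (diff_power k s (real (Suc n)) - diff_power k s (real (Suc (Suc n))))) sums diff_series (Suc k) s"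
    by (simp add: iter_antidiff_def add_ac)
  from summation_by_parts[OF zero_mean_iter_antidiff lim this]
  show ?thesis unfolding diff_series_def[of k] by (intro sums_unique[symmetric]) (simp add: iter_antidiff_def)
qed

lemma holomorphic_diff_series: "diff_series k holomorphic_on {s. Re s > 1 - real k}"
proof (rule holomorphic_uniform_sequence[where f = "\<lambda>N s. \<Sum>n<N. of_real (iter_antidiff k (Suc n)) * diff_power k s (real (Suc n))"])
  show "open {s. Re s > 1 - real k}" by (rule open_halfspace_Re_gt)
  show "(\<lambda>s. \<Sum>n<N. of_real (iter_antidiff k (Suc n)) * diff_power k s (real (Suc n)))
      holomorphic_on {s. Re s > 1 - real k}" for N
    by (intro holomorphic_intros holomorphic_diff_power) auto
  fix z assume z: "z \<in> {s. Re s > 1 - real k}"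
  \<comment> \<open>Half the distance from z to the boundary line: on the closed disc the exponents
    stay at least 1 + d.\<close>
  define d where "d = (Re z - (1 - real k)) / 2"
  have d: "d > 0" using z by (simp add: d_def)
  have in_ball: "Re z - d \<le> Re s" "norm s \<le> norm z + d" if "s \<in> cball z d" for s
  proof -
    have "norm (z - s) \<le> d" using that by (simp add: dist_norm)
    thus "Re z - d \<le> Re s" "norm s \<le> norm z + d"
      using abs_Re_le_cmod[of "z - s"] norm_triangle_ineq2[of s z] by (auto simp: norm_minus_commute)
  qed
  obtain B where B: "\<And>n s R \<sigma>. norm s \<le> R \<Longrightarrow> \<sigma> \<le> Re s \<Longrightarrow> 0 \<le> \<sigma> + real k \<Longrightarrow>
    norm (of_real (iter_antidiff k (Suc n)) * diff_power k s (real (Suc n))) \<le>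
    B * (\<Prod>i<k. R + real i) * real (Suc n) powr - (\<sigma> + real k)"
    by (rule diff_series_term_bound) blast
  have \<sigma>: "Re z - d + real k > 1" using z by (simp add: d_def field_simps)
  have "uniform_limit (cball z d)
    (\<lambda>N s. \<Sum>n<N. of_real (iter_antidiff k (Suc n)) * diff_power k s (real (Suc n)))
    (\<lambda>s. \<Sum>n. of_real (iter_antidiff k (Suc n)) * diff_power k s (real (Suc n))) sequentially"
  proof (rule Weierstrass_m_test)
    show "norm (of_real (iter_antidiff k (Suc n)) * diff_power k s (real (Suc n))) \<le>
      B * (\<Prod>i<k. norm z + d + real i) * real (Suc n) powr - (Re z - d + real k)"
      if "s \<in> cball z d" for n s
      using in_ball[OF that] \<sigma> by (intro B) auto
    have "summable (\<lambda>n. real (Suc n) powr - (Re z - d + real k))"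
      using \<sigma> by (subst summable_Suc_iff) (simp add: summable_real_powr_iff)
    thus "summable (\<lambda>n. B * (\<Prod>i<k. norm z + d + real i) * real (Suc n) powr - (Re z - d + real k))"
      by (rule summable_mult)
  qed
  hence "uniform_limit (cball z d)
    (\<lambda>N s. \<Sum>n<N. of_real (iter_antidiff k (Suc n)) * diff_power k s (real (Suc n)))
    (diff_series k) sequentially"
    by (simp add: diff_series_def[abs_def])
  moreover have "cball z d \<subseteq> {s. Re s > 1 - real k}"
    using in_ball(1) \<sigma> by fastforce
  ultimately show "\<exists>d>0. cball z d \<subseteq> {s. Re s > 1 - real k} \<and> uniform_limit (cball z d)
    (\<lambda>N s. \<Sum>n<N. of_real (iter_antidiff k (Suc n)) * diff_power k s (real (Suc n)))
    (diff_series k) sequentially"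
    using d by blast
qed

text \<open>Restoring the boundary terms makes the value independent of k wherever the series
  converges (\<open>L_approx_eq\<close>).\<close>

definition L_approx :: "nat \<Rightarrow> complex \<Rightarrow> complex" where
  "L_approx k s = diff_series k s - (\<Sum>j<k. of_real (iter_antidiff (Suc j) 0) * diff_power j s 1)"

lemma L_approx_eq:
  assumes "Re s > 1 - real k" "k \<le> l"
  shows "L_approx l s = L_approx k s"
  using assms(2)
proof (induction l rule: dec_induct)
  case (step l)
  have "Re s > 1 - real l" using assms(1) step by linarith
  from diff_series_step[OF this] have "L_approx (Suc l) s = L_approx l s"
    unfolding L_approx_def by (simp only: sum.lessThan_Suc) simp
  thus ?case using step.IH by simp
qed simp

lemma entire_continuation:
  obtains G where "G holomorphic_on UNIV" "G 0 = - of_real (antidiff M f 0)"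
    "\<And>s. Re s > 1 \<Longrightarrow> (\<lambda>n. of_real (f (Suc n)) / of_nat (Suc n) powr s) sums G s"
proof -
  \<comment> \<open>The number of summations by parts used at s. It jumps with s, but every k with
    Re s > 1 - k gives the same value, so G is nevertheless holomorphic.\<close>
  define K where "K = (\<lambda>s. nat \<lceil>2 - Re s\<rceil>)"
  have K: "Re s > 1 - real (K s)" for s unfolding K_def by linarith
  define G where "G = (\<lambda>s. L_approx (K s) s)"
  have G: "G s = L_approx k s" if "Re s > 1 - real k" for k s
    unfolding G_def using L_approx_eq[OF K[of s], of k] L_approx_eq[OF that, of "K s"]
    by (cases "K s \<le> k") auto
  have "G holomorphic_on UNIV"
  proof (rule holomorphic_onI)
    fix z
    have "L_approx (K z) holomorphic_on {s. Re s > 1 - real (K z)}"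
      unfolding L_approx_def[abs_def]
      by (intro holomorphic_intros holomorphic_diff_series holomorphic_diff_power) auto
    hence "G holomorphic_on {s. Re s > 1 - real (K z)}"
      by (rule holomorphic_transform) (simp add: G)
    hence "G field_differentiable at z"
      using K[of z] by (auto intro: holomorphic_on_imp_differentiable_at open_halfspace_Re_gt)
    thus "G field_differentiable at z within UNIV" by simp
  qed
  moreover have "G 0 = - of_real (antidiff M f 0)"
  proof -
    have "{..<2::nat} = {0, 1}" by auto
    \<comment> \<open>For k = 2 the point 0 lies in the half-plane. By
      \<open>diff_power_zero\<close> the series and the boundary term j = 1 vanish there, and only j
      = 0 remains.\<close>
    thus ?thesis by (subst G[of 2]) (auto simp: L_approx_def diff_series_def diff_power_zero iter_antidiff_def)
  qed
  moreover have "(\<lambda>n. of_real (f (Suc n)) / of_nat (Suc n) powr s) sums G s" if "Re s > 1" for s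
  proof -
    have "(\<lambda>n. of_real (iter_antidiff 0 (Suc n)) * diff_power 0 s (real (Suc n))) sums diff_series 0 s"
      unfolding diff_series_def using that by (intro summable_sums summable_diff_series) auto
    moreover have "G s = diff_series 0 s" using that by (subst G[of 0]) (auto simp: L_approx_def)
    ultimately show ?thesis by (simp add: iter_antidiff_def powr_minus_divide)
  qed
  ultimately show thesis by (rule that)
qed

end

lemma dirichlet_L_eqI: "dirichlet_L_continuation chi f \<Longrightarrow> dirichlet_L chi = f"
  unfolding dirichlet_L_def using dirichlet_L_continuation_unique by blast

lemma dirichlet_L_0:
  assumes "zero_mean_periodic M f" "\<And>n. f (Suc n) = of_int (chi (Suc n))"
  shows "dirichlet_L chi 0 = - of_real (antidiff M f 0)"
proof -
  obtain G where G: "G holomorphic_on UNIV" "G 0 = - of_real (antidiff M f 0)"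
    "\<And>s. Re s > 1 \<Longrightarrow> (\<lambda>n. of_real (f (Suc n)) / of_nat (Suc n) powr s) sums G s"
    by (rule entire_continuation[OF assms(1)]) blast
  hence "dirichlet_L_continuation chi G"
    by (simp add: dirichlet_L_continuation_def assms(2))
  thus ?thesis using G(2) by (simp add: dirichlet_L_eqI)
qed

section \<open>Gaussian sums over the lattice\<close>

lemma has_sum_diff:
  fixes f g :: "'a \<Rightarrow> 'b :: real_normed_vector"
  assumes "(f has_sum a) A" "(g has_sum b) A"
  shows "((\<lambda>x. f x - g x) has_sum (a - b)) A"
proof -
  have "((\<lambda>x. - g x) has_sum (- b)) A" using assms(2) by (simp add: has_sum_uminus)
  from has_sum_add[OF assms(1) this] show ?thesis by simp
qed

lemma has_sum_exp_abs_int: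
  fixes \<delta> :: real
  assumes "\<delta> > 0"
  shows "((\<lambda>x::int. exp (- \<delta> * \<bar>of_int x\<bar>)) has_sum ((1 + exp (- \<delta>)) / (1 - exp (- \<delta>)))) UNIV"
proof -
  define r where "r = exp (- \<delta>)"
  have r: "0 < r" "r < 1" using assms by (simp_all add: r_def)
  have rn: "exp (- \<delta> * real n) = r ^ n" for n
    by (simp add: r_def exp_of_nat_mult[symmetric] mult.commute)
  have "((\<lambda>n. r ^ n) has_sum (1 / (1 - r))) UNIV"
    using r by (intro norm_summable_imp_has_sum geometric_sums) (auto simp: norm_power intro!: summable_geometric)
  also have "?this \<longleftrightarrow> ((\<lambda>x::int. exp (- \<delta> * \<bar>of_int x\<bar>)) has_sum (1 / (1 - r))) {0..}"
    by (rule has_sum_reindex_bij_witness[of _ nat int]) (auto simp: rn[symmetric])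
  finally have 1: "((\<lambda>x::int. exp (- \<delta> * \<bar>of_int x\<bar>)) has_sum (1 / (1 - r))) {0..}" .
  have "((\<lambda>n. r ^ n) has_sum (r / (1 - r))) {1..}"
    using r by (intro has_sum_geometric_from_1) auto
  also have "?this \<longleftrightarrow> ((\<lambda>x::int. exp (- \<delta> * \<bar>of_int x\<bar>)) has_sum (r / (1 - r))) {..<0}"
    by (rule has_sum_reindex_bij_witness[of _ "\<lambda>x. nat (- x)" "\<lambda>n. - int n"]) (auto simp: rn[symmetric])
  finally have 2: "((\<lambda>x::int. exp (- \<delta> * \<bar>of_int x\<bar>)) has_sum (r / (1 - r))) {..<0}" .
  have "((\<lambda>x::int. exp (- \<delta> * \<bar>of_int x\<bar>)) has_sum (1 / (1 - r) + r / (1 - r))) ({0..} \<union> {..<0})"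
    by (rule has_sum_Un_disjoint[OF 1 2]) auto
  moreover have "{0..} \<union> {..<0} = (UNIV :: int set)" by auto
  ultimately show ?thesis by (simp add: r_def add_divide_distrib)
qed

text \<open>From 1 + \<delta> \<le> exp \<delta>. Squared, with \<delta> of order sqrt \<epsilon>,
  the bound accounts for the roughly 1/\<epsilon> lattice points at which a Gaussian is not
  negligible.\<close>

lemma exp_abs_int_sum_le:
  fixes \<delta> :: real
  assumes "\<delta> > 0"
  shows "(1 + exp (- \<delta>)) / (1 - exp (- \<delta>)) \<le> 2 * (1 + \<delta>) / \<delta>"
proof -
  have "exp (- \<delta>) \<le> 1 / (1 + \<delta>)"
    using exp_ge_add_one_self[of \<delta>] assms by (simp add: exp_minus field_simps)
  hence "\<delta> / (1 + \<delta>) \<le> 1 - exp (- \<delta>)" using assms by (simp add: field_simps)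
  moreover have "exp (- \<delta>) \<le> 1" using assms by simp
  ultimately have "(1 + exp (- \<delta>)) / (1 - exp (- \<delta>)) \<le> 2 / (\<delta> / (1 + \<delta>))"
    using assms by (intro frac_le) auto
  thus ?thesis by simp
qed

lemma has_sum_exp_abs_int_prod:
  fixes \<delta> :: real
  assumes "\<delta> > 0"
  defines "S \<equiv> (1 + exp (- \<delta>)) / (1 - exp (- \<delta>))"
  shows "((\<lambda>(x::int, y::int). exp (- \<delta> * (\<bar>of_int x\<bar> + \<bar>of_int y\<bar>))) has_sum S\<^sup>2) UNIV"
proof -
  let ?e = "\<lambda>x::int. exp (- \<delta> * \<bar>of_int x\<bar>)"
  note S = has_sum_exp_abs_int[OF assms(1), folded S_def]
  have 1: "((\<lambda>y. case (x, y) of (x, y) \<Rightarrow> ?e x * ?e y) has_sum (?e x * S)) UNIV" for x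
    using has_sum_cmult_right[OF S, of "?e x"] by simp
  have 2: "((\<lambda>x. ?e x * S) has_sum (S * S)) UNIV"
    by (rule has_sum_cmult_left[OF S])
  have "((\<lambda>(x, y). ?e x * ?e y) has_sum (S * S)) (Sigma UNIV (\<lambda>_. UNIV))"
    by (rule has_sum_SigmaI[OF 1 2], rule summable_on_SigmaI[OF 1])
       (use 2 in \<open>auto simp: summable_on_def\<close>)
  moreover have "?e x * ?e y = exp (- \<delta> * (\<bar>of_int x\<bar> + \<bar>of_int y\<bar>))" for x y
    by (simp add: exp_add[symmetric] algebra_simps)
  ultimately show ?thesis by (simp add: power2_eq_square)
qed

text \<open>The mean value theorem three times: for the second difference of f on [0, 1], for the
  first difference of f1 from z to z + 1, and for f2 from w to w + 1. The final point therefore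
  stays below 3.\<close>

lemma third_difference_mean_value:
  fixes f f1 f2 f3 :: "real \<Rightarrow> real"
  assumes "\<And>t. (f has_real_derivative f1 t) (at t)" "\<And>t. (f1 has_real_derivative f2 t) (at t)"
    "\<And>t. (f2 has_real_derivative f3 t) (at t)"
  obtains \<xi> where "0 \<le> \<xi>" "\<xi> \<le> 3" "f 0 - 3 * f 1 + 3 * f 2 - f 3 = - f3 \<xi>"
proof -
  have shift: "((\<lambda>t. g (t + c)) has_real_derivative g' (t + c)) (at t)"
    if "\<And>t. (g has_real_derivative g' t) (at t)" for g g' :: "real \<Rightarrow> real" and c t
    using DERIV_shift[of g "g' (t + c)" t c] that[of "t + c"] by (simp add: add.commute)
  note d = assms[THEN shift] assms
  have "\<exists>z. 0 < z \<and> z < 1 \<and> (f (1 + 2) - 2 * f (1 + 1) + f 1) - (f (0 + 2) - 2 * f (0 + 1) + f 0) =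
      (1 - 0) * (f1 (z + 2) - 2 * f1 (z + 1) + f1 z)"
    by (rule MVT2) (auto intro!: derivative_eq_intros d)
  then obtain z where z: "0 < z" "z < 1"
    "f 3 - 2 * f 2 + f 1 - (f 2 - 2 * f 1 + f 0) = f1 (z + 2) - 2 * f1 (z + 1) + f1 z" by auto
  have "\<exists>w. z < w \<and> w < z + 1 \<and> (f1 (z + 1 + 1) - f1 (z + 1)) - (f1 (z + 1) - f1 z) =
      (z + 1 - z) * (f2 (w + 1) - f2 w)"
    by (rule MVT2) (auto intro!: derivative_eq_intros d)
  then obtain w where w: "z < w" "w < z + 1"
    "f1 (z + 2) - f1 (z + 1) - (f1 (z + 1) - f1 z) = f2 (w + 1) - f2 w" by (auto simp: add.assoc)
  have "\<exists>v. w < v \<and> v < w + 1 \<and> f2 (w + 1) - f2 w = (w + 1 - w) * f3 v"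
    by (rule MVT2) (auto intro!: d)
  then obtain v where "w < v" "v < w + 1" "f2 (w + 1) - f2 w = f3 v" by auto
  thus thesis using z w by (intro that[of v]) auto
qed

text \<open>With P the quadratic and w = sqrt \<epsilon> P'(\<xi>), the third derivative of g is
  \<epsilon> sqrt \<epsilon> (6 \<alpha> w - w^3) g, which exhibits the gain. The discriminant
  condition gives w^2 \<le> 4 \<alpha> \<epsilon> P, so half of the exponential absorbs the
  polynomial in w; the other half is kept for the summation over the lattice.\<close>

lemma exp_quadratic_third_difference:
  fixes \<alpha> \<beta> \<gamma> \<epsilon> :: real
  assumes "\<alpha> > 0" "\<beta>\<^sup>2 \<le> 4 * \<alpha> * \<gamma>" "\<epsilon> > 0"
  defines "g \<equiv> \<lambda>t. exp (- \<epsilon> * (\<alpha> * t\<^sup>2 + \<beta> * t + \<gamma>))"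
  obtains \<xi> where "0 \<le> \<xi>" "\<xi> \<le> 3"
    "\<bar>g 0 - 3 * g 1 + 3 * g 2 - g 3\<bar> \<le>
     (1 + 6 * \<alpha> + 176 * \<alpha>\<^sup>2) * (\<epsilon> * sqrt \<epsilon>) * exp (- \<epsilon> * (\<alpha> * \<xi>\<^sup>2 + \<beta> * \<xi> + \<gamma>) / 2)"
proof -
  define P where "P = (\<lambda>t. \<alpha> * t\<^sup>2 + \<beta> * t + \<gamma>)"
  define P' where "P' = (\<lambda>t. 2 * \<alpha> * t + \<beta>)"
  define g1 where "g1 = (\<lambda>t. - \<epsilon> * P' t * g t)"
  define g2 where "g2 = (\<lambda>t. (\<epsilon>\<^sup>2 * (P' t)\<^sup>2 - 2 * \<alpha> * \<epsilon>) * g t)"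
  define g3 where "g3 = (\<lambda>t. (6 * \<alpha> * \<epsilon>\<^sup>2 * P' t - \<epsilon>^3 * (P' t)^3) * g t)"
  have d0: "(g has_real_derivative g1 t) (at t)" for t
    unfolding g_def g1_def P'_def by (auto intro!: derivative_eq_intros simp: algebra_simps)
  have dP: "(P' has_real_derivative 2 * \<alpha>) (at t)" for t
    unfolding P'_def by (auto intro!: derivative_eq_intros)
  have d1: "(g1 has_real_derivative g2 t) (at t)" for t
    unfolding g1_def g2_def
    by (auto intro!: derivative_eq_intros d0 dP simp: g1_def algebra_simps power2_eq_square)
  have d2: "(g2 has_real_derivative g3 t) (at t)" for t
    unfolding g2_def g3_def
    by (auto intro!: derivative_eq_intros d0 dP simp: g1_def algebra_simps power2_eq_square power3_eq_cube)
  obtain \<xi> where \<xi>: "0 \<le> \<xi>" "\<xi> \<le> 3" "g 0 - 3 * g 1 + 3 * g 2 - g 3 = - g3 \<xi>"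
    using third_difference_mean_value[OF d0 d1 d2] .
  define u where "u = \<epsilon> * P \<xi>"
  define w where "w = sqrt \<epsilon> * P' \<xi>"
  define e where "e = exp (u / 2)"
  have "(P' \<xi>)\<^sup>2 = 4 * \<alpha> * P \<xi> - (4 * \<alpha> * \<gamma> - \<beta>\<^sup>2)"
    by (simp add: P'_def P_def power2_eq_square algebra_simps)
  hence "(P' \<xi>)\<^sup>2 \<le> 4 * \<alpha> * P \<xi>" using assms(2) by linarith
  hence "\<epsilon> * (P' \<xi>)\<^sup>2 \<le> \<epsilon> * (4 * \<alpha> * P \<xi>)" using assms(3) by simp
  hence w2: "w\<^sup>2 \<le> 4 * \<alpha> * u" using assms(3) by (simp add: w_def u_def power_mult_distrib algebra_simps)
  hence u0: "u \<ge> 0" using assms(1) zero_le_power2[of w] by (smt (verit) mult_pos_neg)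
  have "1 + u / 2 + (u / 2)\<^sup>2 / 2 \<le> e"
    unfolding e_def using u0 by (intro exp_lower_Taylor_quadratic) auto
  hence "1 + u / 2 + u\<^sup>2 / 8 \<le> e" by (simp add: power_divide)
  \<comment> \<open>The terms of the Taylor bound taken separately. The factors 2 and 8 become 8
    \<alpha> and 128 \<alpha>^2 below, and 6 * 8 + 128 = 176 is the final constant.\<close>
  hence e: "1 \<le> e" "u \<le> 2 * e" "u\<^sup>2 \<le> 8 * e"
    using u0 zero_le_power2[of u] by linarith+
  have "\<bar>w\<bar> \<le> 1 + w\<^sup>2" using zero_le_power2[of "\<bar>w\<bar> - 1"] by (simp add: power2_eq_square algebra_simps)
  also have "\<dots> \<le> 1 + 4 * \<alpha> * u" using w2 by simp
  also have "\<dots> \<le> e + 4 * \<alpha> * (2 * e)" using e assms(1) by (intro add_mono mult_left_mono) auto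
  finally have w1: "\<bar>w\<bar> \<le> (1 + 8 * \<alpha>) * e" by (simp add: algebra_simps)
  have "\<bar>w\<bar>^3 \<le> 1 + (w\<^sup>2)\<^sup>2"
  proof (cases "\<bar>w\<bar> \<le> 1")
    case True
    hence "\<bar>w\<bar>^3 \<le> 1" by (simp add: power_le_one)
    thus ?thesis by (simp add: add_increasing2)
  next
    case False
    hence "\<bar>w\<bar>^3 \<le> \<bar>w\<bar>^4" by (intro power_increasing) auto
    thus ?thesis by (simp add: power2_eq_square power4_eq_xxxx mult.assoc)
  qed
  also have "\<dots> \<le> 1 + (4 * \<alpha> * u)\<^sup>2" using w2 by (intro add_left_mono power_mono) auto
  also have "\<dots> = 1 + 16 * \<alpha>\<^sup>2 * u\<^sup>2" by (simp add: power_mult_distrib)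
  also have "\<dots> \<le> e + 16 * \<alpha>\<^sup>2 * (8 * e)" using e by (intro add_mono mult_left_mono) auto
  finally have w3: "\<bar>w\<bar>^3 \<le> (1 + 128 * \<alpha>\<^sup>2) * e" by (simp add: algebra_simps)
  have "\<bar>6 * \<alpha> * w - w^3\<bar> \<le> 6 * \<alpha> * \<bar>w\<bar> + \<bar>w\<bar>^3"
    using abs_triangle_ineq4[of "6 * \<alpha> * w" "w^3"] assms(1) by (simp add: abs_mult power_abs)
  also have "\<dots> \<le> 6 * \<alpha> * ((1 + 8 * \<alpha>) * e) + (1 + 128 * \<alpha>\<^sup>2) * e"
    using w1 w3 assms(1) by (intro add_mono mult_left_mono) auto
  finally have main: "\<bar>6 * \<alpha> * w - w^3\<bar> \<le> (1 + 6 * \<alpha> + 176 * \<alpha>\<^sup>2) * e"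
    by (simp add: algebra_simps power2_eq_square)
  have "6 * \<alpha> * \<epsilon>\<^sup>2 * P' \<xi> - \<epsilon>^3 * (P' \<xi>)^3 = \<epsilon> * sqrt \<epsilon> * (6 * \<alpha> * w - w^3)"
  proof -
    have "\<epsilon> = sqrt \<epsilon> * sqrt \<epsilon>" using assms(3) by simp
    then obtain s where s: "\<epsilon> = s * s" "sqrt \<epsilon> = s" by blast
    show ?thesis unfolding w_def s(2) unfolding s(1) by (simp add: algebra_simps power2_eq_square power3_eq_cube)
  qed
  hence "\<bar>g3 \<xi>\<bar> = \<epsilon> * sqrt \<epsilon> * \<bar>6 * \<alpha> * w - w^3\<bar> * exp (- u)"
    using assms(3) by (simp add: g3_def abs_mult g_def u_def P_def)
  also have "\<dots> \<le> \<epsilon> * sqrt \<epsilon> * ((1 + 6 * \<alpha> + 176 * \<alpha>\<^sup>2) * e) * exp (- u)"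
    using assms(3) by (intro mult_right_mono mult_left_mono main) auto
  also have "\<dots> = (1 + 6 * \<alpha> + 176 * \<alpha>\<^sup>2) * (\<epsilon> * sqrt \<epsilon>) * (e * exp (- u))"
    by (simp add: mult_ac)
  also have "e * exp (- u) = exp (- u / 2)" by (simp add: e_def exp_add[symmetric])
  finally show thesis using \<xi> that by (simp add: u_def P_def)
qed

section \<open>Lattice sums of a positive definite real form\<close>

context
  fixes a b c :: real
  assumes a: "a > 0" and c: "c > 0" and disc: "b\<^sup>2 + 1 \<le> 4 * a * c"
begin

definition qf :: "real \<Rightarrow> real \<Rightarrow> real" where
  "qf x y = a * x\<^sup>2 + b * x * y + c * y\<^sup>2"

text \<open>Completing the square in either variable. The gap 1 between b^2 and 4 a c is what an
  integral form of negative discriminant provides.\<close>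

lemma qf_lower_bound: "x\<^sup>2 + y\<^sup>2 \<le> 4 * (a + c) * qf x y"
proof -
  have "4 * a * qf x y = (2 * a * x + b * y)\<^sup>2 + (4 * a * c - b\<^sup>2) * y\<^sup>2"
    by (simp add: qf_def power2_eq_square algebra_simps)
  moreover have "1 * y\<^sup>2 \<le> (4 * a * c - b\<^sup>2) * y\<^sup>2" using disc by (intro mult_right_mono) auto
  ultimately have 1: "y\<^sup>2 \<le> 4 * a * qf x y" using zero_le_power2[of "2 * a * x + b * y"] by linarith
  have "4 * c * qf x y = (2 * c * y + b * x)\<^sup>2 + (4 * a * c - b\<^sup>2) * x\<^sup>2"
    by (simp add: qf_def power2_eq_square algebra_simps)
  moreover have "1 * x\<^sup>2 \<le> (4 * a * c - b\<^sup>2) * x\<^sup>2" using disc by (intro mult_right_mono) auto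
  ultimately have 2: "x\<^sup>2 \<le> 4 * c * qf x y" using zero_le_power2[of "2 * c * y + b * x"] by linarith
  show ?thesis using 1 2 by (simp add: algebra_simps)
qed

text \<open>The rate \<delta> for which \<open>qf_lower_bound\<close> reads \<delta>^2 (x^2 + y^2)
  \<le> \<epsilon> qf x y / 2. Trading quadratic for linear decay lets the lattice sum factor into
  geometric series.\<close>

definition decay :: "real \<Rightarrow> real" where
  "decay \<epsilon> = sqrt (\<epsilon> / (8 * (a + c)))"

lemma decay_pos: "\<epsilon> > 0 \<Longrightarrow> decay \<epsilon> > 0"
  using a c by (simp add: decay_def)

text \<open>From (\<delta>|z| - 1/2)^2 \<ge> 0 for z = x and z = y; each costs 1/4 in the exponent,
  whence \<open>exp (1 / 2)\<close>.\<close>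

lemma exp_qf_bound:
  assumes "\<epsilon> > 0"
  shows "exp (- \<epsilon> * qf x y / 2) \<le> exp (1 / 2) * exp (- decay \<epsilon> * (\<bar>x\<bar> + \<bar>y\<bar>))"
proof -
  define \<delta> where "\<delta> = decay \<epsilon>"
  have \<delta>2: "\<delta>\<^sup>2 = \<epsilon> / (8 * (a + c))" using assms a c by (simp add: \<delta>_def decay_def)
  have *: "\<delta> * \<bar>z\<bar> - 1 / 4 \<le> \<delta>\<^sup>2 * z\<^sup>2" for z
  proof -
    have "0 \<le> (\<delta> * \<bar>z\<bar> - 1 / 2)\<^sup>2" by simp
    also have "\<dots> = \<delta>\<^sup>2 * z\<^sup>2 - \<delta> * \<bar>z\<bar> + 1 / 4" by (simp add: power2_diff power_mult_distrib) (simp add: power2_eq_square)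
    finally show ?thesis by linarith
  qed
  have "\<delta>\<^sup>2 * (x\<^sup>2 + y\<^sup>2) \<le> \<delta>\<^sup>2 * (4 * (a + c) * qf x y)"
    by (intro mult_left_mono qf_lower_bound) auto
  also have "\<dots> = \<epsilon> * qf x y / 2" using a c unfolding \<delta>2 by (simp add: field_simps)
  finally have "- \<epsilon> * qf x y / 2 \<le> 1 / 2 - \<delta> * (\<bar>x\<bar> + \<bar>y\<bar>)"
    using *[of x] *[of y] by (simp add: algebra_simps)
  thus ?thesis by (simp add: exp_add[symmetric] \<delta>_def)
qed

definition gauss :: "real \<Rightarrow> int \<times> int \<Rightarrow> real" where
  "gauss \<epsilon> v = exp (- \<epsilon> * qf (of_int (fst v)) (of_int (snd v)))"

lemma gauss_summable:
  assumes "\<epsilon> > 0"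
  shows "gauss \<epsilon> summable_on UNIV"
proof (rule summable_on_comparison_test)
  have "(\<lambda>(x::int, y::int). exp (- decay (2 * \<epsilon>) * (\<bar>of_int x\<bar> + \<bar>of_int y\<bar>))) summable_on UNIV"
    using has_sum_exp_abs_int_prod[OF decay_pos[of "2 * \<epsilon>"]] assms by (auto simp: summable_on_def)
  thus "(\<lambda>v. exp (1 / 2) * (case v of (x::int, y::int) \<Rightarrow> exp (- decay (2 * \<epsilon>) * (\<bar>of_int x\<bar> + \<bar>of_int y\<bar>)))) summable_on UNIV"
    by (rule summable_on_cmult_right)
  show "gauss \<epsilon> v \<le> exp (1 / 2) * (case v of (x::int, y::int) \<Rightarrow> exp (- decay (2 * \<epsilon>) * (\<bar>of_int x\<bar> + \<bar>of_int y\<bar>)))" for v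
    using exp_qf_bound[of "2 * \<epsilon>" "of_int (fst v)" "of_int (snd v)"] assms
    by (auto simp: gauss_def split: prod.split)
qed (simp add: gauss_def)

lemma has_sum_weighted_gauss:
  assumes "\<epsilon> > 0" "\<And>v. \<bar>s v\<bar> \<le> 1"
  shows "((\<lambda>v. s v * gauss \<epsilon> v) has_sum (\<Sum>\<^sub>\<infinity>v. s v * gauss \<epsilon> v)) UNIV"
proof -
  have "norm (s v * gauss \<epsilon> v) \<le> gauss \<epsilon> v" for v
    using mult_right_mono[OF assms(2)[of v], of "gauss \<epsilon> v"] by (simp add: gauss_def abs_mult)
  hence "(\<lambda>v. norm (s v * gauss \<epsilon> v)) summable_on UNIV"
    using gauss_summable[OF assms(1)] by (intro Infinite_Sum.abs_summable_on_comparison_test'[of "gauss \<epsilon>"]) auto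
  hence "(\<lambda>v. s v * gauss \<epsilon> v) summable_on UNIV" by (rule abs_summable_summable)
  thus ?thesis by (rule has_sum_infsum)
qed

text \<open>On the line through (x, y) in direction (e1, e2) the form is a quadratic polynomial, so
  \<open>exp_quadratic_third_difference\<close> applies. Its bound lives at an intermediate point;
  moving back to (x, y) changes |x| + |y| by at most 3, which costs the factor
  \<open>exp (3 * decay 1)\<close>, uniform in \<epsilon> \<le> 1.\<close>

lemma gauss_third_difference:
  assumes "0 < \<epsilon>" "\<epsilon> \<le> 1" "(e1, e2) = (1, 0) \<or> (e1, e2) = (0, 1)"
  defines "K \<equiv> (1 + 6 * (a + c) + 176 * (a + c)\<^sup>2) * exp (1 / 2 + 3 * decay 1)"
  shows "\<bar>gauss \<epsilon> (x, y) - 3 * gauss \<epsilon> (x + e1, y + e2) + 3 * gauss \<epsilon> (x + 2 * e1, y + 2 * e2)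
      - gauss \<epsilon> (x + 3 * e1, y + 3 * e2)\<bar>
    \<le> K * (\<epsilon> * sqrt \<epsilon>) * exp (- decay \<epsilon> * (\<bar>of_int x\<bar> + \<bar>of_int y\<bar>))"
proof -
  define \<alpha> where "\<alpha> = (if e1 = 1 then a else c)"
  define \<beta> where "\<beta> = (if e1 = 1 then 2 * a * of_int x + b * of_int y else 2 * c * of_int y + b * of_int x)"
  define \<gamma> where "\<gamma> = qf (of_int x) (of_int y)"
  have e: "e1 = 1 \<and> e2 = 0 \<or> e1 = 0 \<and> e2 = 1" using assms(3) by auto
  have line: "qf (of_int x + t * of_int e1) (of_int y + t * of_int e2) = \<alpha> * t\<^sup>2 + \<beta> * t + \<gamma>" for t
    using e by (auto simp: qf_def \<alpha>_def \<beta>_def \<gamma>_def power2_eq_square algebra_simps)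
  have \<alpha>: "\<alpha> > 0" "\<alpha> \<le> a + c" using a c by (auto simp: \<alpha>_def)
  have "4 * \<alpha> * \<gamma> - \<beta>\<^sup>2 = (4 * a * c - b\<^sup>2) * (if e1 = 1 then of_int y else of_int x)\<^sup>2"
    by (simp add: \<alpha>_def \<beta>_def \<gamma>_def qf_def power2_eq_square algebra_simps)
  also have "\<dots> \<ge> 0" using disc by (intro mult_nonneg_nonneg) auto
  finally have "\<beta>\<^sup>2 \<le> 4 * \<alpha> * \<gamma>" by linarith
  from exp_quadratic_third_difference[OF \<alpha>(1) this assms(1)] obtain \<xi> where \<xi>: "0 \<le> \<xi>" "\<xi> \<le> 3"
    and D: "\<bar>exp (- \<epsilon> * (\<alpha> * 0\<^sup>2 + \<beta> * 0 + \<gamma>)) - 3 * exp (- \<epsilon> * (\<alpha> * 1\<^sup>2 + \<beta> * 1 + \<gamma>)) +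
       3 * exp (- \<epsilon> * (\<alpha> * 2\<^sup>2 + \<beta> * 2 + \<gamma>)) - exp (- \<epsilon> * (\<alpha> * 3\<^sup>2 + \<beta> * 3 + \<gamma>))\<bar>
      \<le> (1 + 6 * \<alpha> + 176 * \<alpha>\<^sup>2) * (\<epsilon> * sqrt \<epsilon>) * exp (- \<epsilon> * (\<alpha> * \<xi>\<^sup>2 + \<beta> * \<xi> + \<gamma>) / 2)" .
  have "exp (- \<epsilon> * (\<alpha> * \<xi>\<^sup>2 + \<beta> * \<xi> + \<gamma>) / 2) \<le>
      exp (1 / 2) * exp (- decay \<epsilon> * (\<bar>of_int x + \<xi> * of_int e1\<bar> + \<bar>of_int y + \<xi> * of_int e2\<bar>))"
    unfolding line[symmetric] using assms(1) by (rule exp_qf_bound)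
  also have "\<dots> \<le> exp (1 / 2) * exp (3 * decay 1 - decay \<epsilon> * (\<bar>of_int x\<bar> + \<bar>of_int y\<bar>))"
  proof -
    have "\<bar>of_int x\<bar> + \<bar>of_int y\<bar> - 3 \<le> \<bar>of_int x + \<xi> * of_int e1\<bar> + \<bar>of_int y + \<xi> * of_int e2\<bar>"
      using e \<xi> by auto
    hence "decay \<epsilon> * (\<bar>of_int x\<bar> + \<bar>of_int y\<bar> - 3) \<le> decay \<epsilon> * (\<bar>of_int x + \<xi> * of_int e1\<bar> + \<bar>of_int y + \<xi> * of_int e2\<bar>)"
      using decay_pos[OF assms(1)] by (intro mult_left_mono) auto
    moreover have "decay \<epsilon> \<le> decay 1"
      unfolding decay_def using assms(2) a c by (intro real_sqrt_le_mono divide_right_mono) auto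
    ultimately show ?thesis by (simp add: algebra_simps)
  qed
  also have "\<dots> = exp (1 / 2 + 3 * decay 1) * exp (- decay \<epsilon> * (\<bar>of_int x\<bar> + \<bar>of_int y\<bar>))"
    by (simp add: exp_add[symmetric])
  finally have E: "exp (- \<epsilon> * (\<alpha> * \<xi>\<^sup>2 + \<beta> * \<xi> + \<gamma>) / 2) \<le>
    exp (1 / 2 + 3 * decay 1) * exp (- decay \<epsilon> * (\<bar>of_int x\<bar> + \<bar>of_int y\<bar>))" .
  have "(1 + 6 * \<alpha> + 176 * \<alpha>\<^sup>2) \<le> (1 + 6 * (a + c) + 176 * (a + c)\<^sup>2)"
    using \<alpha> by (intro add_mono mult_left_mono power_mono) auto
  hence "(1 + 6 * \<alpha> + 176 * \<alpha>\<^sup>2) * (\<epsilon> * sqrt \<epsilon>) * exp (- \<epsilon> * (\<alpha> * \<xi>\<^sup>2 + \<beta> * \<xi> + \<gamma>) / 2) \<le>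
    (1 + 6 * (a + c) + 176 * (a + c)\<^sup>2) * (\<epsilon> * sqrt \<epsilon>) *
    (exp (1 / 2 + 3 * decay 1) * exp (- decay \<epsilon> * (\<bar>of_int x\<bar> + \<bar>of_int y\<bar>)))"
    using assms(1) a c E by (intro mult_mono mult_right_mono) auto
  moreover have "gauss \<epsilon> (x + of_nat k * e1, y + of_nat k * e2) = exp (- \<epsilon> * (\<alpha> * (real k)\<^sup>2 + \<beta> * real k + \<gamma>))" for k
    using line[of "real k"] by (simp add: gauss_def)
  from this[of 0] this[of 1] this[of 2] this[of 3]
  have "gauss \<epsilon> (x, y) = exp (- \<epsilon> * (\<alpha> * 0\<^sup>2 + \<beta> * 0 + \<gamma>))"
    "gauss \<epsilon> (x + e1, y + e2) = exp (- \<epsilon> * (\<alpha> * 1\<^sup>2 + \<beta> * 1 + \<gamma>))"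
    "gauss \<epsilon> (x + 2 * e1, y + 2 * e2) = exp (- \<epsilon> * (\<alpha> * 2\<^sup>2 + \<beta> * 2 + \<gamma>))"
    "gauss \<epsilon> (x + 3 * e1, y + 3 * e2) = exp (- \<epsilon> * (\<alpha> * 3\<^sup>2 + \<beta> * 3 + \<gamma>))" by simp_all
  ultimately show ?thesis using D unfolding K_def by (simp only: mult_ac)
qed

text \<open>Shifting by \<open>(e1, e2)\<close> flips the sign of \<open>s\<close>, so the sum is one eighth of the sum of the third
  differences. These have size \<open>\<epsilon>\<^bsup>3/2\<^esup>\<close> on about \<open>1/\<epsilon>\<close> lattice points; second differences would
  only give a bounded quantity.\<close>

lemma alternating_gauss_sum_bound:
  fixes s :: "int \<times> int \<Rightarrow> real"
  assumes "(e1, e2) = (1, 0) \<or> (e1, e2) = (0, 1)"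
    "\<And>v. \<bar>s v\<bar> \<le> 1" "\<And>x y. s (x + e1, y + e2) = - s (x, y)"
  obtains C where "\<And>\<epsilon>. 0 < \<epsilon> \<Longrightarrow> \<epsilon> \<le> 1 \<Longrightarrow> \<bar>\<Sum>\<^sub>\<infinity>v. s v * gauss \<epsilon> v\<bar> \<le> C * sqrt \<epsilon>"
proof -
  define K where "K = (1 + 6 * (a + c) + 176 * (a + c)\<^sup>2) * exp (1 / 2 + 3 * decay 1)"
  have K: "K \<ge> 0" using a c by (simp add: K_def)
  have "\<bar>\<Sum>\<^sub>\<infinity>v. s v * gauss \<epsilon> v\<bar> \<le> (K * (2 * (1 + decay 1))\<^sup>2 * (8 * (a + c))) * sqrt \<epsilon>"
    if \<epsilon>: "0 < \<epsilon>" "\<epsilon> \<le> 1" for \<epsilon>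
  proof -
    define I where "I = (\<Sum>\<^sub>\<infinity>v. s v * gauss \<epsilon> v)"
    have I: "((\<lambda>v. s v * gauss \<epsilon> v) has_sum I) UNIV"
      unfolding I_def by (rule has_sum_weighted_gauss[OF \<epsilon>(1) assms(2)])
    have shift: "s (x + int k * e1, y + int k * e2) = (- 1) ^ k * s (x, y)" for k x y
    proof (induction k)
      case (Suc k)
      have "s (x + int (Suc k) * e1, y + int (Suc k) * e2) = s ((x + int k * e1) + e1, (y + int k * e2) + e2)"
        by (simp add: algebra_simps)
      thus ?case unfolding assms(3) using Suc by simp
    qed simp
    have Ik: "((\<lambda>v. s v * gauss \<epsilon> (fst v + int k * e1, snd v + int k * e2)) has_sum ((- 1) ^ k * I)) UNIV" for k
    proof -
      have "((\<lambda>v. (- 1) ^ k * (s v * gauss \<epsilon> v)) has_sum ((- 1) ^ k * I)) UNIV"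
        by (rule has_sum_cmult_right[OF I])
      also have "?this \<longleftrightarrow> ((\<lambda>v. s v * gauss \<epsilon> (fst v + int k * e1, snd v + int k * e2)) has_sum ((- 1) ^ k * I)) UNIV"
      proof (rule has_sum_reindex_bij_witness[where i = "\<lambda>v. (fst v + int k * e1, snd v + int k * e2)"
            and j = "\<lambda>v. (fst v - int k * e1, snd v - int k * e2)"])
        fix v :: "int \<times> int"
        have "s v = (- 1) ^ k * s (fst v - int k * e1, snd v - int k * e2)"
          using shift[of "fst v - int k * e1" k "snd v - int k * e2"] by simp
        thus "s (fst v - int k * e1, snd v - int k * e2) *
          gauss \<epsilon> (fst (fst v - int k * e1, snd v - int k * e2) + int k * e1,
                   snd (fst v - int k * e1, snd v - int k * e2) + int k * e2) = (- 1) ^ k * (s v * gauss \<epsilon> v)"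
          by (simp add: power_mult_distrib[symmetric] mult.assoc[symmetric])
      qed auto
      finally show ?thesis .
    qed
    let ?D = "\<lambda>v. gauss \<epsilon> v - 3 * gauss \<epsilon> (fst v + e1, snd v + e2) +
        3 * gauss \<epsilon> (fst v + 2 * e1, snd v + 2 * e2) - gauss \<epsilon> (fst v + 3 * e1, snd v + 3 * e2)"
    have "((\<lambda>v. s v * gauss \<epsilon> v - 3 * (s v * gauss \<epsilon> (fst v + e1, snd v + e2)) +
        3 * (s v * gauss \<epsilon> (fst v + 2 * e1, snd v + 2 * e2)) - s v * gauss \<epsilon> (fst v + 3 * e1, snd v + 3 * e2))
       has_sum (I - 3 * (- I) + 3 * I - (- I))) UNIV"
      using Ik[of 1] Ik[of 2] Ik[of 3] I
      by (intro has_sum_diff has_sum_add has_sum_cmult_right) (simp_all add: power3_eq_cube)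
    hence D: "((\<lambda>v. s v * ?D v) has_sum (8 * I)) UNIV" by (simp add: algebra_simps)
    define S where "S = (1 + exp (- decay \<epsilon>)) / (1 - exp (- decay \<epsilon>))"
    have E: "((\<lambda>v. K * (\<epsilon> * sqrt \<epsilon>) * (case v of (x::int, y::int) \<Rightarrow> exp (- decay \<epsilon> * (\<bar>of_int x\<bar> + \<bar>of_int y\<bar>))))
        has_sum (K * (\<epsilon> * sqrt \<epsilon>) * S\<^sup>2)) UNIV"
      unfolding S_def by (intro has_sum_cmult_right has_sum_exp_abs_int_prod decay_pos \<epsilon>)
    have "norm (8 * I) \<le> K * (\<epsilon> * sqrt \<epsilon>) * S\<^sup>2"
    proof (rule norm_infsum_le[OF D E])
      fix v :: "int \<times> int"
      obtain x y where v: "v = (x, y)" by (cases v)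
      have "norm (s v * ?D v) \<le> 1 * \<bar>?D v\<bar>"
        unfolding real_norm_def abs_mult using assms(2) by (intro mult_right_mono) auto
      also have "\<dots> \<le> K * (\<epsilon> * sqrt \<epsilon>) * exp (- decay \<epsilon> * (\<bar>of_int x\<bar> + \<bar>of_int y\<bar>))"
        using gauss_third_difference[OF \<epsilon> assms(1), of x y] by (simp add: v K_def)
      finally show "norm (s v * ?D v) \<le> K * (\<epsilon> * sqrt \<epsilon>) * (case v of (x, y) \<Rightarrow> exp (- decay \<epsilon> * (\<bar>of_int x\<bar> + \<bar>of_int y\<bar>)))"
        by (simp add: v)
    qed
    also have "\<dots> \<le> K * (\<epsilon> * sqrt \<epsilon>) * ((2 * (1 + decay 1))\<^sup>2 / (\<epsilon> / (8 * (a + c))))"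
    proof (intro mult_left_mono)
      have dle: "decay \<epsilon> \<le> decay 1"
        unfolding decay_def using \<epsilon>(2) a c by (intro real_sqrt_le_mono divide_right_mono) auto
      have d0: "decay \<epsilon> > 0" using decay_pos[OF \<epsilon>(1)] .
      have "S \<le> 2 * (1 + decay \<epsilon>) / decay \<epsilon>"
        unfolding S_def by (rule exp_abs_int_sum_le[OF d0])
      also have "\<dots> \<le> 2 * (1 + decay 1) / decay \<epsilon>"
        using dle d0 by (intro divide_right_mono) auto
      finally have "S\<^sup>2 \<le> (2 * (1 + decay 1) / decay \<epsilon>)\<^sup>2"
        using d0 by (intro power_mono) (auto simp: S_def)
      also have "\<dots> = (2 * (1 + decay 1))\<^sup>2 / (\<epsilon> / (8 * (a + c)))"
        using \<epsilon> a c by (simp add: power_divide decay_def)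
      finally show "S\<^sup>2 \<le> (2 * (1 + decay 1))\<^sup>2 / (\<epsilon> / (8 * (a + c)))" .
    qed (use K \<epsilon> in auto)
    also have "\<dots> = (K * (2 * (1 + decay 1))\<^sup>2 * (8 * (a + c))) * sqrt \<epsilon>"
      using \<epsilon> by simp
    finally show ?thesis unfolding I_def by simp
  qed
  thus thesis using that by blast
qed

text \<open>Four times the indicator of the doubled vectors, minus 1, is the sum of the three
  nontrivial characters of the lattice modulo 2, and the sum over doubled vectors at \<epsilon> is
  the full sum at 4 \<epsilon>. Each character changes sign along a coordinate direction, as
  \<open>alternating_gauss_sum_bound\<close> requires.\<close>

lemma gauss_dilation_bound:
  obtains C where "\<And>\<epsilon>. 0 < \<epsilon> \<Longrightarrow> \<epsilon> \<le> 1 \<Longrightarrow>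
    \<bar>4 * (\<Sum>\<^sub>\<infinity>v. gauss (4 * \<epsilon>) v) - (\<Sum>\<^sub>\<infinity>v. gauss \<epsilon> v)\<bar> \<le> C * sqrt \<epsilon>"
proof -
  define sg :: "int \<Rightarrow> real" where "sg = (\<lambda>x. if even x then 1 else - 1)"
  obtain C1 where C1: "\<And>\<epsilon>. 0 < \<epsilon> \<Longrightarrow> \<epsilon> \<le> 1 \<Longrightarrow> \<bar>\<Sum>\<^sub>\<infinity>v. sg (fst v) * gauss \<epsilon> v\<bar> \<le> C1 * sqrt \<epsilon>"
    by (rule alternating_gauss_sum_bound[of 1 0 "\<lambda>v. sg (fst v)"]) (auto simp: sg_def)
  obtain C2 where C2: "\<And>\<epsilon>. 0 < \<epsilon> \<Longrightarrow> \<epsilon> \<le> 1 \<Longrightarrow> \<bar>\<Sum>\<^sub>\<infinity>v. sg (snd v) * gauss \<epsilon> v\<bar> \<le> C2 * sqrt \<epsilon>"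
    by (rule alternating_gauss_sum_bound[of 0 1 "\<lambda>v. sg (snd v)"]) (auto simp: sg_def)
  obtain C3 where C3: "\<And>\<epsilon>. 0 < \<epsilon> \<Longrightarrow> \<epsilon> \<le> 1 \<Longrightarrow> \<bar>\<Sum>\<^sub>\<infinity>v. sg (fst v + snd v) * gauss \<epsilon> v\<bar> \<le> C3 * sqrt \<epsilon>"
    by (rule alternating_gauss_sum_bound[of 1 0 "\<lambda>v. sg (fst v + snd v)"]) (auto simp: sg_def)
  have "\<bar>4 * (\<Sum>\<^sub>\<infinity>v. gauss (4 * \<epsilon>) v) - (\<Sum>\<^sub>\<infinity>v. gauss \<epsilon> v)\<bar> \<le> (C1 + C2 + C3) * sqrt \<epsilon>"
    if \<epsilon>: "0 < \<epsilon>" "\<epsilon> \<le> 1" for \<epsilon>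
  proof -
    define T1 where "T1 = (\<Sum>\<^sub>\<infinity>v. gauss \<epsilon> v)"
    define T4 where "T4 = (\<Sum>\<^sub>\<infinity>v. gauss (4 * \<epsilon>) v)"
    have h1: "(gauss \<epsilon> has_sum T1) UNIV" and h4: "(gauss (4 * \<epsilon>) has_sum T4) UNIV"
      unfolding T1_def T4_def using gauss_summable[of \<epsilon>] gauss_summable[of "4 * \<epsilon>"] \<epsilon> by auto
    define E where "E = {v::int\<times>int. even (fst v) \<and> even (snd v)}"
    have "(gauss (4 * \<epsilon>) has_sum T4) UNIV \<longleftrightarrow> (gauss \<epsilon> has_sum T4) E"
      by (rule has_sum_reindex_bij_witness[where i = "\<lambda>v. (fst v div 2, snd v div 2)"
            and j = "\<lambda>v. (2 * fst v, 2 * snd v)"])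
         (auto simp: E_def gauss_def qf_def power2_eq_square algebra_simps)
    with h4 have "(gauss \<epsilon> has_sum T4) E" by simp
    also have "?this \<longleftrightarrow> ((\<lambda>v. if v \<in> E then gauss \<epsilon> v else 0) has_sum T4) UNIV"
      by (rule has_sum_cong_neutral) auto
    finally have "((\<lambda>v. if v \<in> E then gauss \<epsilon> v else 0) has_sum T4) UNIV" .
    hence "((\<lambda>v. 4 * (if v \<in> E then gauss \<epsilon> v else 0) - gauss \<epsilon> v) has_sum (4 * T4 - T1)) UNIV"
      by (intro has_sum_diff has_sum_cmult_right h1)
    moreover have "4 * (if v \<in> E then gauss \<epsilon> v else 0) - gauss \<epsilon> v =
      sg (fst v) * gauss \<epsilon> v + sg (snd v) * gauss \<epsilon> v + sg (fst v + snd v) * gauss \<epsilon> v" for v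
      by (auto simp: E_def sg_def)
    ultimately have "((\<lambda>v. sg (fst v) * gauss \<epsilon> v + sg (snd v) * gauss \<epsilon> v + sg (fst v + snd v) * gauss \<epsilon> v)
      has_sum (4 * T4 - T1)) UNIV" by simp
    moreover have "((\<lambda>v. sg (fst v) * gauss \<epsilon> v + sg (snd v) * gauss \<epsilon> v + sg (fst v + snd v) * gauss \<epsilon> v)
      has_sum ((\<Sum>\<^sub>\<infinity>v. sg (fst v) * gauss \<epsilon> v) + (\<Sum>\<^sub>\<infinity>v. sg (snd v) * gauss \<epsilon> v) + (\<Sum>\<^sub>\<infinity>v. sg (fst v + snd v) * gauss \<epsilon> v))) UNIV"
      by (intro has_sum_add has_sum_weighted_gauss \<epsilon>) (auto simp: sg_def)
    ultimately have "4 * T4 - T1 = (\<Sum>\<^sub>\<infinity>v. sg (fst v) * gauss \<epsilon> v) + (\<Sum>\<^sub>\<infinity>v. sg (snd v) * gauss \<epsilon> v) + (\<Sum>\<^sub>\<infinity>v. sg (fst v + snd v) * gauss \<epsilon> v)"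
      by (rule has_sum_unique)
    thus ?thesis using C1[OF \<epsilon>] C2[OF \<epsilon>] C3[OF \<epsilon>] unfolding T1_def T4_def
      by (simp add: algebra_simps)
  qed
  thus thesis using that by blast
qed

end

section \<open>Lambert series\<close>

text \<open>The Fermi function. By \<open>lambert_fermi\<close> it is what remains of the Lambert
  terms once the pole at 0 has cancelled; its smoothness and its value 1/2 at 0 govern the
  limit.\<close>

definition fermi :: "real \<Rightarrow> real" where "fermi x = 1 / (1 + exp x)"

lemma fermi_range: "0 < fermi x" "fermi x < 1"
  by (simp_all add: fermi_def add_pos_pos)

lemma fermi_le_exp: "fermi x \<le> exp (- x)"
  using exp_gt_zero[of x] by (simp add: fermi_def exp_minus field_simps add_pos_pos)

lemma fermi_deriv: "(fermi has_real_derivative (- (fermi x * (1 - fermi x)))) (at x)"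
proof -
  have "1 + exp x \<noteq> 0" using exp_gt_zero[of x] by linarith
  thus ?thesis unfolding fermi_def[abs_def]
    by (auto intro!: derivative_eq_intros simp: field_simps power2_eq_square)
qed

lemma fermi_deriv2:
  "((\<lambda>x. - (fermi x * (1 - fermi x))) has_real_derivative
     (fermi x * (1 - fermi x) * (1 - 2 * fermi x))) (at x)"
  by (auto intro!: derivative_eq_intros fermi_deriv simp: algebra_simps)

lemma fermi_lipschitz:
  assumes "x < y"
  shows "\<bar>fermi y - fermi x\<bar> \<le> y - x"
proof -
  obtain z where z: "fermi y - fermi x = (y - x) * - (fermi z * (1 - fermi z))"
    using MVT2[OF assms fermi_deriv] by blast
  have "fermi z * (1 - fermi z) \<le> 1 * 1" "0 \<le> fermi z * (1 - fermi z)"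
    using fermi_range[of z] by (intro mult_mono mult_nonneg_nonneg; simp)+
  hence "(y - x) * \<bar>fermi z * (1 - fermi z)\<bar> \<le> (y - x) * 1" using assms by (intro mult_left_mono) auto
  thus ?thesis unfolding z using assms by (simp add: abs_mult)
qed

text \<open>The mean value theorem twice. The derivatives are polynomials in \<open>fermi\<close>,
  which lies between 0 and 1, so the second one is at most fermi(w) \<le> exp(-w) in modulus, at a
  point w > x.\<close>

lemma fermi_second_difference:
  assumes "\<epsilon> > 0"
  shows "\<bar>(fermi x - fermi (x + \<epsilon>)) - (fermi (x + \<epsilon>) - fermi (x + 2 * \<epsilon>))\<bar> \<le> \<epsilon>\<^sup>2 * exp (- x)"
proof -
  define g where "g = (\<lambda>x. - (fermi x * (1 - fermi x)))"
  have shift: "((\<lambda>t. fermi (t + \<epsilon>)) has_real_derivative g (t + \<epsilon>)) (at t)" for t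
    using DERIV_shift[of fermi "g (t + \<epsilon>)" t \<epsilon>] fermi_deriv[of "t + \<epsilon>"] by (simp add: g_def add.commute)
  have "\<exists>z>x. z < x + \<epsilon> \<and> (fermi (x + \<epsilon> + \<epsilon>) - fermi (x + \<epsilon>)) - (fermi (x + \<epsilon>) - fermi x)
      = (x + \<epsilon> - x) * (g (z + \<epsilon>) - g z)"
    using assms by (intro MVT2) (auto intro!: derivative_eq_intros shift fermi_deriv simp: g_def)
  then obtain z where z: "x < z" "z < x + \<epsilon>"
    "fermi (x + 2 * \<epsilon>) - fermi (x + \<epsilon>) - (fermi (x + \<epsilon>) - fermi x) = \<epsilon> * (g (z + \<epsilon>) - g z)"
    by (auto simp: algebra_simps)
  obtain w where w: "z < w" "g (z + \<epsilon>) - g z = \<epsilon> * (fermi w * (1 - fermi w) * (1 - 2 * fermi w))"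
    using MVT2[of z "z + \<epsilon>" g, OF _ fermi_deriv2[folded g_def]] assms by auto
  have "\<bar>fermi w * (1 - fermi w) * (1 - 2 * fermi w)\<bar> \<le> fermi w * 1 * 1"
    unfolding abs_mult using fermi_range[of w] by (intro mult_mono) auto
  also have "\<dots> \<le> exp (- w)" using fermi_le_exp[of w] by simp
  also have "\<dots> \<le> exp (- x)" using w z by simp
  finally have "\<epsilon>\<^sup>2 * \<bar>fermi w * (1 - fermi w) * (1 - 2 * fermi w)\<bar> \<le> \<epsilon>\<^sup>2 * exp (- x)"
    by (intro mult_left_mono) auto
  moreover have "(fermi x - fermi (x + \<epsilon>)) - (fermi (x + \<epsilon>) - fermi (x + 2 * \<epsilon>)) =
      \<epsilon>\<^sup>2 * (fermi w * (1 - fermi w) * (1 - 2 * fermi w))"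
    using z(3) w(2) by (simp add: power2_eq_square)
  ultimately show ?thesis by (simp only: abs_mult abs_power2)
qed

text \<open>Two summations by parts are used: the first leaves differences of size \<epsilon>
  exp(-\<epsilon> n), whose absolute values sum only to order 1, whereas second differences of size
  \<epsilon>^2 exp(-\<epsilon> n) sum to O(\<epsilon>). Of the boundary terms,
  \<open>h2 0 * v 1\<close> is O(\<epsilon>), and \<open>h 0 * u 1\<close> is within O(\<epsilon>)
  of \<open>h 0 / 2\<close> because \<open>fermi 0\<close> is 1/2.\<close>

lemma fermi_sum_bound:
  assumes f: "zero_mean_periodic M f"
  obtains C where "\<And>\<epsilon>. 0 < \<epsilon> \<Longrightarrow> \<exists>S. (\<lambda>n. f (Suc n) * fermi (\<epsilon> * real (Suc n))) sums S \<and>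
    \<bar>S + antidiff M f 0 / 2\<bar> \<le> C * \<epsilon>"
proof -
  define h where "h = antidiff M f"
  define h2 where "h2 = antidiff M h"
  have h: "zero_mean_periodic M h" unfolding h_def by (rule zero_mean_periodic_antidiff[OF f])
  have "zero_mean_periodic M h2" unfolding h2_def by (rule zero_mean_periodic_antidiff[OF h])
  then obtain B where B: "B > 0" "\<And>n. \<bar>h2 n\<bar> \<le> B" using zero_mean_periodic_bounded by metis
  have "\<exists>S. (\<lambda>n. f (Suc n) * fermi (\<epsilon> * real (Suc n))) sums S \<and>
    \<bar>S + antidiff M f 0 / 2\<bar> \<le> (2 * B + \<bar>h 0\<bar>) * \<epsilon>" if \<epsilon>: "\<epsilon> > 0" for \<epsilon>
  proof -
    define u where "u = (\<lambda>n. fermi (\<epsilon> * real n))"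
    define v where "v = (\<lambda>n. u n - u (Suc n))"
    define r where "r = exp (- \<epsilon>)"
    have r: "0 < r" "r < 1" using \<epsilon> by (simp_all add: r_def)
    have rn: "exp (- (\<epsilon> * real n)) = r ^ n" for n
      by (simp add: r_def exp_of_nat_mult[symmetric] mult.commute)
    have u0: "u \<longlonglongrightarrow> 0"
    proof (rule Lim_null_comparison)
      show "\<forall>\<^sub>F n in sequentially. norm (u n) \<le> r ^ n"
        using fermi_le_exp fermi_range(1) by (auto simp: u_def rn[symmetric] less_imp_le)
      show "(\<lambda>n. r ^ n) \<longlonglongrightarrow> 0" using r by (intro LIMSEQ_power_zero) auto
    qed
    have v0: "v \<longlonglongrightarrow> 0"
      using tendsto_diff[OF u0 LIMSEQ_Suc[OF u0]] by (simp add: v_def)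
    have tb: "norm (h2 (Suc n) * (v (Suc n) - v (Suc (Suc n)))) \<le> B * \<epsilon>\<^sup>2 * r ^ Suc n" for n
    proof -
      have "\<bar>v (Suc n) - v (Suc (Suc n))\<bar> \<le> \<epsilon>\<^sup>2 * r ^ Suc n"
        using fermi_second_difference[OF \<epsilon>, of "\<epsilon> * real (Suc n)"]
        unfolding v_def u_def rn by (simp add: algebra_simps)
      hence "\<bar>h2 (Suc n)\<bar> * \<bar>v (Suc n) - v (Suc (Suc n))\<bar> \<le> B * (\<epsilon>\<^sup>2 * r ^ Suc n)"
        using B by (intro mult_mono) auto
      thus ?thesis by (simp add: abs_mult mult.assoc)
    qed
    have "(\<lambda>n. r ^ Suc n) sums (r * (1 / (1 - r)))"
      using sums_mult[OF geometric_sums[of r], of r] r by simp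
    hence gs: "(\<lambda>n. B * \<epsilon>\<^sup>2 * r ^ Suc n) sums (B * \<epsilon>\<^sup>2 * (r * (1 / (1 - r))))" by (rule sums_mult)
    define S2 where "S2 = (\<Sum>n. h2 (Suc n) * (v (Suc n) - v (Suc (Suc n))))"
    have nsm: "summable (\<lambda>n. norm (h2 (Suc n) * (v (Suc n) - v (Suc (Suc n)))))"
      by (rule summable_comparison_test'[OF sums_summable[OF gs], of 0]) (use tb in simp)
    have S2: "(\<lambda>n. h2 (Suc n) * (v (Suc n) - v (Suc (Suc n)))) sums S2"
      unfolding S2_def by (rule summable_sums[OF summable_norm_cancel[OF nsm]])
    have "\<bar>S2\<bar> \<le> (\<Sum>n. norm (h2 (Suc n) * (v (Suc n) - v (Suc (Suc n)))))"
      using summable_norm[OF nsm] by (simp add: S2_def)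
    also have "\<dots> \<le> (\<Sum>n. B * \<epsilon>\<^sup>2 * r ^ Suc n)"
      by (rule suminf_le[OF tb nsm sums_summable[OF gs]])
    also have "\<dots> = B * \<epsilon>\<^sup>2 * (r * (1 / (1 - r)))" using gs by (simp add: sums_iff)
    also have "\<dots> \<le> B * \<epsilon>\<^sup>2 * (1 / \<epsilon>)"
    proof (intro mult_left_mono)
      have "r * (1 + \<epsilon>) \<le> 1"
        using exp_ge_add_one_self[of \<epsilon>] by (simp add: r_def exp_minus field_simps)
      thus "r * (1 / (1 - r)) \<le> 1 / \<epsilon>" using r \<epsilon> by (simp add: field_simps)
    qed (use B in auto)
    finally have S2b: "\<bar>S2\<bar> \<le> B * \<epsilon>" using \<epsilon> by (simp add: power2_eq_square)
    have "(\<lambda>n. h (Suc n) * v (Suc n)) sums (S2 - h2 0 * v 1)"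
      using summation_by_parts[OF h v0, of S2] S2 by (simp add: h2_def)
    hence "(\<lambda>n. f (Suc n) * u (Suc n)) sums (S2 - h2 0 * v 1 - h 0 * u 1)"
      using summation_by_parts[OF f u0, of "S2 - h2 0 * v 1"] by (simp add: h_def v_def)
    moreover have "\<bar>S2 - h2 0 * v 1 - h 0 * u 1 + h 0 / 2\<bar> \<le> (2 * B + \<bar>h 0\<bar>) * \<epsilon>"
    proof -
      have "\<bar>v 1\<bar> \<le> \<epsilon>" using fermi_lipschitz[of \<epsilon> "2 * \<epsilon>"] \<epsilon>
        by (simp add: v_def u_def abs_minus_commute mult.commute)
      hence 1: "\<bar>h2 0\<bar> * \<bar>v 1\<bar> \<le> B * \<epsilon>" using B by (intro mult_mono) auto
      have "\<bar>u 1 - 1 / 2\<bar> \<le> \<epsilon>" using fermi_lipschitz[of 0 \<epsilon>] \<epsilon> by (simp add: u_def fermi_def)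
      hence "\<bar>h 0\<bar> * \<bar>u 1 - 1 / 2\<bar> \<le> \<bar>h 0\<bar> * \<epsilon>" by (intro mult_left_mono) auto
      hence 2: "\<bar>h 0 * u 1 - h 0 / 2\<bar> \<le> \<bar>h 0\<bar> * \<epsilon>" by (simp add: abs_mult[symmetric] algebra_simps)
      have "\<bar>S2 - h2 0 * v 1 - h 0 * u 1 + h 0 / 2\<bar> \<le> \<bar>S2\<bar> + \<bar>h2 0 * v 1\<bar> + \<bar>h 0 * u 1 - h 0 / 2\<bar>"
        by linarith
      also have "\<dots> \<le> B * \<epsilon> + B * \<epsilon> + \<bar>h 0\<bar> * \<epsilon>"
        using S2b 1 2 by (intro add_mono) (auto simp: abs_mult)
      finally show ?thesis by (simp add: algebra_simps)
    qed
    ultimately show ?thesis unfolding u_def h_def by blast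
  qed
  thus thesis using that by blast
qed

text \<open>The double series of f(d) z^(d k) converges absolutely. Summing over k first gives the
  Lambert form; grouping by N = d k gives the divisor sums.\<close>

lemma lambert_series:
  fixes f :: "nat \<Rightarrow> real" and z :: real
  assumes "0 < z" "z < 1" "\<And>n. \<bar>f n\<bar> \<le> B"
  obtains S where "((\<lambda>N. (\<Sum>d | d dvd N. f d) * z ^ N) has_sum S) {1..}"
    "((\<lambda>d. f d * (z ^ d / (1 - z ^ d))) has_sum S) {1..}"
proof -
  define g where "g = (\<lambda>(d, k). f d * z ^ (d * k))"
  have zd: "z ^ d < 1" if "d \<ge> 1" for d using assms that by (simp add: power_less_one_iff)
  have in1: "((\<lambda>k. c * z ^ (d * k)) has_sum (c * (z ^ d / (1 - z ^ d)))) {1..}" if "d \<in> {1..}" for c d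
    using has_sum_cmult_right[OF has_sum_geometric_from_1[of "z ^ d"], of c] zd[of d] assms(1) that
    by (simp add: power_mult)
  have B: "B \<ge> 0" using assms(3)[of 0] by simp
  have "(\<lambda>v. case v of (d, k) \<Rightarrow> B * z ^ (d * k)) summable_on Sigma {1..} (\<lambda>_. {1..})"
  proof (rule summable_on_SigmaI)
    show "((\<lambda>k. case (d, k) of (d, k) \<Rightarrow> B * z ^ (d * k)) has_sum B * (z ^ d / (1 - z ^ d))) {1..}"
      if "d \<in> {1..}" for d using in1[OF that, of B] by simp
    show "(\<lambda>d. B * (z ^ d / (1 - z ^ d))) summable_on {1..}"
    proof (rule summable_on_comparison_test)
      have "(\<lambda>d. z ^ d) summable_on {1..}"
        using has_sum_geometric_from_1[of z] assms by (auto simp: summable_on_def)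
      thus "(\<lambda>d. B / (1 - z) * z ^ d) summable_on {1..}" by (rule summable_on_cmult_right)
      show "B * (z ^ d / (1 - z ^ d)) \<le> B / (1 - z) * z ^ d" if "d \<in> {1..}" for d
      proof -
        have "z ^ d \<le> z ^ 1" using assms that by (intro power_decreasing) auto
        hence "z ^ d / (1 - z ^ d) \<le> z ^ d / (1 - z)" using assms zd[of d] that by (intro divide_left_mono) auto
        from mult_left_mono[OF this B] show ?thesis by simp
      qed
      show "0 \<le> B * (z ^ d / (1 - z ^ d))" if "d \<in> {1..}" for d using B zd[of d] that assms by simp
    qed
  qed (use B assms in auto)
  hence "(\<lambda>v. norm (g v)) summable_on Sigma {1..} (\<lambda>_. {1..})"
    by (rule Infinite_Sum.abs_summable_on_comparison_test')
       (use assms in \<open>auto simp: g_def abs_mult intro!: mult_right_mono\<close>)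
  hence "g summable_on Sigma {1..} (\<lambda>_. {1..})" by (rule abs_summable_summable)
  then obtain S where S: "(g has_sum S) (Sigma {1..} (\<lambda>_. {1..}))" by (auto simp: summable_on_def)
  have "((\<lambda>d. f d * (z ^ d / (1 - z ^ d))) has_sum S) {1..}"
    by (rule has_sum_SigmaD[OF S]) (use in1 in \<open>auto simp: g_def\<close>)
  moreover have "(g has_sum S) (Sigma {1..} (\<lambda>_. {1..})) \<longleftrightarrow>
      ((\<lambda>(N, d). f d * z ^ N) has_sum S) (Sigma {1..} (\<lambda>N. {d. d dvd N}))"
    by (rule has_sum_reindex_bij_witness[where i = "\<lambda>(N, d). (d, N div d)" and j = "\<lambda>(d, k). (d * k, d)"])
       (auto simp: g_def Suc_le_eq dvd_div_eq_0_iff dvd_pos_nat intro: Nat.gr0I)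
  with S have S': "((\<lambda>(N, d). f d * z ^ N) has_sum S) (Sigma {1..} (\<lambda>N. {d. d dvd N}))" by simp
  have "((\<lambda>N. (\<Sum>d | d dvd N. f d) * z ^ N) has_sum S) {1..}"
  proof (rule has_sum_SigmaD[OF S'])
    fix N :: nat assume "N \<in> {1..}"
    thus "((\<lambda>d. case (N, d) of (N, d) \<Rightarrow> f d * z ^ N) has_sum (\<Sum>d | d dvd N. f d) * z ^ N) {d. d dvd N}"
      by (intro has_sum_finiteI) (auto simp: sum_distrib_right)
  qed
  ultimately show thesis using that by blast
qed

text \<open>The poles of the two Lambert terms at \<open>w = 1\<close> cancel.\<close>

lemma lambert_fermi:
  fixes w :: real
  assumes "w = exp (- x)" "x > 0"
  shows "w / (1 - w) - 4 * (w ^ 4 / (1 - w ^ 4)) = fermi x + 2 * fermi (2 * x)"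
proof -
  have w: "0 < w" "w < 1" using assms by simp_all
  have "w * exp x = 1" by (simp add: assms exp_minus)
  hence ex: "exp x = 1 / w" using w by (simp add: field_simps)
  hence ex2: "exp (2 * x) = 1 / w\<^sup>2" by (simp add: exp_double power_divide)
  have "1 / (1 + 1 / y) = y / (1 + y)" if "y > 0" for y :: real
    using that by (simp add: field_simps)
  hence F: "fermi x = w / (1 + w)" "fermi (2 * x) = w\<^sup>2 / (1 + w\<^sup>2)"
    unfolding fermi_def ex ex2 using w by simp_all
  have "1 + w > 0" "1 + w\<^sup>2 > 0" using w by (auto intro: add_pos_nonneg)
  hence nz: "1 + w \<noteq> 0" "1 + w\<^sup>2 \<noteq> 0" "1 - w \<noteq> 0" using w by linarith+
  have f: "1 - w ^ 4 = (1 - w) * ((1 + w) * (1 + w\<^sup>2))"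
    by (simp add: algebra_simps power2_eq_square power4_eq_xxxx)
  have "w / (1 - w) = w * ((1 + w) * (1 + w\<^sup>2)) / ((1 - w) * ((1 + w) * (1 + w\<^sup>2)))"
    "w / (1 + w) = w * (1 - w) * (1 + w\<^sup>2) / ((1 - w) * ((1 + w) * (1 + w\<^sup>2)))"
    "w\<^sup>2 / (1 + w\<^sup>2) = w\<^sup>2 * (1 - w) * (1 + w) / ((1 - w) * ((1 + w) * (1 + w\<^sup>2)))"
    using nz by (simp_all add: divide_eq_eq)
  moreover have "w * ((1 + w) * (1 + w\<^sup>2)) - 4 * w ^ 4 =
      w * (1 - w) * (1 + w\<^sup>2) + 2 * (w\<^sup>2 * (1 - w) * (1 + w))"
    by (simp add: algebra_simps power2_eq_square power4_eq_xxxx)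
  ultimately show ?thesis unfolding F f
    by (simp only: times_divide_eq_right diff_divide_distrib[symmetric] add_divide_distrib[symmetric])
qed

text \<open>Subtracting four times the Lambert series at z^4 from the one at z = exp(-\<epsilon>)
  leaves the terms f(d) (fermi(\<epsilon> d) + 2 fermi(2 \<epsilon> d)). By
  \<open>fermi_sum_bound\<close> the limit is (1 + 2) times -1/2 times
  \<open>antidiff M f 0\<close>.\<close>

lemma divisor_sum_asymptotics:
  assumes f: "zero_mean_periodic M f"
  obtains C where "\<And>\<epsilon>. 0 < \<epsilon> \<Longrightarrow> \<exists>S.
    ((\<lambda>N. (\<Sum>d | d dvd N. f d) * (exp (- \<epsilon> * real N) - 4 * exp (- 4 * \<epsilon> * real N))) has_sum S) {1..} \<and>
    \<bar>S + 3 / 2 * antidiff M f 0\<bar> \<le> C * \<epsilon>"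
proof -
  obtain B where B: "\<And>n. \<bar>f n\<bar> \<le> B" using zero_mean_periodic_bounded[OF f] by metis
  obtain C where C: "\<And>\<epsilon>. 0 < \<epsilon> \<Longrightarrow> \<exists>S. (\<lambda>n. f (Suc n) * fermi (\<epsilon> * real (Suc n))) sums S \<and>
    \<bar>S + antidiff M f 0 / 2\<bar> \<le> C * \<epsilon>" using fermi_sum_bound[OF f] by metis
  have "\<exists>S. ((\<lambda>N. (\<Sum>d | d dvd N. f d) * (exp (- \<epsilon> * real N) - 4 * exp (- 4 * \<epsilon> * real N))) has_sum S) {1..} \<and>
    \<bar>S + 3 / 2 * antidiff M f 0\<bar> \<le> 5 * C * \<epsilon>" if \<epsilon>: "\<epsilon> > 0" for \<epsilon>
  proof -
    define z where "z = exp (- \<epsilon>)"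
    have z: "0 < z" "z < 1" "0 < z ^ 4" "z ^ 4 < 1"
      using \<epsilon> by (simp_all add: z_def power_less_one_iff)
    have zN: "exp (- \<epsilon> * real N) = z ^ N" "exp (- 4 * \<epsilon> * real N) = (z ^ 4) ^ N" for N
      by (simp_all add: z_def exp_of_nat_mult[symmetric] power_mult[symmetric] mult_ac)
    obtain S1 where S1: "((\<lambda>N. (\<Sum>d | d dvd N. f d) * z ^ N) has_sum S1) {1..}"
      "((\<lambda>d. f d * (z ^ d / (1 - z ^ d))) has_sum S1) {1..}"
      by (rule lambert_series[OF z(1,2) B])
    obtain S4 where S4: "((\<lambda>N. (\<Sum>d | d dvd N. f d) * (z ^ 4) ^ N) has_sum S4) {1..}"
      "((\<lambda>d. f d * ((z ^ 4) ^ d / (1 - (z ^ 4) ^ d))) has_sum S4) {1..}"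
      by (rule lambert_series[OF z(3,4) B])
    have "((\<lambda>N. (\<Sum>d | d dvd N. f d) * z ^ N - 4 * ((\<Sum>d | d dvd N. f d) * (z ^ 4) ^ N)) has_sum (S1 - 4 * S4)) {1..}"
      by (intro has_sum_diff has_sum_cmult_right S1 S4)
    hence 1: "((\<lambda>N. (\<Sum>d | d dvd N. f d) * (exp (- \<epsilon> * real N) - 4 * exp (- 4 * \<epsilon> * real N))) has_sum (S1 - 4 * S4)) {1..}"
      unfolding zN by (simp add: algebra_simps)
    have "((\<lambda>d. f d * (z ^ d / (1 - z ^ d)) - 4 * (f d * ((z ^ 4) ^ d / (1 - (z ^ 4) ^ d)))) has_sum (S1 - 4 * S4)) {1..}"
      by (intro has_sum_diff has_sum_cmult_right S1 S4)
    also have "?this \<longleftrightarrow> ((\<lambda>d. f d * (fermi (\<epsilon> * real d) + 2 * fermi (2 * \<epsilon> * real d))) has_sum (S1 - 4 * S4)) {1..}"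
    proof (rule has_sum_cong)
      fix d :: nat assume "d \<in> {1..}"
      hence "z ^ d / (1 - z ^ d) - 4 * ((z ^ d) ^ 4 / (1 - (z ^ d) ^ 4)) =
          fermi (\<epsilon> * real d) + 2 * fermi (2 * (\<epsilon> * real d))"
        using \<epsilon> zN(1)[of d] by (intro lambert_fermi) auto
      hence e: "fermi (\<epsilon> * real d) + 2 * fermi (2 * \<epsilon> * real d) =
          z ^ d / (1 - z ^ d) - 4 * ((z ^ 4) ^ d / (1 - (z ^ 4) ^ d))"
        by (simp add: power_mult[symmetric] mult_ac)
      show "f d * (z ^ d / (1 - z ^ d)) - 4 * (f d * ((z ^ 4) ^ d / (1 - (z ^ 4) ^ d))) =
        f d * (fermi (\<epsilon> * real d) + 2 * fermi (2 * \<epsilon> * real d))"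
        unfolding e by (simp add: algebra_simps)
    qed
    also have "\<dots> \<longleftrightarrow> ((\<lambda>n. f (Suc n) * (fermi (\<epsilon> * real (Suc n)) + 2 * fermi (2 * \<epsilon> * real (Suc n)))) has_sum (S1 - 4 * S4)) UNIV"
      by (rule has_sum_reindex_bij_witness[where i = Suc and j = "\<lambda>d. d - 1"]) auto
    finally have sums1: "(\<lambda>n. f (Suc n) * (fermi (\<epsilon> * real (Suc n)) + 2 * fermi (2 * \<epsilon> * real (Suc n)))) sums (S1 - 4 * S4)"
      by (rule has_sum_imp_sums)
    obtain U where U: "(\<lambda>n. f (Suc n) * fermi (\<epsilon> * real (Suc n))) sums U" "\<bar>U + antidiff M f 0 / 2\<bar> \<le> C * \<epsilon>"
      using C[OF \<epsilon>] by blast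
    obtain V where V: "(\<lambda>n. f (Suc n) * fermi (2 * \<epsilon> * real (Suc n))) sums V" "\<bar>V + antidiff M f 0 / 2\<bar> \<le> C * (2 * \<epsilon>)"
      using C[of "2 * \<epsilon>"] \<epsilon> by auto
    have "(\<lambda>n. f (Suc n) * fermi (\<epsilon> * real (Suc n)) + 2 * (f (Suc n) * fermi (2 * \<epsilon> * real (Suc n)))) sums (U + 2 * V)"
      by (intro sums_add sums_mult U V)
    hence "(\<lambda>n. f (Suc n) * (fermi (\<epsilon> * real (Suc n)) + 2 * fermi (2 * \<epsilon> * real (Suc n)))) sums (U + 2 * V)"
      by (simp add: algebra_simps)
    with sums1 have eq: "S1 - 4 * S4 = U + 2 * V" by (rule sums_unique2)
    have "(S1 - 4 * S4) + 3 / 2 * antidiff M f 0 = (U + antidiff M f 0 / 2) + 2 * (V + antidiff M f 0 / 2)"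
      unfolding eq by (simp add: field_simps)
    hence "\<bar>(S1 - 4 * S4) + 3 / 2 * antidiff M f 0\<bar> \<le> \<bar>U + antidiff M f 0 / 2\<bar> + 2 * \<bar>V + antidiff M f 0 / 2\<bar>"
      using abs_triangle_ineq[of "U + antidiff M f 0 / 2" "2 * (V + antidiff M f 0 / 2)"]
      by (simp only: abs_mult abs_numeral)
    also have "\<dots> \<le> 5 * C * \<epsilon>" using U V by simp
    finally show ?thesis using 1 by blast
  qed
  thus thesis using that by blast
qed

section \<open>Divisor sums\<close>

definition divisor_sum :: "(nat \<Rightarrow> real) \<Rightarrow> nat \<Rightarrow> real" where
  "divisor_sum f N = (\<Sum>d | d dvd N. f d)"

lemma divisors_prime_mult:
  fixes q N :: nat
  assumes "prime q"
  shows "{d. d dvd q * N} = {d. d dvd N} \<union> (\<lambda>d. q * d) ` {d. d dvd N}"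
proof (intro equalityI subsetI)
  fix d assume d: "d \<in> {d. d dvd q * N}"
  show "d \<in> {d. d dvd N} \<union> (\<lambda>d. q * d) ` {d. d dvd N}"
  proof (cases "q dvd d")
    case True
    then obtain e where "d = q * e" by blast
    thus ?thesis using d prime_gt_0_nat[OF assms] by auto
  next
    case False
    hence "coprime d q" using assms prime_imp_coprime coprime_commute by blast
    thus ?thesis using d coprime_dvd_mult_right_iff by blast
  qed
qed auto

text \<open>Inclusion and exclusion: a divisor of q N divides N or is q times a divisor of N, and
  both hold for q times the divisors of N div q. The recursion is the one that
  \<open>rep_mass_step\<close> gives for representation numbers.\<close>

lemma divisor_sum_prime_mult:
  assumes q: "prime q" and N: "N > 0" and f: "\<And>d. d > 0 \<Longrightarrow> f (q * d) = f q * f d"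
  shows "divisor_sum f (q * N) = (1 + f q) * divisor_sum f N -
    f q * (if q dvd N then divisor_sum f (N div q) else 0)"
proof -
  have q0: "q > 0" using prime_gt_0_nat[OF q] .
  have inj: "inj_on (\<lambda>d. q * d) X" for X using q0 by (auto simp: inj_on_def)
  have fin: "finite {d. d dvd k}" if "k > 0" for k :: nat using that by simp
  have im: "sum f ((\<lambda>d. q * d) ` {d. d dvd k}) = f q * divisor_sum f k" if "k > 0" for k
  proof -
    have "sum f ((\<lambda>d. q * d) ` {d. d dvd k}) = (\<Sum>d | d dvd k. f (q * d))"
      by (simp add: sum.reindex[OF inj])
    also have "\<dots> = (\<Sum>d | d dvd k. f q * f d)"
      using that by (intro sum.cong refl f) (auto intro: dvd_pos_nat)
    finally show ?thesis by (simp add: divisor_sum_def sum_distrib_left)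
  qed
  have int: "{d. d dvd N} \<inter> (\<lambda>d. q * d) ` {d. d dvd N} =
      (if q dvd N then (\<lambda>d. q * d) ` {d. d dvd N div q} else {})"
  proof (cases "q dvd N")
    case True
    then obtain k where k: "N = q * k" by blast
    thus ?thesis using True q0 by auto
  next
    case False
    thus ?thesis by (auto dest: dvd_mult_left)
  qed
  have "divisor_sum f (q * N) = sum f {d. d dvd N} + sum f ((\<lambda>d. q * d) ` {d. d dvd N}) -
      sum f ({d. d dvd N} \<inter> (\<lambda>d. q * d) ` {d. d dvd N})"
    unfolding divisor_sum_def divisors_prime_mult[OF q] using fin[OF N] by (intro sum_Un) auto
  also have "sum f ({d. d dvd N} \<inter> (\<lambda>d. q * d) ` {d. d dvd N}) =
      f q * (if q dvd N then divisor_sum f (N div q) else 0)"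
    unfolding int using N im[of "N div q"] by (auto simp: dvd_div_eq_0_iff intro: Nat.gr0I)
  finally show ?thesis unfolding im[OF N] by (simp add: divisor_sum_def algebra_simps)
qed

section \<open>The Moebius-weighted divisor sum of a conductor\<close>

lemma moebius_prime_mult:
  assumes "prime q" "a > 0"
  shows "moebius (q * a) = (if q dvd a then 0 else - moebius a)"
proof (cases "q dvd a")
  case True
  then obtain k where "a = q * k" by blast
  hence "q\<^sup>2 dvd q * a" by (simp add: power2_eq_square)
  hence "\<not> squarefree (q * a)" using assms(1) unfolding squarefree_def
    by (metis not_prime_unit)
  thus ?thesis using True by (simp add: moebius_def)
next
  case False
  hence cop: "coprime q a" using assms(1) prime_imp_coprime by blast
  have "squarefree (q * a) \<longleftrightarrow> squarefree a"
    using squarefree_mult_coprime[OF cop squarefree_prime[OF assms(1)]] squarefree_multD(2) by blast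
  moreover have "prime_factors (q * a) = insert q (prime_factors a)"
    using assms by (simp add: prime_factors_product prime_factorization_prime prime_gt_0_nat)
  moreover have "q \<notin> prime_factors a" using False by auto
  ultimately show ?thesis using False by (simp add: moebius_def)
qed

definition sigma :: "nat \<Rightarrow> real" where
  "sigma = divisor_sum real"

text \<open>For f = \<chi>_t this is the ratio of M(t m^2) to M(t) (\<open>mass_conductor\<close>),
  and also the part of the sums in both Hurwitz numbers that is prime to p
  (\<open>hurwitz_sums\<close>).\<close>

definition conductor_sum :: "(nat \<Rightarrow> real) \<Rightarrow> nat \<Rightarrow> real" where
  "conductor_sum f m = (\<Sum>a | a dvd m. of_int (moebius a) * f a * sigma (m div a))"

lemma conductor_sum_1: "f 1 = 1 \<Longrightarrow> conductor_sum f 1 = 1"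
  by (simp add: conductor_sum_def sigma_def divisor_sum_def moebius_def)

lemma sigma_prime_mult:
  assumes "prime q" "k > 0"
  shows "sigma (q * k) = (1 + real q) * sigma k - real q * (if q dvd k then sigma (k div q) else 0)"
  unfolding sigma_def using assms by (intro divisor_sum_prime_mult) auto

text \<open>The divisors of q m are those of m and their multiples by q. For the former
  \<open>sigma\<close> gains the factor 1 + q; for the latter the Moebius function changes sign and
  f gains f(q).\<close>

lemma conductor_sum_coprime:
  assumes q: "prime q" and m: "m > 0" and qm: "\<not> q dvd m" and f: "\<And>d. d > 0 \<Longrightarrow> f (q * d) = f q * f d"
  shows "conductor_sum f (q * m) = (1 + real q - f q) * conductor_sum f m"
proof -
  have q0: "q > 0" using prime_gt_0_nat[OF q] .
  let ?g = "\<lambda>a. of_int (moebius a) * f a * sigma (q * m div a)"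
  have inj: "inj_on (\<lambda>d. q * d) X" for X using q0 by (auto simp: inj_on_def)
  have "conductor_sum f (q * m) = sum ?g {a. a dvd m} + sum ?g ((\<lambda>d. q * d) ` {a. a dvd m})"
    unfolding conductor_sum_def divisors_prime_mult[OF q]
    using m qm by (intro sum.union_disjoint) (auto dest: dvd_mult_left)
  also have "sum ?g {a. a dvd m} = (1 + real q) * conductor_sum f m"
    unfolding conductor_sum_def sum_distrib_left
  proof (rule sum.cong)
    fix a assume "a \<in> {a. a dvd m}"
    then obtain k where k: "m = a * k" by auto
    have "a > 0" "k > 0" "\<not> q dvd k" using m qm k by auto
    moreover from this have "q * m div a = q * k" "m div a = k" by (simp_all add: k)
    ultimately show "?g a = (1 + real q) * (of_int (moebius a) * f a * sigma (m div a))"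
      using sigma_prime_mult[OF q, of k] by simp
  qed simp
  also have "sum ?g ((\<lambda>d. q * d) ` {a. a dvd m}) = - f q * conductor_sum f m"
    unfolding conductor_sum_def sum_distrib_left sum.reindex[OF inj] o_def
  proof (rule sum.cong)
    fix a assume a: "a \<in> {a. a dvd m}"
    hence "a > 0" using m by (auto intro: dvd_pos_nat)
    moreover have "\<not> q dvd a" using a qm by (auto dest: dvd_trans)
    moreover have "q * m div (q * a) = m div a" using q0 by simp
    ultimately show "of_int (moebius (q * a)) * f (q * a) * sigma (q * m div (q * a)) =
        - f q * (of_int (moebius a) * f a * sigma (m div a))"
      by (simp add: moebius_prime_mult[OF q] f)
  qed simp
  finally show ?thesis by (simp add: algebra_simps)
qed

text \<open>A divisor of q m that does not divide m is a multiple of q^2, so the Moebius factor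
  removes it. On the remaining divisors the two-step recursion of \<open>sigma\<close> is
  inherited.\<close>

lemma conductor_sum_dvd:
  assumes q: "prime q" and m: "m > 0" and qm: "q dvd m"
  shows "conductor_sum f (q * m) = (1 + real q) * conductor_sum f m - real q * conductor_sum f (m div q)"
proof -
  have q0: "q > 0" using prime_gt_0_nat[OF q] .
  let ?w = "\<lambda>a. of_int (moebius a) * f a"
  obtain l where l: "m = q * l" using qm by blast
  have l0: "l > 0" using m l by auto
  have "conductor_sum f (q * m) = (\<Sum>a | a dvd m. ?w a * sigma (q * m div a))"
    unfolding conductor_sum_def
  proof (rule sum.mono_neutral_right)
    show "\<forall>a\<in>{a. a dvd q * m} - {a. a dvd m}. ?w a * sigma (q * m div a) = 0"
    proof
      fix a assume a: "a \<in> {a. a dvd q * m} - {a. a dvd m}"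
      then obtain e where e: "a = q * e" "e dvd m" using divisors_prime_mult[OF q, of m] by auto
      have "q dvd e"
      proof (rule ccontr)
        assume "\<not> q dvd e"
        hence "coprime q e" using q prime_imp_coprime by blast
        hence "a dvd m" using e qm divides_mult by blast
        thus False using a by simp
      qed
      moreover have "e > 0" using e m by (auto intro: dvd_pos_nat)
      ultimately have "moebius a = 0" using moebius_prime_mult[OF q, of e] e by simp
      thus "?w a * sigma (q * m div a) = 0" by simp
    qed
  qed (use m q0 in auto)
  also have "\<dots> = (\<Sum>a | a dvd m. (1 + real q) * (?w a * sigma (m div a)) -
      real q * (if a dvd l then ?w a * sigma (l div a) else 0))"
  proof (rule sum.cong)
    fix a assume "a \<in> {a. a dvd m}"
    then obtain k where k: "m = a * k" by auto
    have a0: "a > 0" and k0: "k > 0" using m k by auto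
    have e: "q * m div a = q * k" "m div a = k" using a0 by (simp_all add: k)
    have c: "q dvd k \<longleftrightarrow> a dvd l"
    proof
      assume "q dvd k"
      then obtain j where "k = q * j" by blast
      hence "q * l = q * (a * j)" using k l by (metis mult.left_commute)
      hence "l = a * j" using q0 by simp
      thus "a dvd l" by simp
    next
      assume "a dvd l"
      then obtain j where "l = a * j" by blast
      hence "a * k = a * (q * j)" using k l by (metis mult.left_commute)
      hence "k = q * j" using a0 by simp
      thus "q dvd k" by simp
    qed
    have d: "l div a = k div q" if al: "a dvd l"
    proof -
      obtain j where j: "l = a * j" using al by blast
      hence "a * k = a * (q * j)" using k l by (metis mult.left_commute)
      hence "k = q * j" using a0 by simp
      thus ?thesis using j a0 q0 by simp
    qed
    show "?w a * sigma (q * m div a) = (1 + real q) * (?w a * sigma (m div a)) -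
      real q * (if a dvd l then ?w a * sigma (l div a) else 0)"
      unfolding e sigma_prime_mult[OF q k0] c using d by (simp add: algebra_simps)
  qed simp
  also have "\<dots> = (1 + real q) * conductor_sum f m - real q * (\<Sum>a | a dvd m. if a dvd l then ?w a * sigma (l div a) else 0)"
    by (simp add: sum_subtractf conductor_sum_def sum_distrib_left)
  also have "(\<Sum>a | a dvd m. if a dvd l then ?w a * sigma (l div a) else 0) = conductor_sum f l"
    unfolding conductor_sum_def using m l
    by (intro sum.mono_neutral_cong_right) auto
  finally show ?thesis using l q0 by simp
qed

section \<open>Weighted sums over classes of forms\<close>

text \<open>For Q = R this is the full stabilizer, in which A and -A count separately.\<close>

definition transporter :: "nat \<Rightarrow> bqf \<Rightarrow> bqf \<Rightarrow> (int ^ 2 ^ 2) set" where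
  "transporter l Q R = {A \<in> Gamma0 l. bqf_act Q A = R}"

lemma finite_stabilizer:
  assumes "bqf_disc Q < 0"
  shows "finite (transporter l Q Q)"
proof -
  let ?r = "{(A, B). B = A \<or> B = - A} :: ((int ^ 2 ^ 2) \<times> (int ^ 2 ^ 2)) set"
  have "finite (transporter l Q Q // ?r)"
    using finite_Gamma0_stab[OF assms, of l] by (simp add: Gamma0_stab_def transporter_def)
  moreover have "finite C" if C: "C \<in> transporter l Q Q // ?r" for C
  proof -
    obtain A where "C = ?r `` {A}" using C by (meson quotientE)
    hence "C = {A, - A}" by auto
    thus ?thesis by simp
  qed
  ultimately have "finite (\<Union> (transporter l Q Q // ?r))" by blast
  moreover have "transporter l Q Q \<subseteq> \<Union> (transporter l Q Q // ?r)"
    by (auto simp: quotient_def)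
  ultimately show ?thesis by (rule finite_subset[rotated])
qed

lemma bqf_act_adj2:
  assumes "det A = 1"
  shows "bqf_act (bqf_act Q A) (adj2 A) = Q" "bqf_act (bqf_act Q (adj2 A)) A = Q"
  using adj2_inverse[OF assms] by (simp_all add: bqf_act_mult[symmetric])

lemma Gamma0_det: "A \<in> Gamma0 l \<Longrightarrow> det A = 1"
  by (simp add: Gamma0_def)

text \<open>Composition with an invertible matrix. A nonempty transporter is thus a torsor and as
  large as the stabilizer.\<close>

lemma bij_betw_transporter:
  assumes "A \<in> transporter l R Q"
  shows "bij_betw (\<lambda>B. A ** B) (transporter l Q S) (transporter l R S)"
proof (rule bij_betw_byWitness[where f' = "\<lambda>B. adj2 A ** B"])
  have A: "A \<in> Gamma0 l" "bqf_act R A = Q" "det A = 1"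
    using assms Gamma0_det by (auto simp: transporter_def)
  show "\<forall>B\<in>transporter l Q S. adj2 A ** (A ** B) = B" "\<forall>B\<in>transporter l R S. A ** (adj2 A ** B) = B"
    using adj2_inverse[OF A(3)] by (simp_all add: matrix_mul_assoc)
  show "(\<lambda>B. A ** B) ` transporter l Q S \<subseteq> transporter l R S"
    using A by (auto simp: transporter_def bqf_act_mult intro: Gamma0_mult)
  have "bqf_act Q (adj2 A) = R" using bqf_act_adj2(1)[OF A(3), of R] A(2) by simp
  thus "(\<lambda>B. adj2 A ** B) ` transporter l R S \<subseteq> transporter l Q S"
    using A by (auto simp: transporter_def bqf_act_mult intro: Gamma0_mult Gamma0_adj2)
qed

lemma adj2_adj2 [simp]: "adj2 (adj2 A) = A"
  by (simp add: vec_eq_iff forall_2)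

lemma transporter_adj2: "A \<in> transporter l Q R \<Longrightarrow> adj2 A \<in> transporter l R Q"
  using bqf_act_adj2[of A Q] Gamma0_det[of A l] by (auto simp: transporter_def intro: Gamma0_adj2)

lemma card_transporter_commute: "card (transporter l Q R) = card (transporter l R Q)"
  by (intro bij_betw_same_card[of adj2] bij_betw_byWitness[where f' = adj2])
     (auto intro: transporter_adj2)

lemma finite_transporter:
  assumes "bqf_disc Q < 0"
  shows "finite (transporter l Q R)"
proof (cases "transporter l Q R = {}")
  case False
  then obtain A where A: "A \<in> transporter l Q R" by blast
  hence "bqf_disc R < 0" using assms bqf_disc_act[of Q A] by (auto simp: transporter_def Gamma0_def)
  thus ?thesis using bij_betw_finite[OF bij_betw_transporter[OF A, of R]] finite_stabilizer by blast
qed simp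

section \<open>Sums over classes weighted by stabilizers\<close>

definition class_rep :: "bqf set \<Rightarrow> bqf" where
  "class_rep C = (SOME Q. Q \<in> C)"

definition class_sum :: "nat \<Rightarrow> int \<Rightarrow> (bqf \<Rightarrow> real) \<Rightarrow> real" where
  "class_sum l n f =
     (\<Sum>C\<in>bqf_classes l n. f (class_rep C) / real (card (transporter l (class_rep C) (class_rep C))))"

lemma class_rep_in:
  assumes "C \<in> bqf_classes l n"
  shows "class_rep C \<in> C"
proof -
  have "C \<noteq> {}" using assms in_quotient_imp_non_empty[OF equiv_bqf_equiv] by (auto simp: bqf_classes_def)
  thus ?thesis unfolding class_rep_def by (simp add: some_in_eq)
qed

lemma class_rep_level: "C \<in> bqf_classes l n \<Longrightarrow> class_rep C \<in> bqf_level l n"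
  using class_rep_in[of C l n] in_quotient_imp_subset[OF equiv_bqf_equiv] unfolding bqf_classes_def by blast

lemma bqf_level_disc: "Q \<in> bqf_level l n \<Longrightarrow> bqf_disc Q = n"
  by (auto simp: bqf_level_def)

lemma stabilizer_card_pos:
  assumes "Q \<in> bqf_level l n" "n < 0"
  shows "card (transporter l Q Q) > 0"
proof -
  have "mat 1 \<in> transporter l Q Q" by (simp add: transporter_def Gamma0_one)
  moreover have "finite (transporter l Q Q)" using assms bqf_level_disc by (intro finite_stabilizer) auto
  ultimately show ?thesis using card_gt_0_iff by blast
qed

lemma bqf_equiv_iff: "(Q, R) \<in> bqf_equiv l n \<longleftrightarrow> Q \<in> bqf_level l n \<and> transporter l Q R \<noteq> {}"
  by (simp add: bqf_equiv_def transporter_def) metis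

text \<open>Only the class of Q contributes, and there the transporter has the size of the
  stabilizer by which it is divided.\<close>

lemma transporter_class_sum:
  assumes "Q \<in> bqf_level l n" "n < 0" "l > 0"
  shows "class_sum l n (\<lambda>R. real (card (transporter l Q R))) = 1"
proof -
  define C0 where "C0 = bqf_equiv l n `` {Q}"
  have C0: "C0 \<in> bqf_classes l n" unfolding C0_def bqf_classes_def using assms(1) by (rule quotientI)
  have fin: "finite (bqf_classes l n)" using finite_bqf_classes assms by blast
  have zero: "transporter l Q (class_rep C) = {}" if C: "C \<in> bqf_classes l n" "C \<noteq> C0" for C
  proof (rule ccontr)
    assume "transporter l Q (class_rep C) \<noteq> {}"
    hence "(Q, class_rep C) \<in> bqf_equiv l n" using assms(1) by (simp add: bqf_equiv_iff)
    hence "class_rep C \<in> C0" by (simp add: C0_def)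
    hence "C = C0" using class_rep_in[OF C(1)] quotient_disj[OF equiv_bqf_equiv] C(1) C0
      unfolding bqf_classes_def by blast
    thus False using C by simp
  qed
  have one: "card (transporter l Q (class_rep C0)) = card (transporter l (class_rep C0) (class_rep C0))"
  proof -
    have "(Q, class_rep C0) \<in> bqf_equiv l n" using class_rep_in[OF C0] by (simp add: C0_def)
    then obtain A where "A \<in> transporter l Q (class_rep C0)" by (auto simp: bqf_equiv_iff)
    from bij_betw_same_card[OF bij_betw_transporter[OF this]] show ?thesis by simp
  qed
  have "class_sum l n (\<lambda>R. real (card (transporter l Q R))) =
    (\<Sum>C\<in>{C0}. real (card (transporter l Q (class_rep C))) / real (card (transporter l (class_rep C) (class_rep C))))"
    unfolding class_sum_def using fin C0 zero by (intro sum.mono_neutral_right) auto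
  also have "\<dots> = 1" using one stabilizer_card_pos[OF class_rep_level[OF C0] assms(2)] by simp
  finally show ?thesis .
qed

lemma class_sum_cong:
  "(\<And>Q. Q \<in> bqf_level l n \<Longrightarrow> f Q = g Q) \<Longrightarrow> class_sum l n f = class_sum l n g"
  unfolding class_sum_def by (intro sum.cong refl) (simp add: class_rep_level)

lemma class_sum_add: "class_sum l n (\<lambda>Q. f Q + g Q) = class_sum l n f + class_sum l n g"
  by (simp add: class_sum_def add_divide_distrib sum.distrib)

lemma class_sum_cmult: "class_sum l n (\<lambda>Q. c * f Q) = c * class_sum l n f"
  by (simp add: class_sum_def sum_distrib_left)

lemma class_sum_sum: "class_sum l n (\<lambda>Q. \<Sum>i\<in>I. f i Q) = (\<Sum>i\<in>I. class_sum l n (f i))"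
  unfolding class_sum_def by (subst sum.swap) (simp add: sum_divide_distrib)

lemma class_sum_swap:
  "class_sum l n (\<lambda>Q. class_sum k m (\<lambda>R. f Q R)) = class_sum k m (\<lambda>R. class_sum l n (\<lambda>Q. f Q R))"
  unfolding class_sum_def by (simp only: sum_divide_distrib, subst sum.swap) (simp add: mult.commute)

section \<open>Scaling of forms, and systems of coset representatives\<close>

definition bqf_scale :: "int \<Rightarrow> bqf \<Rightarrow> bqf" where
  "bqf_scale s Q = (case Q of (a, b, c) \<Rightarrow> (s * a, s * b, s * c))"

lemma bqf_scale_simp [simp]: "bqf_scale s (a, b, c) = (s * a, s * b, s * c)"
  by (simp add: bqf_scale_def)

lemma bqf_act_scale: "bqf_act (bqf_scale s Q) A = bqf_scale s (bqf_act Q A)"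
  by (cases Q) (simp add: algebra_simps)

lemma bqf_scale_inject: "s \<noteq> 0 \<Longrightarrow> bqf_scale s Q = bqf_scale s R \<longleftrightarrow> Q = R"
  by (cases Q; cases R) auto

lemma bqf_disc_scale: "bqf_disc (bqf_scale s Q) = s\<^sup>2 * bqf_disc Q"
  by (cases Q) (simp add: power2_eq_square algebra_simps)

lemma bqf_scale_scale: "bqf_scale s (bqf_scale r Q) = bqf_scale (s * r) Q"
  by (cases Q) simp

lemma bqf_act_adj2_scale: "bqf_act (bqf_act Q A) (adj2 A) = bqf_scale ((det A)\<^sup>2) Q"
  by (cases Q) (simp add: det_2 power2_eq_square algebra_simps)

definition coset_system :: "nat \<Rightarrow> (int ^ 2 ^ 2) set \<Rightarrow> (int ^ 2 ^ 2) set \<Rightarrow> bool" where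
  "coset_system l T X \<longleftrightarrow> finite T \<and> bij_betw (\<lambda>(\<tau>, h). \<tau> ** h) (T \<times> Gamma0 l) X"

text \<open>Both sides count pairs \<open>(\<tau>, h)\<close> with \<open>h\<close> carrying the reduced form \<open>Q\<tau>/s\<close> to a class
  representative; by \<open>transporter_class_sum\<close> each admissible \<open>\<tau>\<close> has total weight one.\<close>

lemma coset_sum:
  fixes F :: "int ^ 2 ^ 2 \<Rightarrow> real"
  assumes T: "coset_system l T X" and "l > 0" "n < 0" "s \<noteq> 0"
    and F: "\<And>\<tau> h. \<tau> \<in> T \<Longrightarrow> h \<in> Gamma0 l \<Longrightarrow> F (\<tau> ** h) = F \<tau>"
  shows "class_sum l n (\<lambda>R. \<Sum>M | M \<in> X \<and> bqf_act Q M = bqf_scale s R. F M) =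
    (\<Sum>\<tau> | \<tau> \<in> T \<and> (\<exists>R\<in>bqf_level l n. bqf_act Q \<tau> = bqf_scale s R). F \<tau>)"
proof -
  have fT: "finite T" and bij: "bij_betw (\<lambda>(\<tau>, h). \<tau> ** h) (T \<times> Gamma0 l) X"
    using T by (auto simp: coset_system_def)
  let ?valid = "\<lambda>\<tau>. \<exists>R\<in>bqf_level l n. bqf_act Q \<tau> = bqf_scale s R"
  define red where "red = (\<lambda>\<tau>. SOME R. R \<in> bqf_level l n \<and> bqf_act Q \<tau> = bqf_scale s R)"
  have red: "red \<tau> \<in> bqf_level l n" "bqf_act Q \<tau> = bqf_scale s (red \<tau>)" if "?valid \<tau>" for \<tau>
    using someI_ex[of "\<lambda>R. R \<in> bqf_level l n \<and> bqf_act Q \<tau> = bqf_scale s R"] that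
    unfolding red_def by blast+
  let ?V = "{\<tau> \<in> T. ?valid \<tau>}"
  have act: "bqf_act Q (\<tau> ** h) = bqf_scale s R \<longleftrightarrow> bqf_act (red \<tau>) h = R" if "?valid \<tau>" for \<tau> h R
    unfolding bqf_act_mult red(2)[OF that] bqf_act_scale using assms(4) by (simp add: bqf_scale_inject)
  have inner: "(\<Sum>M | M \<in> X \<and> bqf_act Q M = bqf_scale s R. F M) =
      (\<Sum>\<tau>\<in>?V. F \<tau> * real (card (transporter l (red \<tau>) R)))" if R: "R \<in> bqf_level l n" for R
  proof -
    have bij2: "bij_betw (\<lambda>(\<tau>, h). \<tau> ** h) (Sigma ?V (\<lambda>\<tau>. transporter l (red \<tau>) R))
        {M. M \<in> X \<and> bqf_act Q M = bqf_scale s R}"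
      unfolding bij_betw_def
    proof
      show "inj_on (\<lambda>(\<tau>, h). \<tau> ** h) (Sigma ?V (\<lambda>\<tau>. transporter l (red \<tau>) R))"
        by (rule inj_on_subset[OF bij_betw_imp_inj_on[OF bij]]) (auto simp: transporter_def)
      show "(\<lambda>(\<tau>, h). \<tau> ** h) ` Sigma ?V (\<lambda>\<tau>. transporter l (red \<tau>) R) =
          {M. M \<in> X \<and> bqf_act Q M = bqf_scale s R}"
      proof (intro equalityI subsetI)
        fix M assume "M \<in> (\<lambda>(\<tau>, h). \<tau> ** h) ` Sigma ?V (\<lambda>\<tau>. transporter l (red \<tau>) R)"
        then obtain \<tau> h where M: "M = \<tau> ** h" "\<tau> \<in> T" "?valid \<tau>" "h \<in> Gamma0 l" "bqf_act (red \<tau>) h = R"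
          by (auto simp: transporter_def)
        have "M \<in> X" using M bij_betw_imp_surj_on[OF bij] by force
        thus "M \<in> {M. M \<in> X \<and> bqf_act Q M = bqf_scale s R}" using act[OF M(3)] M by simp
      next
        fix M assume "M \<in> {M. M \<in> X \<and> bqf_act Q M = bqf_scale s R}"
        hence M: "M \<in> X" "bqf_act Q M = bqf_scale s R" by auto
        then obtain \<tau> h where t: "M = \<tau> ** h" "\<tau> \<in> T" "h \<in> Gamma0 l"
          using bij_betw_imp_surj_on[OF bij] by force
        have "bqf_act Q \<tau> = bqf_act (bqf_act (bqf_act Q \<tau>) h) (adj2 h)"
          using bqf_act_adj2(1)[OF Gamma0_det[OF t(3)]] by simp
        also have "\<dots> = bqf_scale s (bqf_act R (adj2 h))"
          using M(2) by (simp add: t(1) bqf_act_mult bqf_act_scale)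
        finally have v: "?valid \<tau>" using bqf_level_act[OF R Gamma0_adj2[OF t(3)]] by blast
        have "bqf_act (red \<tau>) h = R" using act[OF v, of h R] M t by simp
        thus "M \<in> (\<lambda>(\<tau>, h). \<tau> ** h) ` Sigma ?V (\<lambda>\<tau>. transporter l (red \<tau>) R)"
          using v t by (force simp: transporter_def)
      qed
    qed
    have "(\<Sum>M | M \<in> X \<and> bqf_act Q M = bqf_scale s R. F M) =
        (\<Sum>(\<tau>, h)\<in>Sigma ?V (\<lambda>\<tau>. transporter l (red \<tau>) R). F (\<tau> ** h))"
      by (subst sum.reindex_bij_betw[OF bij2, symmetric]) (simp add: case_prod_unfold)
    also have "\<dots> = (\<Sum>\<tau>\<in>?V. \<Sum>h\<in>transporter l (red \<tau>) R. F (\<tau> ** h))"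
    proof (intro sum.Sigma[symmetric] ballI)
      fix \<tau> assume "\<tau> \<in> ?V"
      hence "bqf_disc (red \<tau>) < 0" using red(1) bqf_level_disc assms(3) by blast
      thus "finite (transporter l (red \<tau>) R)" by (rule finite_transporter)
    qed (use fT in simp)
    also have "\<dots> = (\<Sum>\<tau>\<in>?V. \<Sum>h\<in>transporter l (red \<tau>) R. F \<tau>)"
      by (intro sum.cong refl F) (auto simp: transporter_def)
    finally show ?thesis by (simp add: mult.commute)
  qed
  have "class_sum l n (\<lambda>R. \<Sum>M | M \<in> X \<and> bqf_act Q M = bqf_scale s R. F M) =
      class_sum l n (\<lambda>R. \<Sum>\<tau>\<in>?V. F \<tau> * real (card (transporter l (red \<tau>) R)))"
    by (intro class_sum_cong inner)
  also have "\<dots> = (\<Sum>\<tau>\<in>?V. F \<tau> * class_sum l n (\<lambda>R. real (card (transporter l (red \<tau>) R))))"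
    by (simp add: class_sum_sum class_sum_cmult)
  also have "\<dots> = (\<Sum>\<tau>\<in>?V. F \<tau> * 1)"
    using red(1) assms(2,3) by (intro sum.cong refl) (simp add: transporter_class_sum)
  finally show ?thesis by simp
qed

section \<open>Coset representatives and roots modulo a prime\<close>

definition mat22 :: "int \<Rightarrow> int \<Rightarrow> int \<Rightarrow> int \<Rightarrow> int ^ 2 ^ 2" where
  "mat22 a b c d = vector [vector [a, b], vector [c, d]]"

lemma mat22_nth [simp]:
  "mat22 a b c d $ 1 $ 1 = a" "mat22 a b c d $ 1 $ 2 = b"
  "mat22 a b c d $ 2 $ 1 = c" "mat22 a b c d $ 2 $ 2 = d"
  by (simp_all add: mat22_def)

lemma det_mat22 [simp]: "det (mat22 a b c d) = a * d - b * c"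
  by (simp add: det_2)

lemma mat22_eq_iff:
  fixes A B :: "int ^ 2 ^ 2"
  shows "A = B \<longleftrightarrow> A$1$1 = B$1$1 \<and> A$1$2 = B$1$2 \<and> A$2$1 = B$2$1 \<and> A$2$2 = B$2$2"
  by (auto simp: vec_eq_iff forall_2)

text \<open>The first columns run through the \<open>q + 1\<close> lines modulo \<open>q\<close>; \<open>s = 1\<close> gives representatives of
  \<open>SL\<^sub>2(\<int>)/\<Gamma>\<^sub>0(q)\<close>, and \<open>s = q\<close> of the matrices of determinant \<open>q\<close> modulo \<open>SL\<^sub>2(\<int>)\<close>.\<close>

definition line_mats :: "int \<Rightarrow> nat \<Rightarrow> (int ^ 2 ^ 2) set" where
  "line_mats s q = insert (mat22 0 (- s) 1 0) ((\<lambda>j. mat22 1 0 j s) ` {0..<int q})"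

lemma finite_line_mats [simp]: "finite (line_mats s q)"
  by (simp add: line_mats_def)

lemma sum_line_mats:
  "(\<Sum>\<tau> | \<tau> \<in> line_mats s q \<and> P \<tau>. F \<tau>) =
     (\<Sum>j | j \<in> {0..<int q} \<and> P (mat22 1 0 j s). F (mat22 1 0 j s)) +
     (if P (mat22 0 (- s) 1 0) then F (mat22 0 (- s) 1 0) else (0::real))"
proof -
  have inj: "inj_on (\<lambda>j. mat22 1 0 j s) X" for X by (auto simp: inj_on_def mat22_eq_iff)
  have nin: "mat22 0 (- s) 1 0 \<notin> (\<lambda>j. mat22 1 0 j s) ` X" for X by (auto simp: mat22_eq_iff)
  let ?J = "{j. j \<in> {0..<int q} \<and> P (mat22 1 0 j s)}"
  have set: "{\<tau>. \<tau> \<in> line_mats s q \<and> P \<tau>} =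
      (if P (mat22 0 (- s) 1 0) then insert (mat22 0 (- s) 1 0) ((\<lambda>j. mat22 1 0 j s) ` ?J)
       else (\<lambda>j. mat22 1 0 j s) ` ?J)"
    by (auto simp: line_mats_def)
  have "finite ?J" by (rule finite_subset[of _ "{0..<int q}"]) auto
  thus ?thesis unfolding set using nin[of ?J] by (simp add: sum.reindex[OF inj])
qed

lemma bqf_act_line_mats:
  "bqf_act (a, b, c) (mat22 1 0 j s) = (a + b * j + c * j\<^sup>2, s * (b + 2 * c * j), s\<^sup>2 * c)"
  "bqf_act (a, b, c) (mat22 0 (- s) 1 0) = (c, - s * b, s\<^sup>2 * a)"
  by (simp_all add: power2_eq_square algebra_simps)

lemma ex_residue_quotient:
  fixes x y :: int
  assumes "prime q" "\<not> int q dvd x"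
  shows "\<exists>j\<in>{0..<int q}. int q dvd y - j * x"
proof -
  have "coprime x (int q)"
    using assms prime_imp_coprime[of "int q" x] by (simp add: coprime_commute)
  then obtain x' where "[x * x' = 1] (mod int q)" using cong_solve_coprime_int by blast
  then obtain k where k: "x * x' - 1 = int q * k" by (auto simp: cong_iff_dvd_diff elim: dvdE)
  define r D where "r = x' * y mod int q" and "D = x' * y div int q"
  have rD: "r = x' * y - int q * D" unfolding r_def D_def by (simp add: minus_mult_div_eq_mod)
  have "y - r * x = y - (x * x') * y + int q * D * x" unfolding rD by (simp add: algebra_simps)
  also have "x * x' = 1 + int q * k" using k by simp
  finally have "y - r * x = int q * (D * x - k * y)" by (simp add: algebra_simps)
  hence "int q dvd y - r * x" by simp
  moreover have "r \<in> {0..<int q}" using prime_gt_0_nat[OF assms(1)] by (simp add: r_def)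
  ultimately show ?thesis by blast
qed

lemma residue_unique:
  fixes i j :: int
  assumes "i \<in> {0..<int q}" "j \<in> {0..<int q}" "int q dvd i - j"
  shows "i = j"
proof -
  have "i mod int q = j mod int q" using assms(3) by (simp add: mod_eq_dvd_iff)
  thus ?thesis using assms(1,2) by simp
qed

text \<open>The coset of g is determined by its first column modulo p: the line is j = g21/g11, and
  then the lower left entry g21 - j g11 of the cofactor is divisible by p; when p divides g11 the
  line is the one at infinity.\<close>

lemma coset_system_Gamma0:
  assumes "prime p"
  shows "coset_system p (line_mats 1 p) (Gamma0 1)"
  unfolding coset_system_def
proof (intro conjI bij_betw_imageI)
  have not_dvd: "\<not> int p dvd h$1$1" if "h \<in> Gamma0 p" for h
  proof
    assume "int p dvd h$1$1"
    moreover have "int p dvd h$2$1" using that by (simp add: Gamma0_def)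
    ultimately have "int p dvd det h" unfolding det_2 by simp
    thus False using that prime_gt_1_nat[OF assms] by (simp add: Gamma0_def)
  qed
  show "inj_on (\<lambda>(\<tau>, h). \<tau> ** h) (line_mats 1 p \<times> Gamma0 p)"
  proof (rule inj_onI, clarify)
    fix \<tau> h \<tau>' h' assume *: "\<tau> \<in> line_mats 1 p" "h \<in> Gamma0 p" "\<tau>' \<in> line_mats 1 p" "h' \<in> Gamma0 p"
      "\<tau> ** h = \<tau>' ** h'"
    have h: "int p dvd h$2$1" "int p dvd h'$2$1" using * by (auto simp: Gamma0_def)
    have e: "(\<tau> ** h)$i$j = (\<tau>' ** h')$i$j" for i j using *(5) by simp
    note e = e[of 1 1] e[of 1 2] e[of 2 1] e[of 2 2]
    have "\<tau> = \<tau>'"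
    proof -
      have 1: "i = j" if "i \<in> {0..<int p}" "j \<in> {0..<int p}" "\<tau> = mat22 1 0 i 1" "\<tau>' = mat22 1 0 j 1" for i j
      proof -
        have "h$1$1 = h'$1$1" "i * h$1$1 + h$2$1 = j * h'$1$1 + h'$2$1"
          using e that by (simp_all add: mat2_mult)
        hence "(i - j) * h$1$1 = h'$2$1 - h$2$1" by (simp add: algebra_simps)
        hence "int p dvd (i - j) * h$1$1" using h by simp
        hence "int p dvd i - j" using not_dvd[OF *(2)] assms by (simp add: prime_dvd_mult_iff)
        thus ?thesis using residue_unique that by blast
      qed
      have 2: False if "g$1$1 = - g'$2$1" "g \<in> Gamma0 p" "g' \<in> Gamma0 p" for g g' :: "int ^ 2 ^ 2"
        using not_dvd[OF that(2)] that by (simp add: Gamma0_def)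
      consider "\<tau> = \<tau>'" | i j where "i \<in> {0..<int p}" "j \<in> {0..<int p}" "\<tau> = mat22 1 0 i 1" "\<tau>' = mat22 1 0 j 1"
        | i where "\<tau> = mat22 1 0 i 1" "\<tau>' = mat22 0 (- 1) 1 0"
        | j where "\<tau> = mat22 0 (- 1) 1 0" "\<tau>' = mat22 1 0 j 1"
        using *(1,3) unfolding line_mats_def by blast
      thus ?thesis
      proof cases
        case 2
        thus ?thesis using 1 by blast
      next
        case 3
        thus ?thesis using e 2[of h h'] *(2,4) by (simp add: mat2_mult)
      next
        case 4
        thus ?thesis using e 2[of h' h] *(2,4) by (simp add: mat2_mult)
      qed
    qed
    moreover have "h = h'"
      using e *(1) unfolding \<open>\<tau> = \<tau>'\<close>[symmetric] by (auto simp: line_mats_def mat2_mult mat22_eq_iff)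
    ultimately show "\<tau> = \<tau>' \<and> h = h'" by simp
  qed
  show "(\<lambda>(\<tau>, h). \<tau> ** h) ` (line_mats 1 p \<times> Gamma0 p) = Gamma0 1"
  proof (intro equalityI subsetI)
    fix g assume "g \<in> (\<lambda>(\<tau>, h). \<tau> ** h) ` (line_mats 1 p \<times> Gamma0 p)"
    thus "g \<in> Gamma0 1" by (auto simp: Gamma0_def det_mul line_mats_def)
  next
    fix g :: "int ^ 2 ^ 2" assume g: "g \<in> Gamma0 1"
    have "\<exists>\<tau>\<in>line_mats 1 p. \<exists>h\<in>Gamma0 p. g = \<tau> ** h"
    proof (cases "int p dvd g$1$1")
      case True
      thus ?thesis using g
        by (intro bexI[of _ "mat22 0 (- 1) 1 0"] bexI[of _ "mat22 (g$2$1) (g$2$2) (- g$1$1) (- g$1$2)"])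
           (simp_all add: line_mats_def Gamma0_def mat22_eq_iff mat2_mult det_2[of g] algebra_simps)
    next
      case False
      then obtain j where j: "j \<in> {0..<int p}" "int p dvd g$2$1 - j * g$1$1"
        using ex_residue_quotient[OF assms] by blast
      thus ?thesis using g
        by (intro bexI[of _ "mat22 1 0 j 1"] bexI[of _ "mat22 (g$1$1) (g$1$2) (g$2$1 - j * g$1$1) (g$2$2 - j * g$1$2)"])
           (simp_all add: line_mats_def Gamma0_def mat22_eq_iff mat2_mult det_2[of g] algebra_simps)
    qed
    thus "g \<in> (\<lambda>(\<tau>, h). \<tau> ** h) ` (line_mats 1 p \<times> Gamma0 p)" by force
  qed
qed simp

text \<open>A coset of M is the same as the sublattice of index q spanned by the columns of M. These
  sublattices are given by y = j x modulo q with 0 \<le> j < q, and by x = 0 modulo q;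
  \<open>line_mats\<close> lists bases of them.\<close>

lemma coset_system_Hecke:
  assumes "prime q"
  shows "coset_system 1 (line_mats (int q) q) {M. det M = int q}"
  unfolding coset_system_def
proof (intro conjI bij_betw_imageI)
  have q0: "int q > 0" using prime_gt_0_nat[OF assms] by simp
  have not_dvd: "\<not> (int q dvd h$1$1 \<and> int q dvd h$1$2)" if "h \<in> Gamma0 1" for h
  proof
    assume "int q dvd h$1$1 \<and> int q dvd h$1$2"
    hence "int q dvd det h" unfolding det_2 by simp
    thus False using that prime_gt_1_nat[OF assms] by (simp add: Gamma0_def)
  qed
  show "inj_on (\<lambda>(\<tau>, h). \<tau> ** h) (line_mats (int q) q \<times> Gamma0 1)"
  proof (rule inj_onI, clarify)
    fix \<tau> h \<tau>' h' assume *: "\<tau> \<in> line_mats (int q) q" "h \<in> Gamma0 1" "\<tau>' \<in> line_mats (int q) q" "h' \<in> Gamma0 1"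
      "\<tau> ** h = \<tau>' ** h'"
    have e: "(\<tau> ** h)$i$j = (\<tau>' ** h')$i$j" for i j using *(5) by simp
    note e = e[of 1 1] e[of 1 2] e[of 2 1] e[of 2 2]
    have "\<tau> = \<tau>'"
    proof -
      have 1: "i = j" if "i \<in> {0..<int q}" "j \<in> {0..<int q}" "\<tau> = mat22 1 0 i (int q)" "\<tau>' = mat22 1 0 j (int q)" for i j
      proof -
        have "h$1$1 = h'$1$1" "i * h$1$1 + int q * h$2$1 = j * h'$1$1 + int q * h'$2$1"
          "h$1$2 = h'$1$2" "i * h$1$2 + int q * h$2$2 = j * h'$1$2 + int q * h'$2$2"
          using e that by (simp_all add: mat2_mult)
        hence "(i - j) * h$1$1 = int q * (h'$2$1 - h$2$1)" "(i - j) * h$1$2 = int q * (h'$2$2 - h$2$2)"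
          by (simp_all add: algebra_simps)
        hence "int q dvd (i - j) * h$1$1" "int q dvd (i - j) * h$1$2" by simp_all
        hence "int q dvd i - j" using not_dvd[OF *(2)] assms by (auto simp: prime_dvd_mult_iff)
        thus ?thesis using residue_unique that by blast
      qed
      have 2: False if "g$1$1 = - (int q * g'$2$1)" "g$1$2 = - (int q * g'$2$2)" "g \<in> Gamma0 1" for g g' :: "int ^ 2 ^ 2"
        using not_dvd[OF that(3)] that by simp
      consider "\<tau> = \<tau>'" | i j where "i \<in> {0..<int q}" "j \<in> {0..<int q}" "\<tau> = mat22 1 0 i (int q)" "\<tau>' = mat22 1 0 j (int q)"
        | i where "\<tau> = mat22 1 0 i (int q)" "\<tau>' = mat22 0 (- int q) 1 0"
        | j where "\<tau> = mat22 0 (- int q) 1 0" "\<tau>' = mat22 1 0 j (int q)"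
        using *(1,3) unfolding line_mats_def by blast
      thus ?thesis
      proof cases
        case 2
        thus ?thesis using 1 by blast
      next
        case 3
        thus ?thesis using e 2[of h h'] *(2,4) by (simp add: mat2_mult)
      next
        case 4
        thus ?thesis using e 2[of h' h] *(2,4) by (simp add: mat2_mult)
      qed
    qed
    moreover have "h = h'"
      using e *(1) q0 unfolding \<open>\<tau> = \<tau>'\<close>[symmetric] by (auto simp: line_mats_def mat2_mult mat22_eq_iff)
    ultimately show "\<tau> = \<tau>' \<and> h = h'" by simp
  qed
  show "(\<lambda>(\<tau>, h). \<tau> ** h) ` (line_mats (int q) q \<times> Gamma0 1) = {M. det M = int q}"
  proof (intro equalityI subsetI)
    fix g assume "g \<in> (\<lambda>(\<tau>, h). \<tau> ** h) ` (line_mats (int q) q \<times> Gamma0 1)"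
    thus "g \<in> {M. det M = int q}" by (auto simp: Gamma0_def det_mul line_mats_def)
  next
    fix g :: "int ^ 2 ^ 2" assume "g \<in> {M. det M = int q}"
    hence d: "g$1$1 * g$2$2 - g$1$2 * g$2$1 = int q" by (simp add: det_2)
    have mk: "\<exists>\<tau>\<in>line_mats (int q) q. \<exists>h\<in>Gamma0 1. g = \<tau> ** h"
      if j: "j \<in> {0..<int q}" "int q dvd g$2$1 - j * g$1$1" "int q dvd g$2$2 - j * g$1$2" for j
    proof -
      obtain u v where uv: "g$2$1 - j * g$1$1 = int q * u" "g$2$2 - j * g$1$2 = int q * v" using j by (auto elim!: dvdE)
      hence uv': "g$2$1 = j * g$1$1 + int q * u" "g$2$2 = j * g$1$2 + int q * v" by linarith+
      have "int q * (g$1$1 * v - g$1$2 * u) = int q * 1"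
        using d unfolding uv' by (simp add: algebra_simps)
      hence "g$1$1 * v - g$1$2 * u = 1" using q0 by (simp only: mult_cancel_left) simp
      thus ?thesis using uv' j(1)
        by (intro bexI[of _ "mat22 1 0 j (int q)"] bexI[of _ "mat22 (g$1$1) (g$1$2) u v"])
           (simp_all add: line_mats_def Gamma0_def mat22_eq_iff mat2_mult)
    qed
    have "\<exists>\<tau>\<in>line_mats (int q) q. \<exists>h\<in>Gamma0 1. g = \<tau> ** h"
    proof (cases "int q dvd g$1$1")
      case F1: False
      then obtain j where j: "j \<in> {0..<int q}" "int q dvd g$2$1 - j * g$1$1"
        using ex_residue_quotient[OF assms] by blast
      \<comment> \<open>The first column fixes j; as q divides the determinant, the second column
        lies on the same line modulo q.\<close>
      have "g$1$1 * (g$2$2 - j * g$1$2) = int q + g$1$2 * (g$2$1 - j * g$1$1)"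
        using d by (simp add: algebra_simps)
      hence "int q dvd g$1$1 * (g$2$2 - j * g$1$2)" using j(2) by simp
      hence "int q dvd g$2$2 - j * g$1$2" using F1 assms by (simp add: prime_dvd_mult_iff)
      thus ?thesis using mk j by blast
    next
      case T1: True
      show ?thesis
      proof (cases "int q dvd g$1$2")
        case F2: False
        then obtain j where j: "j \<in> {0..<int q}" "int q dvd g$2$2 - j * g$1$2"
          using ex_residue_quotient[OF assms] by blast
        have "g$1$2 * g$2$1 = g$1$1 * g$2$2 - int q" using d by simp
        hence "int q dvd g$1$2 * g$2$1" using T1 by simp
        hence "int q dvd g$2$1" using F2 assms by (simp add: prime_dvd_mult_iff)
        hence "int q dvd g$2$1 - j * g$1$1" using T1 by simp
        thus ?thesis using mk j by blast
      next
        case True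
        then obtain u v where uv: "g$1$1 = int q * u" "g$1$2 = int q * v" using T1 by (auto elim!: dvdE)
        have "int q * (u * g$2$2 - v * g$2$1) = int q * 1" using d unfolding uv by (simp add: algebra_simps)
        hence "u * g$2$2 - v * g$2$1 = 1" using q0 by (simp only: mult_cancel_left) simp
        thus ?thesis using uv
          by (intro bexI[of _ "mat22 0 (- int q) 1 0"] bexI[of _ "mat22 (g$2$1) (g$2$2) (- u) (- v)"])
             (simp_all add: line_mats_def Gamma0_def mat22_eq_iff mat2_mult det_2[of g] algebra_simps)
      qed
    qed
    thus "g \<in> (\<lambda>(\<tau>, h). \<tau> ** h) ` (line_mats (int q) q \<times> Gamma0 1)" by force
  qed
qed simp

section \<open>Roots of a form on the projective line modulo q\<close>

definition num_roots :: "nat \<Rightarrow> bqf \<Rightarrow> nat" where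
  "num_roots q Q = card {j \<in> {0..<int q}. int q dvd bqf_eval Q 1 j} +
     (if int q dvd bqf_eval Q 0 1 then 1 else 0)"

definition bqf_dvd :: "int \<Rightarrow> bqf \<Rightarrow> bool" where
  "bqf_dvd d Q \<longleftrightarrow> (\<exists>R. Q = bqf_scale d R)"

lemma bqf_dvd_iff: "bqf_dvd d (a, b, c) \<longleftrightarrow> d dvd a \<and> d dvd b \<and> d dvd c"
proof
  assume "d dvd a \<and> d dvd b \<and> d dvd c"
  then obtain x y z where "a = d * x" "b = d * y" "c = d * z" by (auto elim!: dvdE)
  thus "bqf_dvd d (a, b, c)" unfolding bqf_dvd_def by (intro exI[of _ "(x, y, z)"]) simp
qed (auto simp: bqf_dvd_def)

lemma card_sqrt_mod:
  assumes "prime q" "2 < q"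
  shows "int (card {y \<in> {0..<int q}. int q dvd y\<^sup>2 - n}) = 1 + Legendre n (int q)"
proof -
  have q: "odd q" using assms prime_odd_nat by blast
  have q0: "int q > 0" using assms by simp
  have sq: "int q dvd y\<^sup>2 - n \<longleftrightarrow> [y\<^sup>2 = n] (mod int q)" for y by (simp add: cong_iff_dvd_diff)
  consider (zero) "[n = 0] (mod int q)" | (res) "\<not> [n = 0] (mod int q)" "QuadRes (int q) n"
    | (nonres) "\<not> [n = 0] (mod int q)" "\<not> QuadRes (int q) n" by blast
  thus ?thesis
  proof cases
    case zero
    have "{y \<in> {0..<int q}. int q dvd y\<^sup>2 - n} = {0}"
    proof -
      have "int q dvd n" using zero by (simp add: cong_0_iff)
      hence "int q dvd y\<^sup>2 - n \<longleftrightarrow> int q dvd y" for y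
        using assms(1) by (simp add: dvd_diff_left_iff prime_dvd_power_iff)
      thus ?thesis using q0 residue_unique[of _ q 0] by auto
    qed
    thus ?thesis using zero by (simp add: Legendre_def)
  next
    case res
    then obtain y where y: "[y\<^sup>2 = n] (mod int q)" by (auto simp: QuadRes_def)
    define r where "r = y mod int q"
    have "[r = y] (mod int q)" by (simp add: r_def cong_def)
    hence r: "[r\<^sup>2 = n] (mod int q)" using y cong_pow cong_trans by blast
    have r0: "r \<in> {0..<int q}" using q0 by (simp add: r_def)
    have nr: "\<not> int q dvd r"
    proof
      assume "int q dvd r"
      hence "int q dvd r\<^sup>2" by (simp add: power2_eq_square)
      hence "[r\<^sup>2 = 0] (mod int q)" by (simp add: cong_0_iff)
      thus False using r res(1) cong_sym cong_trans by blast
    qed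
    hence "r \<noteq> 0" by auto
    have s0: "int q - r \<in> {0..<int q}" using r0 \<open>r \<noteq> 0\<close> by auto
    have "r \<noteq> int q - r" using q by (metis even_of_nat dvd_triv_left mult_2 diff_add_cancel)
    have "{y \<in> {0..<int q}. int q dvd y\<^sup>2 - n} = {r, int q - r}"
    proof (intro equalityI subsetI)
      fix x assume "x \<in> {y \<in> {0..<int q}. int q dvd y\<^sup>2 - n}"
      hence x: "x \<in> {0..<int q}" "[x\<^sup>2 = n] (mod int q)" using sq by auto
      have "[x\<^sup>2 = r\<^sup>2] (mod int q)" using x(2) r cong_sym cong_trans by blast
      hence "int q dvd (x - r) * (x + r)" by (simp add: cong_iff_dvd_diff power2_eq_square algebra_simps)
      hence "int q dvd x - r \<or> int q dvd x + r" using assms by (simp add: prime_dvd_mult_iff)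
      thus "x \<in> {r, int q - r}"
      proof
        assume "int q dvd x - r"
        thus ?thesis using residue_unique[OF x(1) r0] by simp
      next
        assume "int q dvd x + r"
        moreover have "x - (int q - r) = (x + r) - int q" by simp
        ultimately have "int q dvd x - (int q - r)" by (metis dvd_diff dvd_refl)
        thus ?thesis using residue_unique[OF x(1) s0] by simp
      qed
    next
      fix x assume x: "x \<in> {r, int q - r}"
      have e: "(int q - r)\<^sup>2 - n = (r\<^sup>2 - n) + int q * (int q - 2 * r)"
        by (simp add: power2_eq_square algebra_simps)
      have d: "int q dvd r\<^sup>2 - n" using r sq by blast
      hence "int q dvd (int q - r)\<^sup>2 - n" unfolding e by (intro dvd_add dvd_triv_left)
      with d show "x \<in> {y \<in> {0..<int q}. int q dvd y\<^sup>2 - n}" using x r0 s0 by blast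
    qed
    thus ?thesis using res \<open>r \<noteq> int q - r\<close> by (simp add: Legendre_def)
  next
    case nonres
    hence "{y \<in> {0..<int q}. int q dvd y\<^sup>2 - n} = {}" unfolding sq by (auto simp: QuadRes_def)
    hence "card {y \<in> {0..<int q}. int q dvd y\<^sup>2 - n} = 0" by (simp only: card.empty)
    thus ?thesis using nonres by (simp add: Legendre_def)
  qed
qed

lemma num_roots_imprimitive:
  assumes "bqf_dvd (int q) Q"
  shows "num_roots q Q = q + 1"
proof -
  obtain a b c where Q: "Q = (a, b, c)" by (cases Q)
  have "int q dvd a" "int q dvd b" "int q dvd c" using assms by (auto simp: Q bqf_dvd_iff)
  hence "{j \<in> {0..<int q}. int q dvd bqf_eval Q 1 j} = {0..<int q}" by (auto simp: Q)
  thus ?thesis using \<open>int q dvd c\<close> by (simp add: num_roots_def Q)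
qed

text \<open>For odd q not dividing c, multiplication by 4 c completes the square, and the affine
  roots correspond to the square roots of the discriminant. If an odd q divides c, infinity is a
  root and the remaining equation is linear in j. For q = 2 parities decide: for odd b the
  discriminant is 1 or 5 modulo 8 according to the parity of a c.\<close>

lemma num_roots_primitive:
  assumes q: "prime q" and Q: "\<not> bqf_dvd (int q) Q"
  shows "int (num_roots q Q) = 1 + kronecker_prime (bqf_disc Q) q"
proof -
  obtain a b c where abc: "Q = (a, b, c)" by (cases Q)
  define n where "n = b\<^sup>2 - 4 * a * c"
  have disc: "bqf_disc Q = n" by (simp add: abc n_def)
  have prim: "\<not> (int q dvd a \<and> int q dvd b \<and> int q dvd c)" using Q by (simp add: abc bqf_dvd_iff)
  show ?thesis
  proof (cases "q = 2")
    case True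
    have "{0..<2::int} = {0, 1}" by auto
    hence "{j \<in> {0..<2}. even (a + b * j + c * j\<^sup>2)} =
        (if even a then {0} else {}) \<union> (if even (a + b + c) then {1} else {})" by auto
    hence N: "num_roots q Q = (if even a then 1 else 0) + (if even (a + b + c) then 1 else 0) + (if even c then 1 else 0)"
      by (auto simp: num_roots_def abc True)
    show ?thesis
    proof (cases "even b")
      case True
      hence "even n" by (simp add: n_def)
      thus ?thesis using N prim True \<open>q = 2\<close> by (auto simp: disc kronecker_prime_def)
    next
      case False
      then obtain k where k: "b = 2 * k + 1" by (rule oddE)
      obtain m where m: "k * (k + 1) = 2 * m" by (metis even_mult_iff even_plus_one_iff evenE)
      have "b\<^sup>2 = 4 * (k * (k + 1)) + 1" by (simp add: k power2_eq_square algebra_simps)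
      hence b2: "b\<^sup>2 = 8 * m + 1" by (simp add: m)
      have "odd n" using False by (simp add: n_def)
      show ?thesis
      proof (cases "even (a * c)")
        case True
        then obtain r where r: "a * c = 2 * r" by blast
        have "n = 8 * (m - r) + 1" using r b2 by (simp add: n_def mult.assoc)
        hence "n mod 8 = 1" by presburger
        thus ?thesis using N True False \<open>odd n\<close> \<open>q = 2\<close> by (auto simp: disc kronecker_prime_def)
      next
        case odd: False
        then obtain r where r: "a * c = 2 * r + 1" by (rule oddE)
        have "n = 8 * (m - r - 1) + 5" using r b2 by (simp add: n_def mult.assoc)
        hence "n mod 8 = 5" by presburger
        thus ?thesis using N odd False \<open>odd n\<close> \<open>q = 2\<close> by (auto simp: disc kronecker_prime_def)
      qed
    qed
  next
    case False
    hence q2: "q > 2" using prime_ge_2_nat[OF q] by simp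
    have kp: "kronecker_prime (bqf_disc Q) q = Legendre n (int q)"
      using False by (simp add: disc kronecker_prime_def)
    have N: "num_roots q Q = card {j \<in> {0..<int q}. int q dvd a + b * j + c * j\<^sup>2} + (if int q dvd c then 1 else 0)"
      by (simp add: num_roots_def abc)
    have n2: "\<not> int q dvd 2" using q2 zdvd_imp_le[of "int q" 2] by auto
    show ?thesis
    proof (cases "int q dvd c")
      case qc: False
      have u: "\<not> int q dvd 2 * c" using qc n2 q by (simp add: prime_dvd_mult_iff)
      have n4: "\<not> int q dvd 4 * c"
        using u n2 q prime_dvd_multD[of "int q" 2 "2 * c"] by auto
      have eq: "int q dvd a + b * j + c * j\<^sup>2 \<longleftrightarrow> int q dvd (2 * c * j + b)\<^sup>2 - n" for j
      proof -
        have "(2 * c * j + b)\<^sup>2 - n = 4 * c * (a + b * j + c * j\<^sup>2)"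
          by (simp add: n_def power2_eq_square algebra_simps)
        thus ?thesis using n4 q by (simp add: prime_dvd_mult_iff)
      qed
      have md: "int q dvd (x mod int q)\<^sup>2 - n \<longleftrightarrow> int q dvd x\<^sup>2 - n" for x
        by (metis mod_eq_dvd_iff power_mod)
      have "bij_betw (\<lambda>j. (2 * c * j + b) mod int q) {j \<in> {0..<int q}. int q dvd a + b * j + c * j\<^sup>2}
          {y \<in> {0..<int q}. int q dvd y\<^sup>2 - n}"
      proof (rule bij_betw_imageI)
        show "inj_on (\<lambda>j. (2 * c * j + b) mod int q) {j \<in> {0..<int q}. int q dvd a + b * j + c * j\<^sup>2}"
        proof (rule inj_onI)
          fix i j assume ij: "i \<in> {j \<in> {0..<int q}. int q dvd a + b * j + c * j\<^sup>2}"
            "j \<in> {j \<in> {0..<int q}. int q dvd a + b * j + c * j\<^sup>2}"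
            "(2 * c * i + b) mod int q = (2 * c * j + b) mod int q"
          hence "int q dvd (2 * c * i + b) - (2 * c * j + b)" by (simp add: mod_eq_dvd_iff)
          hence "int q dvd (2 * c) * (i - j)" by (simp add: algebra_simps)
          hence "int q dvd i - j" using u q prime_dvd_multD by (metis prime_nat_int_transfer)
          thus "i = j" using ij residue_unique by blast
        qed
        show "(\<lambda>j. (2 * c * j + b) mod int q) ` {j \<in> {0..<int q}. int q dvd a + b * j + c * j\<^sup>2} =
          {y \<in> {0..<int q}. int q dvd y\<^sup>2 - n}"
        proof (intro equalityI subsetI)
          fix y assume "y \<in> (\<lambda>j. (2 * c * j + b) mod int q) ` {j \<in> {0..<int q}. int q dvd a + b * j + c * j\<^sup>2}"
          thus "y \<in> {y \<in> {0..<int q}. int q dvd y\<^sup>2 - n}" using q2 by (auto simp: md eq)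
        next
          fix y assume y: "y \<in> {y \<in> {0..<int q}. int q dvd y\<^sup>2 - n}"
          obtain j where j: "j \<in> {0..<int q}" "int q dvd (y - b) - j * (2 * c)"
            using ex_residue_quotient[OF q u] by blast
          hence "int q dvd y - (2 * c * j + b)" by (simp add: algebra_simps)
          hence "y mod int q = (2 * c * j + b) mod int q" by (simp add: mod_eq_dvd_iff)
          hence jy: "(2 * c * j + b) mod int q = y" using y by auto
          hence "int q dvd (2 * c * j + b)\<^sup>2 - n" using y md[of "2 * c * j + b"] by simp
          thus "y \<in> (\<lambda>j. (2 * c * j + b) mod int q) ` {j \<in> {0..<int q}. int q dvd a + b * j + c * j\<^sup>2}"
            using j jy eq by (intro image_eqI[of _ _ j]) auto
        qed
      qed
      hence "card {j \<in> {0..<int q}. int q dvd a + b * j + c * j\<^sup>2} = card {y \<in> {0..<int q}. int q dvd y\<^sup>2 - n}"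
        by (rule bij_betw_same_card)
      thus ?thesis using card_sqrt_mod[OF q q2, of n] qc by (simp add: N kp)
    next
      case qc: True
      have nb: "[b\<^sup>2 = n] (mod int q)" using qc by (simp add: n_def cong_iff_dvd_diff)
      have eq: "int q dvd a + b * j + c * j\<^sup>2 \<longleftrightarrow> int q dvd a + b * j" for j
        using qc by (simp add: dvd_add_left_iff)
      show ?thesis
      proof (cases "int q dvd b")
        case True
        hence "{j \<in> {0..<int q}. int q dvd a + b * j + c * j\<^sup>2} = {}"
          using prim qc by (auto simp: eq dvd_add_left_iff)
        hence "card {j \<in> {0..<int q}. int q dvd a + b * j + c * j\<^sup>2} = 0" by (simp only: card.empty)
        moreover have "[n = 0] (mod int q)" using True qc by (simp add: n_def cong_0_iff power2_eq_square)
        ultimately show ?thesis using qc unfolding N kp by (simp add: Legendre_def)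
      next
        case qb: False
        obtain j where j: "j \<in> {0..<int q}" "int q dvd - a - j * b"
          using ex_residue_quotient[OF q qb] by blast
        have "int q dvd a + b * i \<longleftrightarrow> i = j" if "i \<in> {0..<int q}" for i
        proof
          assume "int q dvd a + b * i"
          from dvd_add[OF this j(2)] have "int q dvd b * (i - j)" by (simp add: algebra_simps)
          hence "int q dvd i - j" using qb q by (simp add: prime_dvd_mult_iff)
          thus "i = j" using residue_unique that j by blast
        next
          assume "i = j"
          thus "int q dvd a + b * i" using j(2) by (metis dvd_minus_iff minus_add_distrib minus_minus mult.commute uminus_add_conv_diff add_uminus_conv_diff)
        qed
        hence "{j \<in> {0..<int q}. int q dvd a + b * j + c * j\<^sup>2} = {j}" using j(1) by (auto simp: eq)
        hence "card {j \<in> {0..<int q}. int q dvd a + b * j + c * j\<^sup>2} = 1" by simp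
        moreover have "\<not> [n = 0] (mod int q)"
        proof
          assume "[n = 0] (mod int q)"
          hence "[b\<^sup>2 = 0] (mod int q)" using nb cong_trans by blast
          thus False using qb q by (simp add: cong_0_iff prime_dvd_power_iff)
        qed
        moreover have "QuadRes (int q) n" using nb by (auto simp: QuadRes_def)
        ultimately show ?thesis using qc unfolding N kp by (simp add: Legendre_def)
      qed
    qed
  qed
qed

section \<open>Hecke correspondences\<close>

declare One_nat_def [simp del] bqf_act.simps [simp del] bqf_eval.simps [simp del]
  split_paired_All [simp del] split_paired_Ex [simp del]

text \<open>Positive and negative definite forms are both counted, and the stabilizers are those in
  \<open>SL\<^sub>2(\<int>)\<close>, not modulo \<open>{1, -1}\<close>.\<close>

definition mass :: "int \<Rightarrow> real" where
  "mass n = class_sum 1 n (\<lambda>_. 1)"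

text \<open>Kept as an indicator sum over all forms of discriminant n, so that it can be split off
  inside a class sum; \<open>mass_dvd_scale\<close> turns it into a sum for a smaller
  discriminant.\<close>

definition mass_dvd :: "int \<Rightarrow> int \<Rightarrow> real" where
  "mass_dvd d n = class_sum 1 n (\<lambda>Q. if bqf_dvd d Q then 1 else 0)"

lemma bqf_scale_1 [simp]: "bqf_scale 1 Q = Q"
  by (cases Q) simp

lemma bqf_level_1_iff: "Q \<in> bqf_level 1 n \<longleftrightarrow> bqf_disc Q = n"
  by (cases Q) (simp add: bqf_level_def)

lemma bqf_level_subset: "Q \<in> bqf_level p n \<Longrightarrow> Q \<in> bqf_level 1 n"
  by (cases Q) (simp add: bqf_level_def)

lemma Gamma0_1_iff: "A \<in> Gamma0 1 \<longleftrightarrow> det A = 1"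
  by (simp add: Gamma0_def)

text \<open>Forms of level p are also of level 1, so the constant 1 can be expanded as a level 1 sum
  of transporter sizes. After the exchange of sums, \<open>coset_sum\<close> counts for each Q the
  cosets of \<open>Gamma0 p\<close> in \<open>Gamma0 1\<close> that make the first coefficient
  divisible by p; that coefficient is the value of Q at a line modulo p.\<close>

theorem level_mass_eq:
  assumes p: "prime p" and n: "n < 0"
  shows "class_sum p n (\<lambda>_. 1) = class_sum 1 n (\<lambda>Q. real (num_roots p Q))"
proof -
  have p0: "p > 0" using prime_gt_0_nat[OF p] .
  have count: "real (card (transporter 1 R Q)) = (\<Sum>M | M \<in> Gamma0 1 \<and> bqf_act Q M = bqf_scale 1 R. 1)" for R Q
    unfolding card_transporter_commute[of 1 R Q] by (simp add: transporter_def)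
  have "class_sum p n (\<lambda>_. 1) = class_sum p n (\<lambda>R. class_sum 1 n (\<lambda>Q. real (card (transporter 1 R Q))))"
    using n by (intro class_sum_cong) (simp add: transporter_class_sum bqf_level_subset)
  also have "\<dots> = class_sum 1 n (\<lambda>Q. class_sum p n (\<lambda>R. real (card (transporter 1 R Q))))"
    by (rule class_sum_swap)
  also have "\<dots> = class_sum 1 n (\<lambda>Q. class_sum p n (\<lambda>R. \<Sum>M | M \<in> Gamma0 1 \<and> bqf_act Q M = bqf_scale 1 R. 1))"
    by (simp only: count)
  also have "\<dots> = class_sum 1 n (\<lambda>Q. real (num_roots p Q))"
  proof (rule class_sum_cong)
    fix Q assume "Q \<in> bqf_level 1 n"
    hence Q: "bqf_disc Q = n" by (simp add: bqf_level_1_iff)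
    obtain a b c where abc: "Q = (a, b, c)" by (cases Q)
    have valid: "(\<exists>R\<in>bqf_level p n. bqf_act Q \<tau> = bqf_scale 1 R) \<longleftrightarrow> int p dvd fst (bqf_act Q \<tau>)"
      if "det \<tau> = 1" for \<tau>
      using bqf_disc_act[of Q \<tau>] that Q by (cases "bqf_act Q \<tau>") (auto simp: bqf_level_def)
    have "class_sum p n (\<lambda>R. \<Sum>M | M \<in> Gamma0 1 \<and> bqf_act Q M = bqf_scale 1 R. 1) =
        (\<Sum>\<tau> | \<tau> \<in> line_mats 1 p \<and> (\<exists>R\<in>bqf_level p n. bqf_act Q \<tau> = bqf_scale 1 R). 1)"
      using p0 n by (intro coset_sum coset_system_Gamma0 p) auto
    also have "\<dots> = real (num_roots p Q)"
    proof -
      have "(\<exists>R\<in>bqf_level p n. bqf_act Q (mat22 1 0 j 1) = bqf_scale 1 R) \<longleftrightarrow> int p dvd bqf_eval Q 1 j" for j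
        using valid[of "mat22 1 0 j 1"] by (simp add: abc bqf_act_line_mats bqf_eval.simps)
      moreover have "(\<exists>R\<in>bqf_level p n. bqf_act Q (mat22 0 (- 1) 1 0) = bqf_scale 1 R) \<longleftrightarrow> int p dvd bqf_eval Q 0 1"
        using valid[of "mat22 0 (- 1) 1 0"] by (simp add: abc bqf_act_line_mats bqf_eval.simps)
      ultimately show ?thesis unfolding sum_line_mats num_roots_def by simp
    qed
    finally show "class_sum p n (\<lambda>R. \<Sum>M | M \<in> Gamma0 1 \<and> bqf_act Q M = bqf_scale 1 R. 1) = real (num_roots p Q)" .
  qed
  finally show ?thesis .
qed

section \<open>Matrices of prime determinant and their adjugates\<close>

lemma sum_adj2:
  "(\<Sum>M | det M = d \<and> P (adj2 M). f (adj2 M)) = (\<Sum>M | det M = d \<and> P M. (f M :: real))"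
  by (rule sum.reindex_bij_witness[where i = adj2 and j = adj2]) auto

lemma bqf_act_eq_scale_iff:
  assumes "det M = d" "d \<noteq> 0"
  shows "bqf_act Q M = bqf_scale d R \<longleftrightarrow> bqf_act R (adj2 M) = bqf_scale d Q"
    and "bqf_act Q M = R \<longleftrightarrow> bqf_act R (adj2 M) = bqf_scale (d\<^sup>2) Q"
proof -
  have 1: "bqf_act S (adj2 A) = bqf_scale d T" if "bqf_act T A = bqf_scale d S" "det A = d" for S T A
  proof -
    have "bqf_scale d (bqf_act S (adj2 A)) = bqf_scale (d * d) T"
      using bqf_act_adj2_scale[of T A] that by (simp add: bqf_act_scale power2_eq_square)
    thus ?thesis using assms(2) by (metis bqf_scale_inject bqf_scale_scale)
  qed
  show "bqf_act Q M = bqf_scale d R \<longleftrightarrow> bqf_act R (adj2 M) = bqf_scale d Q"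
    using 1[of Q M R] 1[of R "adj2 M" Q] assms by auto
  show "bqf_act Q M = R \<longleftrightarrow> bqf_act R (adj2 M) = bqf_scale (d\<^sup>2) Q"
  proof
    assume "bqf_act Q M = R"
    thus "bqf_act R (adj2 M) = bqf_scale (d\<^sup>2) Q" using bqf_act_adj2_scale[of Q M] assms by simp
  next
    assume "bqf_act R (adj2 M) = bqf_scale (d\<^sup>2) Q"
    hence "bqf_scale (d\<^sup>2) R = bqf_scale (d\<^sup>2) (bqf_act Q M)"
      using bqf_act_adj2_scale[of R "adj2 M"] assms by (simp add: bqf_act_scale)
    thus "bqf_act Q M = R" using assms(2) bqf_scale_inject[of "d\<^sup>2" R "bqf_act Q M"] by simp
  qed
qed

text \<open>A matrix \<open>M\<close> of determinant \<open>q\<close> carries \<open>Q\<close> to \<open>R\<close> iff its adjugate carries \<open>R\<close> to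
  \<open>q\<^sup>2 Q\<close>; the two sides count such \<open>M\<close> from the two ends.\<close>

theorem hecke_mass:
  assumes q: "prime q" and n: "n < 0"
  shows "(real q + 1) * mass n = class_sum 1 (n * (int q)\<^sup>2) (\<lambda>R.
    \<Sum>\<tau> | \<tau> \<in> line_mats (int q) q \<and> (\<exists>Q\<in>bqf_level 1 n. bqf_act R \<tau> = bqf_scale ((int q)\<^sup>2) Q). 1)"
proof -
  have q0: "int q > 0" using prime_gt_0_nat[OF q] by simp
  have nq: "n * (int q)\<^sup>2 < 0" using n q0 by (simp add: mult_neg_pos)
  have "(real q + 1) * mass n = class_sum 1 n (\<lambda>Q. (real q + 1) * 1)"
    unfolding mass_def by (rule class_sum_cmult[symmetric])
  also have "\<dots> = class_sum 1 n (\<lambda>Q. class_sum 1 (n * (int q)\<^sup>2)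
      (\<lambda>R. \<Sum>M | M \<in> {M. det M = int q} \<and> bqf_act Q M = bqf_scale 1 R. 1))"
  proof (rule class_sum_cong)
    fix Q assume "Q \<in> bqf_level 1 n"
    hence Q: "bqf_disc Q = n" by (simp add: bqf_level_1_iff)
    have valid: "\<exists>R\<in>bqf_level 1 (n * (int q)\<^sup>2). bqf_act Q \<tau> = bqf_scale 1 R" if "det \<tau> = int q" for \<tau>
      using bqf_disc_act[of Q \<tau>] that Q by (simp add: Bex_def bqf_level_1_iff mult.commute)
    have "class_sum 1 (n * (int q)\<^sup>2) (\<lambda>R. \<Sum>M | M \<in> {M. det M = int q} \<and> bqf_act Q M = bqf_scale 1 R. 1)
        = (\<Sum>\<tau> | \<tau> \<in> line_mats (int q) q \<and> (\<exists>R\<in>bqf_level 1 (n * (int q)\<^sup>2). bqf_act Q \<tau> = bqf_scale 1 R). 1)"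
      using nq by (intro coset_sum coset_system_Hecke q) auto
    also have "\<dots> = real q + 1"
    proof -
      have "{j. 0 \<le> j \<and> j < int q} = {0..<int q}" by auto
      thus ?thesis
        unfolding sum_line_mats using valid[of "mat22 0 (- int q) 1 0"] valid[of "mat22 1 0 _ (int q)"]
        by simp
    qed
    finally show "(real q + 1) * 1 = class_sum 1 (n * (int q)\<^sup>2)
        (\<lambda>R. \<Sum>M | M \<in> {M. det M = int q} \<and> bqf_act Q M = bqf_scale 1 R. 1)" by simp
  qed
  also have "\<dots> = class_sum 1 (n * (int q)\<^sup>2) (\<lambda>R. class_sum 1 n
      (\<lambda>Q. \<Sum>M | M \<in> {M. det M = int q} \<and> bqf_act Q M = bqf_scale 1 R. 1))"
    by (rule class_sum_swap)
  also have "\<dots> = class_sum 1 (n * (int q)\<^sup>2) (\<lambda>R. class_sum 1 n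
      (\<lambda>Q. \<Sum>M | M \<in> {M. det M = int q} \<and> bqf_act R M = bqf_scale ((int q)\<^sup>2) Q. 1))"
  proof (intro arg_cong[where f = "class_sum 1 _"] ext)
    fix R Q
    have "{M. M \<in> {M. det M = int q} \<and> bqf_act Q M = bqf_scale 1 R} =
        {M. det M = int q \<and> bqf_act R (adj2 M) = bqf_scale ((int q)\<^sup>2) Q}"
      using bqf_act_eq_scale_iff(2)[where d = "int q" and Q = Q and R = R] q0 by auto
    thus "(\<Sum>M | M \<in> {M. det M = int q} \<and> bqf_act Q M = bqf_scale 1 R. 1 :: real) =
        (\<Sum>M | M \<in> {M. det M = int q} \<and> bqf_act R M = bqf_scale ((int q)\<^sup>2) Q. 1)"
      using sum_adj2[where d = "int q" and P = "\<lambda>M. bqf_act R M = bqf_scale ((int q)\<^sup>2) Q" and f = "\<lambda>_. 1"] by simp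
  qed
  also have "\<dots> = class_sum 1 (n * (int q)\<^sup>2) (\<lambda>R.
    \<Sum>\<tau> | \<tau> \<in> line_mats (int q) q \<and> (\<exists>Q\<in>bqf_level 1 n. bqf_act R \<tau> = bqf_scale ((int q)\<^sup>2) Q). 1)"
    using n q0 by (intro arg_cong[where f = "class_sum 1 _"] ext coset_sum coset_system_Hecke q) auto
  finally show ?thesis .
qed

text \<open>The absolute value treats positive and negative definite forms alike; imprimitive
  vectors are included.\<close>

definition num_reps :: "nat \<Rightarrow> bqf \<Rightarrow> nat" where
  "num_reps N Q = card {v :: int \<times> int. \<bar>bqf_eval Q (fst v) (snd v)\<bar> = int N}"

lemma num_reps_act:
  assumes "det A = 1"
  shows "num_reps N (bqf_act Q A) = num_reps N Q"
  unfolding num_reps_def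
proof (rule bij_betw_same_card[where f = "\<lambda>v. (A$1$1 * fst v + A$1$2 * snd v, A$2$1 * fst v + A$2$2 * snd v)"],
    rule bij_betw_byWitness[where f' = "\<lambda>v. (A$2$2 * fst v - A$1$2 * snd v, A$1$1 * snd v - A$2$1 * fst v)"])
  define D where "D = A$1$1 * A$2$2 - A$1$2 * A$2$1"
  have D: "D = 1" using assms by (simp add: det_2 D_def)
  have "A$2$2 * (A$1$1 * x + A$1$2 * y) - A$1$2 * (A$2$1 * x + A$2$2 * y) = D * x"
    "A$1$1 * (A$2$1 * x + A$2$2 * y) - A$2$1 * (A$1$1 * x + A$1$2 * y) = D * y"
    "A$1$1 * (A$2$2 * x - A$1$2 * y) + A$1$2 * (A$1$1 * y - A$2$1 * x) = D * x"
    "A$2$1 * (A$2$2 * x - A$1$2 * y) + A$2$2 * (A$1$1 * y - A$2$1 * x) = D * y" for x y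
    by (simp_all add: D_def algebra_simps)
  hence inv1: "A$2$2 * (A$1$1 * x + A$1$2 * y) - A$1$2 * (A$2$1 * x + A$2$2 * y) = x"
    "A$1$1 * (A$2$1 * x + A$2$2 * y) - A$2$1 * (A$1$1 * x + A$1$2 * y) = y"
    "A$1$1 * (A$2$2 * x - A$1$2 * y) + A$1$2 * (A$1$1 * y - A$2$1 * x) = x"
    "A$2$1 * (A$2$2 * x - A$1$2 * y) + A$2$2 * (A$1$1 * y - A$2$1 * x) = y" for x y
    unfolding D by simp_all
  show "\<forall>v\<in>{v. \<bar>bqf_eval (bqf_act Q A) (fst v) (snd v)\<bar> = int N}.
    (A$2$2 * fst (A$1$1 * fst v + A$1$2 * snd v, A$2$1 * fst v + A$2$2 * snd v) -
     A$1$2 * snd (A$1$1 * fst v + A$1$2 * snd v, A$2$1 * fst v + A$2$2 * snd v),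
     A$1$1 * snd (A$1$1 * fst v + A$1$2 * snd v, A$2$1 * fst v + A$2$2 * snd v) -
     A$2$1 * fst (A$1$1 * fst v + A$1$2 * snd v, A$2$1 * fst v + A$2$2 * snd v)) = v"
    by (simp add: inv1)
  show "\<forall>v\<in>{v. \<bar>bqf_eval Q (fst v) (snd v)\<bar> = int N}.
    (A$1$1 * fst (A$2$2 * fst v - A$1$2 * snd v, A$1$1 * snd v - A$2$1 * fst v) +
     A$1$2 * snd (A$2$2 * fst v - A$1$2 * snd v, A$1$1 * snd v - A$2$1 * fst v),
     A$2$1 * fst (A$2$2 * fst v - A$1$2 * snd v, A$1$1 * snd v - A$2$1 * fst v) +
     A$2$2 * snd (A$2$2 * fst v - A$1$2 * snd v, A$1$1 * snd v - A$2$1 * fst v)) = v"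
    by (simp add: inv1)
  show "(\<lambda>v. (A$1$1 * fst v + A$1$2 * snd v, A$2$1 * fst v + A$2$2 * snd v)) `
      {v. \<bar>bqf_eval (bqf_act Q A) (fst v) (snd v)\<bar> = int N} \<subseteq> {v. \<bar>bqf_eval Q (fst v) (snd v)\<bar> = int N}"
    by (auto simp: bqf_eval_act)
  show "(\<lambda>v. (A$2$2 * fst v - A$1$2 * snd v, A$1$1 * snd v - A$2$1 * fst v)) `
      {v. \<bar>bqf_eval Q (fst v) (snd v)\<bar> = int N} \<subseteq> {v. \<bar>bqf_eval (bqf_act Q A) (fst v) (snd v)\<bar> = int N}"
    by (auto simp: bqf_eval_act inv1)
qed

lemma bqf_eval_scale: "bqf_eval (bqf_scale s Q) x y = s * bqf_eval Q x y"
  by (cases Q) (simp add: algebra_simps bqf_eval.simps)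

lemma num_reps_scale:
  assumes "q > 0"
  shows "num_reps (q * N) (bqf_scale (int q) R) = num_reps N R"
  using assms by (simp add: num_reps_def bqf_eval_scale abs_mult)

text \<open>Self-adjointness of the Hecke correspondence: a matrix of determinant q carries Q to q R
  iff its adjugate carries R to q Q. On such pairs q R represents q N as often as R represents N, so
  the weight depends on R alone.\<close>

theorem hecke_reps:
  assumes q: "prime q" and n: "n < 0"
  shows "class_sum 1 n (\<lambda>Q. \<Sum>\<tau> | \<tau> \<in> line_mats (int q) q \<and>
      (\<exists>R\<in>bqf_level 1 n. bqf_act Q \<tau> = bqf_scale (int q) R). real (num_reps (q * N) (bqf_act Q \<tau>))) =
    class_sum 1 n (\<lambda>R. real (num_reps N R) * (\<Sum>\<tau> | \<tau> \<in> line_mats (int q) q \<and>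
      (\<exists>Q\<in>bqf_level 1 n. bqf_act R \<tau> = bqf_scale (int q) Q). 1))"
proof -
  have q0: "int q > 0" "q > 0" using prime_gt_0_nat[OF q] by simp_all
  have "class_sum 1 n (\<lambda>Q. \<Sum>\<tau> | \<tau> \<in> line_mats (int q) q \<and>
      (\<exists>R\<in>bqf_level 1 n. bqf_act Q \<tau> = bqf_scale (int q) R). real (num_reps (q * N) (bqf_act Q \<tau>))) =
    class_sum 1 n (\<lambda>Q. class_sum 1 n (\<lambda>R. \<Sum>M | M \<in> {M. det M = int q} \<and> bqf_act Q M = bqf_scale (int q) R.
      real (num_reps (q * N) (bqf_act Q M))))"
    using n q0 Gamma0_1_iff
    by (intro arg_cong[where f = "class_sum 1 _"] ext coset_sum[symmetric] coset_system_Hecke q)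
       (auto simp: bqf_act_mult num_reps_act Gamma0_def)
  also have "\<dots> = class_sum 1 n (\<lambda>Q. class_sum 1 n (\<lambda>R. \<Sum>M | M \<in> {M. det M = int q} \<and> bqf_act R M = bqf_scale (int q) Q.
      real (num_reps N R)))"
  proof (intro arg_cong[where f = "class_sum 1 _"] ext)
    fix Q R
    have "(\<Sum>M | M \<in> {M. det M = int q} \<and> bqf_act Q M = bqf_scale (int q) R. real (num_reps (q * N) (bqf_act Q M)))
      = (\<Sum>M | M \<in> {M. det M = int q} \<and> bqf_act Q M = bqf_scale (int q) R. real (num_reps N R))"
      using q0 by (intro sum.cong refl) (auto simp: num_reps_scale)
    also have "\<dots> = (\<Sum>M | det M = int q \<and> bqf_act R (adj2 M) = bqf_scale (int q) Q. real (num_reps N R))"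
      using bqf_act_eq_scale_iff(1)[where d = "int q" and Q = Q and R = R] q0 by (intro sum.cong) auto
    also have "(\<Sum>M | det M = int q \<and> bqf_act R (adj2 M) = bqf_scale (int q) Q. real (num_reps N R)) =
        (\<Sum>M | det M = int q \<and> bqf_act R M = bqf_scale (int q) Q. real (num_reps N R))"
      by (rule sum_adj2)
    finally show "(\<Sum>M | M \<in> {M. det M = int q} \<and> bqf_act Q M = bqf_scale (int q) R. real (num_reps (q * N) (bqf_act Q M)))
      = (\<Sum>M | M \<in> {M. det M = int q} \<and> bqf_act R M = bqf_scale (int q) Q. real (num_reps N R))"
      by (simp only: mem_Collect_eq)
  qed
  also have "\<dots> = class_sum 1 n (\<lambda>R. class_sum 1 n (\<lambda>Q. \<Sum>M | M \<in> {M. det M = int q} \<and> bqf_act R M = bqf_scale (int q) Q.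
      real (num_reps N R)))"
    by (rule class_sum_swap)
  also have "\<dots> = class_sum 1 n (\<lambda>R. \<Sum>\<tau> | \<tau> \<in> line_mats (int q) q \<and>
      (\<exists>Q\<in>bqf_level 1 n. bqf_act R \<tau> = bqf_scale (int q) Q). real (num_reps N R))"
    using n q0 by (intro arg_cong[where f = "class_sum 1 _"] ext coset_sum coset_system_Hecke q) auto
  finally show ?thesis by (simp add: mult.commute)
qed

lemma bqf_dvd_act:
  assumes "det A = 1"
  shows "bqf_dvd d (bqf_act Q A) \<longleftrightarrow> bqf_dvd d Q"
proof
  assume "bqf_dvd d (bqf_act Q A)"
  then obtain R where "bqf_act Q A = bqf_scale d R" unfolding bqf_dvd_def by blast
  hence "Q = bqf_scale d (bqf_act R (adj2 A))" using bqf_act_adj2(1)[OF assms, of Q] by (simp add: bqf_act_scale)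
  thus "bqf_dvd d Q" unfolding bqf_dvd_def by blast
next
  assume "bqf_dvd d Q"
  then obtain R where "Q = bqf_scale d R" unfolding bqf_dvd_def by blast
  thus "bqf_dvd d (bqf_act Q A)" unfolding bqf_dvd_def using bqf_act_scale by blast
qed

lemma transporter_scale: "d \<noteq> 0 \<Longrightarrow> transporter l (bqf_scale d Q) (bqf_scale d R) = transporter l Q R"
  by (simp add: transporter_def bqf_act_scale bqf_scale_inject)

text \<open>Multiplication by d commutes with the action and preserves transporters; its image
  consists of the forms of discriminant n d^2 divisible by d. The weights are compared by inserting
  the transporters from d Q to R, since the chosen representatives need not correspond.\<close>

theorem mass_dvd_scale:
  assumes n: "n < 0" and d: "d > 0" and e: "e > 0"
  shows "mass_dvd (d * e) (n * d\<^sup>2) = mass_dvd e n"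
proof -
  have nd: "n * d\<^sup>2 < 0" using n d by (simp add: mult_neg_pos)
  define ind where "ind = (\<lambda>Q. if bqf_dvd e Q then 1 else 0 :: real)"
  have scale_dvd: "bqf_dvd (d * e) (bqf_scale d Q) \<longleftrightarrow> bqf_dvd e Q" for Q
    using d by (simp add: bqf_dvd_def bqf_scale_scale[symmetric] bqf_scale_inject)
  have "mass_dvd e n = class_sum 1 n (\<lambda>Q. class_sum 1 (n * d\<^sup>2) (\<lambda>R. ind Q * real (card (transporter 1 (bqf_scale d Q) R))))"
    unfolding mass_dvd_def
    by (intro class_sum_cong)
       (use nd in \<open>simp add: class_sum_cmult transporter_class_sum bqf_level_1_iff bqf_disc_scale ind_def mult.commute\<close>)
  also have "\<dots> = class_sum 1 (n * d\<^sup>2) (\<lambda>R. class_sum 1 n (\<lambda>Q. ind Q * real (card (transporter 1 (bqf_scale d Q) R))))"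
    by (rule class_sum_swap)
  also have "\<dots> = class_sum 1 (n * d\<^sup>2) (\<lambda>R. if bqf_dvd (d * e) R then 1 else 0)"
  proof (rule class_sum_cong)
    fix R assume "R \<in> bqf_level 1 (n * d\<^sup>2)"
    hence R: "bqf_disc R = n * d\<^sup>2" by (simp add: bqf_level_1_iff)
    show "class_sum 1 n (\<lambda>Q. ind Q * real (card (transporter 1 (bqf_scale d Q) R))) = (if bqf_dvd (d * e) R then 1 else 0)"
    proof (cases "bqf_dvd d R")
      case True
      then obtain S where S: "R = bqf_scale d S" unfolding bqf_dvd_def by blast
      have Sn: "S \<in> bqf_level 1 n" using R d by (simp add: S bqf_disc_scale bqf_level_1_iff mult.commute)
      have "ind Q * real (card (transporter 1 (bqf_scale d Q) R)) = ind S * real (card (transporter 1 S Q))" for Q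
      proof (cases "transporter 1 Q S = {}")
        case True
        hence "card (transporter 1 S Q) = 0" using card_transporter_commute[of 1 S Q] by simp
        thus ?thesis using True d by (simp add: S transporter_scale)
      next
        case False
        then obtain A where "det A = 1" "bqf_act Q A = S" by (auto simp: transporter_def Gamma0_def)
        hence "ind S = ind Q" using bqf_dvd_act[of A e Q] by (auto simp: ind_def)
        thus ?thesis using d by (simp add: S transporter_scale card_transporter_commute[of 1 S Q])
      qed
      hence "class_sum 1 n (\<lambda>Q. ind Q * real (card (transporter 1 (bqf_scale d Q) R))) = ind S"
        using transporter_class_sum[OF Sn n] by (simp add: class_sum_cmult)
      thus ?thesis by (simp add: ind_def S scale_dvd)
    next
      case False
      have "transporter 1 (bqf_scale d Q) R = {}" for Q
        using False bqf_act_scale unfolding transporter_def bqf_dvd_def by blast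
      moreover have "\<not> bqf_dvd (d * e) R" using False unfolding bqf_dvd_def bqf_scale_scale[symmetric] by blast
      ultimately show ?thesis by (simp add: class_sum_def)
    qed
  qed
  finally show ?thesis by (simp add: mass_dvd_def)
qed

lemma bqf_dvd_1 [simp]: "bqf_dvd 1 Q"
  unfolding bqf_dvd_def by (rule exI[of _ Q]) simp

lemma mass_dvd_1: "mass_dvd 1 n = mass n"
  by (simp add: mass_dvd_def mass_def)

section \<open>Counting the sublattices on which a form becomes divisible\<close>

lemma ex_level_scale_iff:
  assumes "bqf_disc X = d\<^sup>2 * n" "d \<noteq> 0"
  shows "(\<exists>R\<in>bqf_level 1 n. X = bqf_scale d R) \<longleftrightarrow> bqf_dvd d X"
proof
  assume "bqf_dvd d X"
  then obtain R where R: "X = bqf_scale d R" unfolding bqf_dvd_def by blast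
  hence "bqf_disc R = n" using assms by (simp add: bqf_disc_scale)
  thus "\<exists>R\<in>bqf_level 1 n. X = bqf_scale d R" using R bqf_level_1_iff by blast
qed (auto simp: bqf_dvd_def)

text \<open>By \<open>bqf_act_line_mats\<close> the second and third coefficients of the transformed
  form carry the factors q and q^2, so divisibility by q concerns only the first, which is the value
  of Q at the line.\<close>

lemma valid_line_iff:
  assumes "bqf_disc Q = n" "q > 0"
  shows "(\<exists>R\<in>bqf_level 1 n. bqf_act Q (mat22 1 0 j (int q)) = bqf_scale (int q) R) \<longleftrightarrow>
      int q dvd bqf_eval Q 1 j"
    "(\<exists>R\<in>bqf_level 1 n. bqf_act Q (mat22 0 (- int q) 1 0) = bqf_scale (int q) R) \<longleftrightarrow>
      int q dvd bqf_eval Q 0 1"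
proof -
  obtain a b c where abc: "Q = (a, b, c)" by (cases Q)
  have disc: "bqf_disc (bqf_act Q M) = (int q)\<^sup>2 * n" if "det M = int q" for M
    using that assms(1) by (simp add: bqf_disc_act)
  show "(\<exists>R\<in>bqf_level 1 n. bqf_act Q (mat22 1 0 j (int q)) = bqf_scale (int q) R) \<longleftrightarrow>
      int q dvd bqf_eval Q 1 j"
    using ex_level_scale_iff[OF disc[of "mat22 1 0 j (int q)"]] assms(2)
    by (simp add: abc bqf_act_line_mats bqf_dvd_iff bqf_eval.simps power2_eq_square)
  show "(\<exists>R\<in>bqf_level 1 n. bqf_act Q (mat22 0 (- int q) 1 0) = bqf_scale (int q) R) \<longleftrightarrow>
      int q dvd bqf_eval Q 0 1"
    using ex_level_scale_iff[OF disc[of "mat22 0 (- int q) 1 0"]] assms(2)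
    by (simp add: abc bqf_act_line_mats bqf_dvd_iff bqf_eval.simps power2_eq_square)
qed

lemma count_valid_lines:
  assumes "bqf_disc Q = n" "q > 0"
  shows "(\<Sum>\<tau> | \<tau> \<in> line_mats (int q) q \<and>
      (\<exists>R\<in>bqf_level 1 n. bqf_act Q \<tau> = bqf_scale (int q) R). 1) = real (num_roots q Q)"
  unfolding sum_line_mats valid_line_iff[OF assms] num_roots_def by simp

lemma mod_4_count:
  fixes A C K :: int
  assumes "A \<in> {0, 1, 2, 3}" "C \<in> {0, 1, 2, 3}" "K \<in> {0, 1, 2, 3}"
    "(K * K - A * C) mod 4 = 0 \<or> (K * K - A * C) mod 4 = 1" "\<not> (even A \<and> even C)"
  shows "(if A = 0 then 1 else 0) + (if (A + 2 * K + C) mod 4 = 0 then 1 else 0) + (if C = 0 then 1 else 0) = (1 :: nat)"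
  using assms by (elim insertE emptyE) simp_all

text \<open>The case q = 2, where completing the square fails. With b = 2 k one has k^2 - a c = n,
  and everything depends on a, k, c modulo 4; here the congruence condition on n enters.\<close>

lemma even_primitive_square_root:
  fixes a b c n :: int
  assumes "b\<^sup>2 - 4 * a * c = n * 4" "n mod 4 = 0 \<or> n mod 4 = 1" "\<not> (even a \<and> even c)"
  shows "(if 4 dvd a then 1 else 0) + (if 4 dvd a + b + c then 1 else 0) + (if 4 dvd c then 1 else 0) = (1 :: nat)"
proof -
  have "b\<^sup>2 = 2 * (2 * n + 2 * (a * c))" using assms(1) by simp
  hence "even (b\<^sup>2)" by simp
  hence "even b" by simp
  then obtain k where k: "b = 2 * k" by blast
  have kn: "k * k - a * c = n" using assms(1) by (simp add: k power2_eq_square)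
  have m: "(k mod 4 * (k mod 4) - a mod 4 * (c mod 4)) mod 4 = n mod 4"
    unfolding kn[symmetric] cong_def[symmetric] by (intro cong_diff cong_mult) (simp_all add: cong_def)
  have d: "4 dvd a \<longleftrightarrow> a mod 4 = 0" "4 dvd c \<longleftrightarrow> c mod 4 = 0"
    "4 dvd a + b + c \<longleftrightarrow> (a mod 4 + 2 * (k mod 4) + c mod 4) mod 4 = 0"
    unfolding k by presburger+
  have e: "even a \<longleftrightarrow> even (a mod 4)" "even c \<longleftrightarrow> even (c mod 4)" by presburger+
  have "a mod 4 \<in> {0, 1, 2, 3}" "c mod 4 \<in> {0, 1, 2, 3}" "k mod 4 \<in> {0, 1, 2, 3}"
    using pos_mod_bound[of 4 a] pos_mod_sign[of 4 a] pos_mod_bound[of 4 c] pos_mod_sign[of 4 c]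
      pos_mod_bound[of 4 k] pos_mod_sign[of 4 k] by auto
  moreover have "\<not> (even (a mod 4) \<and> even (c mod 4))" using assms(3) e by blast
  moreover have "(k mod 4 * (k mod 4) - a mod 4 * (c mod 4)) mod 4 = 0 \<or>
      (k mod 4 * (k mod 4) - a mod 4 * (c mod 4)) mod 4 = 1" using m assms(2) by simp
  ultimately show ?thesis unfolding d by (intro mod_4_count)
qed

text \<open>Modulo q such a form is a multiple of the square of a linear form and has one double
  root. For odd q, the identity 4 c Q(1, j) = (b + 2 c j)^2 - n q^2 shows that the value there is
  even divisible by q^2; if q divides c, the root is at infinity.\<close>

lemma count_square_lines_primitive:
  assumes q: "prime q" and n4: "n mod 4 = 0 \<or> n mod 4 = 1"
    and disc: "b\<^sup>2 - 4 * a * c = n * (int q)\<^sup>2" and prim: "\<not> (int q dvd a \<and> int q dvd b \<and> int q dvd c)"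
  shows "card {j \<in> {0..<int q}. (int q)\<^sup>2 dvd a + b * j + c * j\<^sup>2 \<and> int q dvd b + 2 * c * j} +
     (if (int q)\<^sup>2 dvd c \<and> int q dvd b then 1 else 0) = 1"
proof (cases "q = 2")
  case True
  have d: "b\<^sup>2 - 4 * a * c = n * 4" using disc True by simp
  hence "b\<^sup>2 = 2 * (2 * n + 2 * (a * c))" by simp
  hence "even (b\<^sup>2)" by simp
  hence b: "even b" by simp
  have "{0..<2::int} = {0, 1}" by auto
  hence "{j \<in> {0..<2::int}. 4 dvd a + b * j + c * j\<^sup>2 \<and> even (b + 2 * c * j)} =
      (if 4 dvd a then {0} else {}) \<union> (if 4 dvd a + b + c then {1} else {})" using b by auto
  hence "card {j \<in> {0..<int q}. (int q)\<^sup>2 dvd a + b * j + c * j\<^sup>2 \<and> int q dvd b + 2 * c * j} =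
      (if 4 dvd a then 1 else 0) + (if 4 dvd a + b + c then 1 else 0)"
    unfolding True by simp
  moreover have "(int q)\<^sup>2 dvd c \<and> int q dvd b \<longleftrightarrow> 4 dvd c" using b True by simp
  moreover have "\<not> (even a \<and> even c)" using prim b True by simp
  ultimately show ?thesis using even_primitive_square_root[OF d n4] by presburger
next
  case False
  hence q2: "q > 2" using prime_ge_2_nat[OF q] by simp
  have n2: "\<not> int q dvd 2" using q2 zdvd_imp_le[of "int q" 2] by auto
  have pq: "prime (int q)" using q by simp
  have n4: "\<not> int q dvd 4" using n2 prime_dvd_multD[OF pq, of 2 2] by auto
  show ?thesis
  proof (cases "int q dvd c")
    case qc: False
    have u: "\<not> int q dvd 2 * c" using qc n2 pq by (simp add: prime_dvd_mult_iff)
    obtain j where j: "j \<in> {0..<int q}" "int q dvd - b - j * (2 * c)"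
      using ex_residue_quotient[OF q u] by blast
    have "{j \<in> {0..<int q}. (int q)\<^sup>2 dvd a + b * j + c * j\<^sup>2 \<and> int q dvd b + 2 * c * j} = {j}"
    proof (intro equalityI subsetI)
      fix i assume i: "i \<in> {j \<in> {0..<int q}. (int q)\<^sup>2 dvd a + b * j + c * j\<^sup>2 \<and> int q dvd b + 2 * c * j}"
      hence "int q dvd b + 2 * c * i" by blast
      from dvd_add[OF this j(2)] have "int q dvd 2 * c * (i - j)" by (simp add: algebra_simps)
      hence "int q dvd i - j" using u pq prime_dvd_multD by blast
      thus "i \<in> {j}" using i j residue_unique by blast
    next
      fix i assume "i \<in> {j}"
      hence ij: "i = j" by simp
      have "int q dvd - (- b - j * (2 * c))" using j(2) by (simp only: dvd_minus_iff)
      also have "- (- b - j * (2 * c)) = b + 2 * c * j" by simp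
      finally have d1: "int q dvd b + 2 * c * j" .
      then obtain w where w: "b + 2 * c * j = int q * w" by blast
      have "4 * c * (a + b * j + c * j\<^sup>2) = (b + 2 * c * j)\<^sup>2 - (b\<^sup>2 - 4 * a * c)"
        by (simp add: power2_eq_square algebra_simps)
      also have "\<dots> = (int q)\<^sup>2 * (w\<^sup>2 - n)" unfolding w disc by (simp add: power_mult_distrib algebra_simps)
      finally have "(int q)\<^sup>2 dvd 4 * c * (a + b * j + c * j\<^sup>2)" by simp
      moreover have "coprime ((int q)\<^sup>2) (4 * c)"
        using pq n4 qc by (simp add: prime_imp_coprime)
      ultimately have "(int q)\<^sup>2 dvd a + b * j + c * j\<^sup>2" using coprime_dvd_mult_right_iff by blast
      thus "i \<in> {j \<in> {0..<int q}. (int q)\<^sup>2 dvd a + b * j + c * j\<^sup>2 \<and> int q dvd b + 2 * c * j}"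
        using ij j d1 by blast
    qed
    moreover have "\<not> (int q)\<^sup>2 dvd c" using qc by (metis dvd_trans dvd_triv_left power2_eq_square)
    ultimately show ?thesis by (simp only:) simp
  next
    case qc: True
    have "b\<^sup>2 = n * (int q)\<^sup>2 + 4 * a * c" using disc by simp
    hence "int q dvd b\<^sup>2" using qc by (simp add: power2_eq_square)
    hence qb: "int q dvd b" using pq prime_dvd_power by blast
    hence qa: "\<not> int q dvd a" using prim qc by blast
    have "\<not> (int q)\<^sup>2 dvd a + b * j + c * j\<^sup>2" for j
    proof
      assume "(int q)\<^sup>2 dvd a + b * j + c * j\<^sup>2"
      hence "int q dvd a + (b * j + c * j\<^sup>2)" by (metis dvd_trans dvd_triv_left power2_eq_square add.assoc)
      moreover have "int q dvd b * j + c * j\<^sup>2" using qb qc by simp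
      ultimately show False using qa by (simp add: dvd_add_left_iff)
    qed
    hence e: "{j \<in> {0..<int q}. (int q)\<^sup>2 dvd a + b * j + c * j\<^sup>2 \<and> int q dvd b + 2 * c * j} = {}" by blast
    have "(int q)\<^sup>2 dvd b\<^sup>2" using qb by (simp add: dvd_power_same)
    hence "(int q)\<^sup>2 dvd b\<^sup>2 - n * (int q)\<^sup>2" by (intro dvd_diff dvd_triv_right)
    also have "b\<^sup>2 - n * (int q)\<^sup>2 = 4 * a * c" using disc by simp
    finally have "(int q)\<^sup>2 dvd 4 * a * c" .
    moreover have "coprime ((int q)\<^sup>2) (4 * a)" using pq n4 qa by (simp add: prime_imp_coprime)
    ultimately have "(int q)\<^sup>2 dvd c" using coprime_dvd_mult_right_iff by blast
    thus ?thesis using qb unfolding e by simp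
  qed
qed

text \<open>If R = q S, the two divisibility conditions at a line collapse to q dividing the value
  of S there, and the roots of S are counted. Otherwise the double root gives exactly one
  line.\<close>

lemma count_square_lines:
  assumes q: "prime q" and n4: "n mod 4 = 0 \<or> n mod 4 = 1" and R: "bqf_disc R = n * (int q)\<^sup>2"
  shows "(\<Sum>\<tau> | \<tau> \<in> line_mats (int q) q \<and>
      (\<exists>Q\<in>bqf_level 1 n. bqf_act R \<tau> = bqf_scale ((int q)\<^sup>2) Q). 1) =
    (if \<not> bqf_dvd (int q) R then 1 else if bqf_dvd (int q * int q) R then real q + 1
     else 1 + of_int (kronecker_prime n q))"
proof -
  have q0: "q > 0" using prime_gt_0_nat[OF q] .
  obtain a b c where abc: "R = (a, b, c)" by (cases R)
  have valid: "(\<exists>Q\<in>bqf_level 1 n. bqf_act R \<tau> = bqf_scale ((int q)\<^sup>2) Q) \<longleftrightarrow> bqf_dvd ((int q)\<^sup>2) (bqf_act R \<tau>)"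
    if "det \<tau> = int q" for \<tau>
    using q0 that R by (intro ex_level_scale_iff) (auto simp: bqf_disc_act power2_eq_square)
  have v1: "(\<exists>Q\<in>bqf_level 1 n. bqf_act R (mat22 1 0 j (int q)) = bqf_scale ((int q)\<^sup>2) Q) \<longleftrightarrow>
      (int q)\<^sup>2 dvd a + b * j + c * j\<^sup>2 \<and> int q dvd b + 2 * c * j" for j
    using valid[of "mat22 1 0 j (int q)"] q0 by (simp add: abc bqf_act_line_mats bqf_dvd_iff power2_eq_square)
  have v2: "(\<exists>Q\<in>bqf_level 1 n. bqf_act R (mat22 0 (- int q) 1 0) = bqf_scale ((int q)\<^sup>2) Q) \<longleftrightarrow>
      (int q)\<^sup>2 dvd c \<and> int q dvd b"
    using valid[of "mat22 0 (- int q) 1 0"] q0 by (simp add: abc bqf_act_line_mats bqf_dvd_iff power2_eq_square)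
  have count: "(\<Sum>\<tau> | \<tau> \<in> line_mats (int q) q \<and>
      (\<exists>Q\<in>bqf_level 1 n. bqf_act R \<tau> = bqf_scale ((int q)\<^sup>2) Q). 1) =
    real (card {j \<in> {0..<int q}. (int q)\<^sup>2 dvd a + b * j + c * j\<^sup>2 \<and> int q dvd b + 2 * c * j} +
     (if (int q)\<^sup>2 dvd c \<and> int q dvd b then 1 else 0))"
    unfolding sum_line_mats v1 v2 by simp
  show ?thesis
  proof (cases "bqf_dvd (int q) R")
    case False
    hence "\<not> (int q dvd a \<and> int q dvd b \<and> int q dvd c)" by (simp add: abc bqf_dvd_iff)
    moreover have "b\<^sup>2 - 4 * a * c = n * (int q)\<^sup>2" using R by (simp add: abc)
    ultimately show ?thesis unfolding count using False count_square_lines_primitive[OF q n4] by simp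
  next
    case True
    then obtain S where S: "R = bqf_scale (int q) S" unfolding bqf_dvd_def by blast
    obtain x y z where xyz: "S = (x, y, z)" by (cases S)
    have abc': "a = int q * x" "b = int q * y" "c = int q * z" using S by (simp_all add: abc xyz)
    have "a + b * j + c * j\<^sup>2 = int q * (x + y * j + z * j\<^sup>2)" for j by (simp add: abc' algebra_simps)
    hence c1: "(int q)\<^sup>2 dvd a + b * j + c * j\<^sup>2 \<and> int q dvd b + 2 * c * j \<longleftrightarrow> int q dvd bqf_eval S 1 j" for j
      using q0 by (simp add: abc' xyz power2_eq_square bqf_eval.simps)
    have c2: "(int q)\<^sup>2 dvd c \<and> int q dvd b \<longleftrightarrow> int q dvd bqf_eval S 0 1"
      using q0 by (simp add: abc' xyz power2_eq_square bqf_eval.simps)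
    have dS: "bqf_disc S = n" using R q0 by (simp add: S bqf_disc_scale)
    have dvd2: "bqf_dvd (int q * int q) R \<longleftrightarrow> bqf_dvd (int q) S"
      using q0 by (simp add: abc abc' xyz bqf_dvd_iff)
    have "real (num_roots q S) = (if bqf_dvd (int q) S then real q + 1 else 1 + of_int (kronecker_prime n q))"
    proof (cases "bqf_dvd (int q) S")
      case False
      have "real (num_roots q S) = of_int (int (num_roots q S))" by simp
      thus ?thesis using num_roots_primitive[OF q False] False dS by simp
    qed (simp add: num_roots_imprimitive)
    thus ?thesis unfolding count c1 c2 dvd2 using True by (simp add: num_roots_def)
  qed
qed

lemma class_sum_diff: "class_sum l n (\<lambda>Q. f Q - g Q) = class_sum l n f - class_sum l n g"
  by (simp add: class_sum_def diff_divide_distrib sum_subtractf)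

text \<open>The forms R in \<open>hecke_mass\<close> are split into those not divisible by q, those
  divisible by q but not by q^2, and the rest, with the line counts of
  \<open>count_square_lines\<close>. Scaling moves the masses of the divisible ones down to
  discriminant n.\<close>

theorem mass_step:
  assumes q: "prime q" and n: "n < 0" and n4: "n mod 4 = 0 \<or> n mod 4 = 1"
  shows "(real q + 1) * mass n = mass (n * (int q)\<^sup>2) - mass n +
    (1 + of_int (kronecker_prime n q)) * (mass n - mass_dvd (int q) n) + (real q + 1) * mass_dvd (int q) n"
proof -
  have q0: "int q > 0" using prime_gt_0_nat[OF q] by simp
  define k :: real where "k = 1 + of_int (kronecker_prime n q)"
  define i1 where "i1 = (\<lambda>R. if bqf_dvd (int q) R then 1 else 0 :: real)"
  define i2 where "i2 = (\<lambda>R. if bqf_dvd (int q * int q) R then 1 else 0 :: real)"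
  have imp: "bqf_dvd (int q) R" if "bqf_dvd (int q * int q) R" for R
    using that unfolding bqf_dvd_def bqf_scale_scale[symmetric] by blast
  have "(real q + 1) * mass n = class_sum 1 (n * (int q)\<^sup>2)
      (\<lambda>R. 1 - i1 R + k * (i1 R - i2 R) + (real q + 1) * i2 R)"
    unfolding hecke_mass[OF q n]
  proof (rule class_sum_cong)
    fix R assume "R \<in> bqf_level 1 (n * (int q)\<^sup>2)"
    hence "bqf_disc R = n * (int q)\<^sup>2" by (simp add: bqf_level_1_iff)
    from count_square_lines[OF q n4 this] imp[of R]
    show "(\<Sum>\<tau> | \<tau> \<in> line_mats (int q) q \<and>
      (\<exists>Q\<in>bqf_level 1 n. bqf_act R \<tau> = bqf_scale ((int q)\<^sup>2) Q). 1) =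
      1 - i1 R + k * (i1 R - i2 R) + (real q + 1) * i2 R"
      by (auto simp: i1_def i2_def k_def)
  qed
  also have "\<dots> = mass (n * (int q)\<^sup>2) - mass_dvd (int q) (n * (int q)\<^sup>2) +
      k * (mass_dvd (int q) (n * (int q)\<^sup>2) - mass_dvd (int q * int q) (n * (int q)\<^sup>2)) +
      (real q + 1) * mass_dvd (int q * int q) (n * (int q)\<^sup>2)"
    unfolding class_sum_add class_sum_cmult class_sum_diff i1_def i2_def mass_def mass_dvd_def ..
  also have "mass_dvd (int q) (n * (int q)\<^sup>2) = mass n"
    using mass_dvd_scale[OF n q0, of 1] by (simp add: mass_dvd_1)
  also have "mass_dvd (int q * int q) (n * (int q)\<^sup>2) = mass_dvd (int q) n"
    by (rule mass_dvd_scale[OF n q0 q0])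
  finally show ?thesis by (simp add: k_def)
qed

lemma num_roots_eq:
  assumes "prime p" "bqf_disc Q = n"
  shows "real (num_roots p Q) = (1 + of_int (kronecker_prime n p)) * (1 - (if bqf_dvd (int p) Q then 1 else 0)) +
    (real p + 1) * (if bqf_dvd (int p) Q then 1 else 0)"
proof (cases "bqf_dvd (int p) Q")
  case False
  have "real (num_roots p Q) = of_int (int (num_roots p Q))" by simp
  thus ?thesis using num_roots_primitive[OF assms(1) False] False assms(2) by simp
qed (simp add: num_roots_imprimitive)

theorem level_mass:
  assumes p: "prime p" and n: "n < 0"
  shows "class_sum p n (\<lambda>_. 1) =
    (1 + of_int (kronecker_prime n p)) * (mass n - mass_dvd (int p) n) + (real p + 1) * mass_dvd (int p) n"
proof -
  have "class_sum p n (\<lambda>_. 1) = class_sum 1 n (\<lambda>Q.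
    (1 + of_int (kronecker_prime n p)) * (1 - (if bqf_dvd (int p) Q then 1 else 0)) +
    (real p + 1) * (if bqf_dvd (int p) Q then 1 else 0))"
    unfolding level_mass_eq[OF p n]
    by (rule class_sum_cong) (simp add: num_roots_eq[OF p] bqf_level_1_iff)
  thus ?thesis unfolding class_sum_add class_sum_cmult class_sum_diff mass_def mass_dvd_def .
qed

section \<open>Representation numbers\<close>

lemma finite_reps:
  assumes "bqf_disc Q < 0"
  shows "finite {v :: int \<times> int. \<bar>bqf_eval Q (fst v) (snd v)\<bar> = N}"
proof -
  obtain a b c where abc: "Q = (a, b, c)" by (cases Q)
  have d: "1 \<le> 4 * a * c - b\<^sup>2" using assms by (simp add: abc)
  have sq: "\<bar>z\<bar> \<le> z\<^sup>2" for z :: int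
  proof (cases "z = 0")
    case False
    hence "\<bar>z\<bar> * 1 \<le> \<bar>z\<bar> * \<bar>z\<bar>" by (intro mult_left_mono) auto
    thus ?thesis by (simp add: power2_eq_square)
  qed simp
  define B where "B = 4 * (\<bar>a\<bar> + \<bar>c\<bar>) * N"
  have "{v :: int \<times> int. \<bar>bqf_eval Q (fst v) (snd v)\<bar> = N} \<subseteq> {-B..B} \<times> {-B..B}"
  proof
    fix v :: "int \<times> int" assume "v \<in> {v. \<bar>bqf_eval Q (fst v) (snd v)\<bar> = N}"
    then obtain x y where v: "v = (x, y)" "\<bar>bqf_eval Q x y\<bar> = N" by (cases v) auto
    have N0: "N \<ge> 0" using v by auto
    have id1: "4 * a * bqf_eval Q x y = (2 * a * x + b * y)\<^sup>2 + (4 * a * c - b\<^sup>2) * y\<^sup>2"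
      and id2: "4 * c * bqf_eval Q x y = (2 * c * y + b * x)\<^sup>2 + (4 * a * c - b\<^sup>2) * x\<^sup>2"
      by (simp_all add: abc bqf_eval.simps power2_eq_square algebra_simps)
    have "1 * y\<^sup>2 \<le> (4 * a * c - b\<^sup>2) * y\<^sup>2" "1 * x\<^sup>2 \<le> (4 * a * c - b\<^sup>2) * x\<^sup>2"
      using d by (intro mult_right_mono; simp)+
    hence "y\<^sup>2 \<le> 4 * a * bqf_eval Q x y" "x\<^sup>2 \<le> 4 * c * bqf_eval Q x y"
      using id1 id2 zero_le_power2[of "2 * a * x + b * y"] zero_le_power2[of "2 * c * y + b * x"] by linarith+
    moreover have "4 * a * bqf_eval Q x y \<le> 4 * \<bar>a\<bar> * N" "4 * c * bqf_eval Q x y \<le> 4 * \<bar>c\<bar> * N"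
      using abs_ge_self[of "4 * a * bqf_eval Q x y"] abs_ge_self[of "4 * c * bqf_eval Q x y"] v(2)
      by (simp_all add: abs_mult)
    moreover have "4 * \<bar>a\<bar> * N \<le> B" "4 * \<bar>c\<bar> * N \<le> B" using N0 by (simp_all add: B_def algebra_simps)
    ultimately have "\<bar>y\<bar> \<le> B" "\<bar>x\<bar> \<le> B" using sq[of y] sq[of x] by linarith+
    thus "v \<in> {-B..B} \<times> {-B..B}" by (auto simp: v)
  qed
  thus ?thesis by (rule finite_subset) simp
qed

section \<open>Representation numbers on sublattices of index q\<close>

lemma num_reps_line:
  assumes "q > 0"
  shows "num_reps N (bqf_act Q (mat22 1 0 j (int q))) =
      card {v :: int \<times> int. \<bar>bqf_eval Q (fst v) (snd v)\<bar> = int N \<and> int q dvd snd v - j * fst v}"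
    "num_reps N (bqf_act Q (mat22 0 (- int q) 1 0)) =
      card {v :: int \<times> int. \<bar>bqf_eval Q (fst v) (snd v)\<bar> = int N \<and> int q dvd fst v}"
proof -
  show "num_reps N (bqf_act Q (mat22 1 0 j (int q))) =
      card {v :: int \<times> int. \<bar>bqf_eval Q (fst v) (snd v)\<bar> = int N \<and> int q dvd snd v - j * fst v}"
    unfolding num_reps_def
  proof (rule bij_betw_same_card[where f = "\<lambda>v. (fst v, j * fst v + int q * snd v)"],
      rule bij_betw_byWitness[where f' = "\<lambda>v. (fst v, (snd v - j * fst v) div int q)"])
  qed (use assms in \<open>auto simp: bqf_eval_act\<close>)
  show "num_reps N (bqf_act Q (mat22 0 (- int q) 1 0)) =
      card {v :: int \<times> int. \<bar>bqf_eval Q (fst v) (snd v)\<bar> = int N \<and> int q dvd fst v}"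
    unfolding num_reps_def
  proof (rule bij_betw_same_card[where f = "\<lambda>v. (- int q * snd v, fst v)"],
      rule bij_betw_byWitness[where f' = "\<lambda>v. (snd v, (- fst v) div int q)"])
  qed (use assms in \<open>auto simp: bqf_eval_act\<close>)
qed

lemma bqf_eval_homogeneous: "bqf_eval Q (k * x) (k * y) = k\<^sup>2 * bqf_eval Q x y"
  by (cases Q) (simp add: bqf_eval.simps power2_eq_square algebra_simps)

lemma card_imprimitive_reps:
  assumes "q > 0"
  shows "card {v :: int \<times> int. \<bar>bqf_eval Q (fst v) (snd v)\<bar> = int (q * N) \<and> int q dvd fst v \<and> int q dvd snd v} =
    (if q dvd N then num_reps (N div q) Q else 0)"
proof -
  have eq: "\<bar>bqf_eval Q (int q * x) (int q * y)\<bar> = int (q * N) \<longleftrightarrow> int q * \<bar>bqf_eval Q x y\<bar> = int N" for x y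
    using assms by (simp add: bqf_eval_homogeneous abs_mult power2_eq_square)
  show ?thesis
  proof (cases "q dvd N")
    case True
    then obtain m where m: "N = q * m" by blast
    have "num_reps m Q = card {v :: int \<times> int. \<bar>bqf_eval Q (fst v) (snd v)\<bar> = int (q * N) \<and> int q dvd fst v \<and> int q dvd snd v}"
      unfolding num_reps_def
    proof (rule bij_betw_same_card[where f = "\<lambda>v. (int q * fst v, int q * snd v)"],
        rule bij_betw_byWitness[where f' = "\<lambda>v. (fst v div int q, snd v div int q)"])
      show "(\<lambda>v. (fst v div int q, snd v div int q)) `
        {v. \<bar>bqf_eval Q (fst v) (snd v)\<bar> = int (q * N) \<and> int q dvd fst v \<and> int q dvd snd v} \<subseteq>
        {v. \<bar>bqf_eval Q (fst v) (snd v)\<bar> = int m}"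
      proof (rule image_subsetI)
        fix v assume v: "v \<in> {v. \<bar>bqf_eval Q (fst v) (snd v)\<bar> = int (q * N) \<and> int q dvd fst v \<and> int q dvd snd v}"
        hence "\<bar>bqf_eval Q (int q * (fst v div int q)) (int q * (snd v div int q))\<bar> = int (q * N)" by simp
        hence "int q * \<bar>bqf_eval Q (fst v div int q) (snd v div int q)\<bar> = int N" unfolding eq .
        thus "(fst v div int q, snd v div int q) \<in> {v. \<bar>bqf_eval Q (fst v) (snd v)\<bar> = int m}"
          using assms by (simp add: m)
      qed
      show "(\<lambda>v. (int q * fst v, int q * snd v)) ` {v. \<bar>bqf_eval Q (fst v) (snd v)\<bar> = int m} \<subseteq>
        {v. \<bar>bqf_eval Q (fst v) (snd v)\<bar> = int (q * N) \<and> int q dvd fst v \<and> int q dvd snd v}"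
        using eq m by auto
    qed (use assms in auto)
    thus ?thesis using True m assms by simp
  next
    case False
    have "{v :: int \<times> int. \<bar>bqf_eval Q (fst v) (snd v)\<bar> = int (q * N) \<and> int q dvd fst v \<and> int q dvd snd v} = {}"
    proof (rule ccontr)
      assume "{v :: int \<times> int. \<bar>bqf_eval Q (fst v) (snd v)\<bar> = int (q * N) \<and> int q dvd fst v \<and> int q dvd snd v} \<noteq> {}"
      then obtain x y where "\<bar>bqf_eval Q (int q * x) (int q * y)\<bar> = int (q * N)" by (auto elim!: dvdE)
      hence "int q dvd int N" unfolding eq by (metis dvd_triv_left)
      thus False using False by simp
    qed
    thus ?thesis using False by (simp only: card.empty if_False)
  qed
qed

text \<open>A vector outside q Z^2 whose value is divisible by q lies on exactly one line modulo q,
  and that line is a root; a vector in q Z^2 lies on all root lines. Hence the sum exceeds the plain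
  count by \<open>num_roots q Q - 1\<close> times the number of vectors in q Z^2.\<close>

lemma sum_valid_lines_reps:
  assumes q: "prime q" and Q: "bqf_disc Q = n" and n: "n < 0"
  shows "(\<Sum>\<tau> | \<tau> \<in> line_mats (int q) q \<and>
      (\<exists>R\<in>bqf_level 1 n. bqf_act Q \<tau> = bqf_scale (int q) R). real (num_reps (q * N) (bqf_act Q \<tau>))) =
    real (num_reps (q * N) Q) + (real (num_roots q Q) - 1) * (if q dvd N then num_reps (N div q) Q else 0)"
proof -
  have q0: "q > 0" using prime_gt_0_nat[OF q] .
  have pq: "prime (int q)" using q by simp
  obtain a b c where abc: "Q = (a, b, c)" by (cases Q)
  define V where "V = {v :: int \<times> int. \<bar>bqf_eval Q (fst v) (snd v)\<bar> = int (q * N)}"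
  define V0 where "V0 = {v \<in> V. int q dvd fst v \<and> int q dvd snd v}"
  define V1 where "V1 = V - V0"
  have fV: "finite V" unfolding V_def using finite_reps Q n by simp
  have fV1: "finite V1" and fV0: "finite V0" using fV by (auto simp: V1_def V0_def)
  define J where "J = {j \<in> {0..<int q}. int q dvd bqf_eval Q 1 j}"
  have fJ: "finite J" unfolding J_def by (rule finite_subset[of _ "{0..<int q}"]) auto
  have roots: "num_roots q Q = card J + (if int q dvd bqf_eval Q 0 1 then 1 else 0)"
    unfolding num_roots_def J_def ..
  have line: "{v. \<bar>bqf_eval Q (fst v) (snd v)\<bar> = int (q * N) \<and> int q dvd snd v - j * fst v} =
      V0 \<union> {v \<in> V1. int q dvd snd v - j * fst v}" for j
    by (auto simp: V_def V0_def V1_def)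
  have inf: "{v. \<bar>bqf_eval Q (fst v) (snd v)\<bar> = int (q * N) \<and> int q dvd fst v} =
      V0 \<union> {v \<in> V1. int q dvd fst v}"
    by (auto simp: V_def V0_def V1_def)
  have disj: "V0 \<inter> {v \<in> V1. P v} = {}" for P by (auto simp: V1_def)
  have c1: "card {v. \<bar>bqf_eval Q (fst v) (snd v)\<bar> = int (q * N) \<and> int q dvd snd v - j * fst v} =
      card V0 + card {v \<in> V1. int q dvd snd v - j * fst v}" for j
    unfolding line using fV0 fV1 disj by (intro card_Un_disjoint) auto
  have c2: "card {v. \<bar>bqf_eval Q (fst v) (snd v)\<bar> = int (q * N) \<and> int q dvd fst v} =
      card V0 + card {v \<in> V1. int q dvd fst v}"
    unfolding inf using fV0 fV1 disj by (intro card_Un_disjoint) auto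
  have root: "int q dvd bqf_eval Q x y" if "(x, y) \<in> V" for x y
    using that unfolding V_def by (metis (mono_tags, lifting) dvd_abs_iff dvd_triv_left fst_conv mem_Collect_eq of_nat_mult snd_conv)
  have split: "V1 = (\<Union>j\<in>J. {v \<in> V1. int q dvd snd v - j * fst v}) \<union> {v \<in> V1. int q dvd fst v}"
  proof (intro equalityI subsetI)
    fix v assume v: "v \<in> V1"
    obtain x y where xy: "v = (x, y)" by (cases v)
    show "v \<in> (\<Union>j\<in>J. {v \<in> V1. int q dvd snd v - j * fst v}) \<union> {v \<in> V1. int q dvd fst v}"
    proof (cases "int q dvd x")
      case False
      then obtain j where j: "j \<in> {0..<int q}" "int q dvd y - j * x"
        using ex_residue_quotient[OF q] by blast
      then obtain w where w: "y = j * x + int q * w" by (metis add_diff_cancel_left' diff_add_cancel dvdE add.commute)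
      have "bqf_eval Q x y = x\<^sup>2 * bqf_eval Q 1 j + int q * (b * x * w + 2 * c * j * x * w + c * int q * w\<^sup>2)"
        by (simp add: abc bqf_eval.simps w power2_eq_square algebra_simps)
      moreover have "int q dvd bqf_eval Q x y" using root v xy by (auto simp: V1_def)
      ultimately have "int q dvd x\<^sup>2 * bqf_eval Q 1 j" by (simp add: dvd_add_left_iff)
      hence "int q dvd bqf_eval Q 1 j" using False pq by (auto simp: prime_dvd_mult_iff prime_dvd_power_iff)
      hence "j \<in> J" using j by (simp add: J_def)
      thus ?thesis using v j xy by auto
    qed (use v xy in auto)
  qed auto
  have inf0: "{v \<in> V1. int q dvd fst v} = {}" if "\<not> int q dvd bqf_eval Q 0 1"
  proof (rule ccontr)
    assume "{v \<in> V1. int q dvd fst v} \<noteq> {}"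
    then obtain x y where v: "(x, y) \<in> V1" "int q dvd x" by auto
    then obtain w where w: "x = int q * w" by blast
    have "bqf_eval Q x y = c * y\<^sup>2 + int q * (a * int q * w\<^sup>2 + b * w * y)"
      by (simp add: abc bqf_eval.simps w power2_eq_square algebra_simps)
    moreover have "int q dvd bqf_eval Q x y" using root v by (auto simp: V1_def)
    ultimately have "int q dvd c * y\<^sup>2" by (simp add: dvd_add_left_iff)
    moreover have "\<not> int q dvd y" using v by (auto simp: V1_def V0_def)
    ultimately have "int q dvd c" using pq by (auto simp: prime_dvd_mult_iff prime_dvd_power_iff)
    thus False using that by (simp add: abc bqf_eval.simps)
  qed
  have noinf: "\<not> int q dvd fst v" if "v \<in> V1" "int q dvd snd v - j * fst v" for v j
  proof
    assume f: "int q dvd fst v"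
    hence "int q dvd snd v" using that(2) by (metis dvd_diff_right_iff dvd_mult dvd_mult2 diff_add_cancel dvd_add)
    thus False using that(1) f by (auto simp: V1_def V0_def)
  qed
  have "card V1 = (\<Sum>j\<in>J. card {v \<in> V1. int q dvd snd v - j * fst v}) + card {v \<in> V1. int q dvd fst v}"
  proof -
    have "card V1 = card ((\<Union>j\<in>J. {v \<in> V1. int q dvd snd v - j * fst v}) \<union> {v \<in> V1. int q dvd fst v})"
      using split by simp
    also have "\<dots> = card (\<Union>j\<in>J. {v \<in> V1. int q dvd snd v - j * fst v}) + card {v \<in> V1. int q dvd fst v}"
      using fJ fV1 noinf by (intro card_Un_disjoint) auto
    also have "card (\<Union>j\<in>J. {v \<in> V1. int q dvd snd v - j * fst v}) = (\<Sum>j\<in>J. card {v \<in> V1. int q dvd snd v - j * fst v})"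
    proof (rule card_UN_disjoint)
      show "\<forall>i\<in>J. \<forall>j\<in>J. i \<noteq> j \<longrightarrow> {v \<in> V1. int q dvd snd v - i * fst v} \<inter> {v \<in> V1. int q dvd snd v - j * fst v} = {}"
      proof (intro ballI impI)
        fix i j assume ij: "i \<in> J" "j \<in> J" "i \<noteq> j"
        show "{v \<in> V1. int q dvd snd v - i * fst v} \<inter> {v \<in> V1. int q dvd snd v - j * fst v} = {}"
        proof (rule ccontr)
          assume "{v \<in> V1. int q dvd snd v - i * fst v} \<inter> {v \<in> V1. int q dvd snd v - j * fst v} \<noteq> {}"
          then obtain v where v: "v \<in> V1" "int q dvd snd v - i * fst v" "int q dvd snd v - j * fst v" by auto
          from dvd_diff[OF v(3,2)] have "int q dvd (i - j) * fst v" by (simp add: algebra_simps)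
          hence "int q dvd i - j" using noinf[OF v(1,2)] pq by (simp add: prime_dvd_mult_iff)
          thus False using ij residue_unique[of i q j] by (simp add: J_def)
        qed
      qed
    qed (use fJ fV1 in auto)
    finally show ?thesis .
  qed
  moreover have "card V = card V0 + card V1"
    unfolding V1_def using fV by (subst card_Diff_subset) (auto simp: V0_def card_mono)
  moreover have "num_reps (q * N) Q = card V" by (simp add: num_reps_def V_def)
  ultimately have total: "real (num_reps (q * N) Q) = real (card V0) +
      (\<Sum>j\<in>J. real (card {v \<in> V1. int q dvd snd v - j * fst v})) + real (card {v \<in> V1. int q dvd fst v})"
    by simp
  have "(\<Sum>\<tau> | \<tau> \<in> line_mats (int q) q \<and>
      (\<exists>R\<in>bqf_level 1 n. bqf_act Q \<tau> = bqf_scale (int q) R). real (num_reps (q * N) (bqf_act Q \<tau>))) =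
    (\<Sum>j\<in>J. real (card V0) + real (card {v \<in> V1. int q dvd snd v - j * fst v})) +
    (if int q dvd bqf_eval Q 0 1 then real (card V0) + real (card {v \<in> V1. int q dvd fst v}) else 0)"
    unfolding sum_line_mats valid_line_iff[OF Q q0] num_reps_line[OF q0] c1 c2 J_def by simp
  also have "\<dots> = real (num_roots q Q) * real (card V0) +
      (\<Sum>j\<in>J. real (card {v \<in> V1. int q dvd snd v - j * fst v})) + real (card {v \<in> V1. int q dvd fst v})"
  proof (cases "int q dvd bqf_eval Q 0 1")
    case True
    thus ?thesis by (simp add: sum.distrib roots algebra_simps)
  next
    case False
    thus ?thesis using inf0[OF False] by (simp only: sum.distrib roots) simp
  qed
  also have "\<dots> = real (num_reps (q * N) Q) + (real (num_roots q Q) - 1) * real (card V0)"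
    unfolding total by (simp add: algebra_simps)
  also have "card V0 = (if q dvd N then num_reps (N div q) Q else 0)"
    unfolding V0_def V_def using card_imprimitive_reps[OF q0, of Q N] by simp
  finally show ?thesis by simp
qed

definition rep_mass :: "int \<Rightarrow> nat \<Rightarrow> real" where
  "rep_mass n N = class_sum 1 n (\<lambda>Q. real (num_reps N Q))"

text \<open>By \<open>prim\<close> every form of discriminant n has the same number 1 + k of roots
  modulo q, so both sides of \<open>hecke_reps\<close> become explicit.\<close>

theorem rep_mass_step:
  assumes q: "prime q" and n: "n < 0" and prim: "\<And>Q. bqf_disc Q = n \<Longrightarrow> \<not> bqf_dvd (int q) Q"
  defines "k \<equiv> of_int (kronecker_prime n q) :: real"
  shows "rep_mass n (q * N) = (1 + k) * rep_mass n N - k * (if q dvd N then rep_mass n (N div q) else 0)"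
proof -
  have q0: "q > 0" using prime_gt_0_nat[OF q] .
  have roots: "real (num_roots q Q) = 1 + k" if "bqf_disc Q = n" for Q
    using num_roots_eq[OF q that] prim[OF that] by (simp add: k_def)
  have "class_sum 1 n (\<lambda>Q. real (num_reps (q * N) Q) + k * real (if q dvd N then num_reps (N div q) Q else 0)) =
      class_sum 1 n (\<lambda>R. (1 + k) * real (num_reps N R))"
  proof -
    have "class_sum 1 n (\<lambda>Q. real (num_reps (q * N) Q) + k * real (if q dvd N then num_reps (N div q) Q else 0)) =
      class_sum 1 n (\<lambda>Q. \<Sum>\<tau> | \<tau> \<in> line_mats (int q) q \<and>
      (\<exists>R\<in>bqf_level 1 n. bqf_act Q \<tau> = bqf_scale (int q) R). real (num_reps (q * N) (bqf_act Q \<tau>)))"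
      by (rule class_sum_cong) (simp only: bqf_level_1_iff sum_valid_lines_reps[OF q _ n] roots add_diff_cancel_left')
    also have "\<dots> = class_sum 1 n (\<lambda>R. real (num_reps N R) * (\<Sum>\<tau> | \<tau> \<in> line_mats (int q) q \<and>
      (\<exists>Q\<in>bqf_level 1 n. bqf_act R \<tau> = bqf_scale (int q) Q). 1))"
      by (rule hecke_reps[OF q n])
    also have "\<dots> = class_sum 1 n (\<lambda>R. (1 + k) * real (num_reps N R))"
      by (rule class_sum_cong) (simp only: bqf_level_1_iff count_valid_lines[OF _ q0] roots mult.commute)
    finally show ?thesis .
  qed
  hence "rep_mass n (q * N) + k * class_sum 1 n (\<lambda>Q. real (if q dvd N then num_reps (N div q) Q else 0)) =
      (1 + k) * rep_mass n N"
    by (simp only: class_sum_add class_sum_cmult rep_mass_def)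
  moreover have "class_sum 1 n (\<lambda>Q. real (if q dvd N then num_reps (N div q) Q else 0)) =
      (if q dvd N then rep_mass n (N div q) else 0)"
    by (cases "q dvd N") (simp_all add: rep_mass_def, simp add: class_sum_def)
  ultimately show ?thesis by simp
qed

text \<open>A vector of value s = 1 or s = -1 is primitive, hence the first column of a matrix of
  determinant 1. Two completions differ by an upper unipotent factor, which shifts the middle
  coefficient by a multiple of 2 s; the discriminant fixes the parity of that coefficient, so
  exactly one completion reaches b0, and then c0 is forced.\<close>

lemma card_unit_reps:
  fixes s b0 c0 :: int
  assumes s: "s * s = 1" and b0: "b0 = 0 \<or> b0 = 1" and disc: "bqf_disc Q = bqf_disc (s, b0, c0)"
  shows "card {v :: int \<times> int. bqf_eval Q (fst v) (snd v) = s} = card (transporter 1 Q (s, b0, c0))"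
proof (rule bij_betw_same_card[symmetric, where f = "\<lambda>A. (A$1$1, A$2$1)"], rule bij_betw_imageI)
  obtain a b c where abc: "Q = (a, b, c)" by (cases Q)
  have s1: "s = 1 \<or> s = - 1"
    using s by (metis zmult_eq_1_iff)
  show "inj_on (\<lambda>A. (A$1$1, A$2$1)) (transporter 1 Q (s, b0, c0))"
  proof (rule inj_onI)
    fix A B assume A: "A \<in> transporter 1 Q (s, b0, c0)" and B: "B \<in> transporter 1 Q (s, b0, c0)"
      and e: "(A$1$1, A$2$1) = (B$1$1, B$2$1)"
    have dA: "det A = 1" and dB: "det B = 1" using A B by (auto simp: transporter_def Gamma0_def)
    define C where "C = adj2 A ** B"
    have C1: "C$1$1 = 1" "C$2$1 = 0" "C$2$2 = 1"
      using e dA dB by (simp_all add: C_def mat2_mult det_2 algebra_simps)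
    have "bqf_act (s, b0, c0) C = bqf_act (bqf_act (s, b0, c0) (adj2 A)) B" by (simp add: C_def bqf_act_mult)
    also have "bqf_act (s, b0, c0) (adj2 A) = Q" using transporter_adj2[OF A] by (simp add: transporter_def)
    also have "bqf_act Q B = (s, b0, c0)" using B by (simp add: transporter_def)
    finally have "2 * s * C$1$2 = 0" using C1 by (simp add: bqf_act.simps)
    hence "C$1$2 = 0" using s by auto
    hence "C = mat 1" using C1 by (simp add: mat22_eq_iff mat_def)
    hence "A ** (adj2 A ** B) = A" by (simp add: C_def)
    thus "A = B" using adj2_inverse(1)[OF dA] by (simp add: matrix_mul_assoc)
  qed
  show "(\<lambda>A. (A$1$1, A$2$1)) ` transporter 1 Q (s, b0, c0) = {v. bqf_eval Q (fst v) (snd v) = s}"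
  proof (intro equalityI subsetI)
    fix v assume "v \<in> (\<lambda>A. (A$1$1, A$2$1)) ` transporter 1 Q (s, b0, c0)"
    then obtain A where A: "A \<in> transporter 1 Q (s, b0, c0)" "v = (A$1$1, A$2$1)" by blast
    have "bqf_act Q A = (s, b0, c0)" using A by (simp add: transporter_def)
    thus "v \<in> {v. bqf_eval Q (fst v) (snd v) = s}" using A(2) by (simp add: abc bqf_act.simps bqf_eval.simps)
  next
    fix v assume "v \<in> {v. bqf_eval Q (fst v) (snd v) = s}"
    then obtain x y where v: "v = (x, y)" "bqf_eval Q x y = s" by (cases v) auto
    have "gcd x y dvd bqf_eval Q x y" by (simp add: abc bqf_eval.simps power2_eq_square)
    hence "gcd x y dvd 1" using v s by (metis dvd_mult2)
    hence "coprime x y" by (simp add: coprime_iff_gcd_eq_1)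
    then obtain u w where uw: "x * u + y * w = 1" using bezout_int[of x y] by (metis coprime_iff_gcd_eq_1 mult.commute)
    define A where "A = mat22 x (- w) y u"
    have dA: "det A = 1" using uw by (simp add: A_def algebra_simps)
    obtain b1 c1 where A1: "bqf_act Q A = (s, b1, c1)"
      using v(2) by (simp add: abc A_def bqf_act.simps bqf_eval.simps)
    have d1: "b1\<^sup>2 - 4 * s * c1 = b0\<^sup>2 - 4 * s * c0"
      using bqf_disc_act[of Q A] dA disc by (simp add: A1)
    have "even (b1\<^sup>2 - b0\<^sup>2)"
    proof -
      have "b1\<^sup>2 - b0\<^sup>2 = 2 * (2 * s * (c1 - c0))" using d1 by (simp add: algebra_simps)
      thus ?thesis by simp
    qed
    hence "even (b0 - b1)" by simp
    then obtain k where k: "b0 - b1 = 2 * k" by blast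
    \<comment> \<open>The unipotent factor with entry s k adds 2 s (s k) = 2 k = b0 - b1 to the
      middle coefficient.\<close>
    define C where "C = A ** mat22 1 (s * k) 0 1"
    have "bqf_act Q C = bqf_act (s, b1, c1) (mat22 1 (s * k) 0 1)"
      by (simp add: C_def bqf_act_mult A1)
    also have "\<dots> = (s, 2 * (s * s) * k + b1, s * (s * k)\<^sup>2 + b1 * (s * k) + c1)"
      by (simp add: bqf_act.simps algebra_simps)
    finally have C1: "bqf_act Q C = (s, b0, s * (s * k)\<^sup>2 + b1 * (s * k) + c1)" using k s by simp
    have dC: "det C = 1" using dA by (simp add: C_def det_mul)
    have "b0\<^sup>2 - 4 * s * (s * (s * k)\<^sup>2 + b1 * (s * k) + c1) = b0\<^sup>2 - 4 * s * c0"
      using bqf_disc_act[of Q C] dC disc by (simp add: C1)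
    hence "s * (s * k)\<^sup>2 + b1 * (s * k) + c1 = c0" using s1 by auto
    hence "C \<in> transporter 1 Q (s, b0, c0)" using C1 dC by (simp add: transporter_def Gamma0_1_iff)
    moreover have "v = (C$1$1, C$2$1)" by (simp add: v C_def A_def mat2_mult)
    ultimately show "v \<in> (\<lambda>A. (A$1$1, A$2$1)) ` transporter 1 Q (s, b0, c0)" by blast
  qed
qed

text \<open>One principal form of each sign, each with total weight 1 by
  \<open>transporter_class_sum\<close>.\<close>

lemma rep_mass_1:
  assumes n: "n < 0" and n4: "n mod 4 = 0 \<or> n mod 4 = 1"
  shows "rep_mass n 1 = 2"
proof -
  \<comment> \<open>Division by 4 gives n = b0 - 4 c0, and b0 = b0^2 since b0 is 0 or 1; so n is the
    discriminant of (1, b0, c0).\<close>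
  define b0 where "b0 = n mod 4"
  define c0 where "c0 = - (n div 4)"
  have b0: "b0 = 0 \<or> b0 = 1" using n4 by (simp add: b0_def)
  have "n = 4 * (n div 4) + n mod 4" by simp
  hence "n = b0 - 4 * c0" by (simp add: b0_def c0_def)
  moreover have "b0\<^sup>2 = b0" using b0 by auto
  ultimately have d: "bqf_disc (1, b0, c0) = n" "bqf_disc (- 1, b0, - c0) = n" by simp_all
  have "real (num_reps 1 Q) = real (card (transporter 1 (1, b0, c0) Q)) + real (card (transporter 1 (- 1, b0, - c0) Q))"
    if "Q \<in> bqf_level 1 n" for Q
  proof -
    have Q: "bqf_disc Q = n" using that by (simp add: bqf_level_1_iff)
    have f: "finite {v :: int \<times> int. \<bar>bqf_eval Q (fst v) (snd v)\<bar> = 1}" using finite_reps Q n by simp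
    have "{v :: int \<times> int. \<bar>bqf_eval Q (fst v) (snd v)\<bar> = 1} =
      {v. bqf_eval Q (fst v) (snd v) = 1} \<union> {v. bqf_eval Q (fst v) (snd v) = - 1}" by auto
    hence "num_reps 1 Q = card {v :: int \<times> int. bqf_eval Q (fst v) (snd v) = 1} +
      card {v :: int \<times> int. bqf_eval Q (fst v) (snd v) = - 1}"
      unfolding num_reps_def using f by (subst card_Un_disjoint[symmetric]) auto
    thus ?thesis
      using card_unit_reps[of 1 b0 Q c0] card_unit_reps[of "- 1" b0 Q "- c0"] b0 Q d
        card_transporter_commute[of 1 Q] by simp
  qed
  hence "rep_mass n 1 = class_sum 1 n (\<lambda>Q. real (card (transporter 1 (1, b0, c0) Q))) +
      class_sum 1 n (\<lambda>Q. real (card (transporter 1 (- 1, b0, - c0) Q)))"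
    unfolding rep_mass_def class_sum_add[symmetric] by (rule class_sum_cong)
  thus ?thesis using d n by (simp add: transporter_class_sum bqf_level_1_iff)
qed

section \<open>The class number formula\<close>

lemma bqf_disc_mod_4: "bqf_disc Q mod 4 = 0 \<or> bqf_disc Q mod 4 = 1"
proof -
  obtain a b c where abc: "Q = (a, b, c)" by (cases Q)
  have "bqf_disc Q = b\<^sup>2 + 4 * (- (a * c))" by (simp add: abc)
  hence m: "bqf_disc Q mod 4 = b\<^sup>2 mod 4" by (simp only: mod_mult_self2)
  show ?thesis
  proof (cases "even b")
    case True
    then obtain k where "b = 2 * k" by blast
    hence "b\<^sup>2 = 4 * k\<^sup>2" by (simp add: power2_eq_square)
    thus ?thesis using m by simp
  next
    case False
    then obtain k where "b = 2 * k + 1" by (rule oddE)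
    hence "b\<^sup>2 = 1 + 4 * (k\<^sup>2 + k)" by (simp add: power2_eq_square algebra_simps)
    hence "b\<^sup>2 mod 4 = 1 mod 4" by (simp only: mod_mult_self2)
    thus ?thesis using m by simp
  qed
qed

text \<open>If Q = q S, the discriminant of S has a decomposition t' m'^2 of its own; uniqueness for
  t m^2 then forces m = q m'.\<close>

lemma primitive_at_prime:
  assumes t: "fundamental_discriminant t" "t < 0" and q: "q > 0" and m: "m > 0" and qm: "\<not> q dvd m"
    and Q: "bqf_disc Q = t * (int m)\<^sup>2"
  shows "\<not> bqf_dvd (int q) Q"
proof
  assume "bqf_dvd (int q) Q"
  then obtain S where S: "Q = bqf_scale (int q) S" unfolding bqf_dvd_def by blast
  have e: "t * (int m)\<^sup>2 = (int q)\<^sup>2 * bqf_disc S" using Q by (simp add: S bqf_disc_scale)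
  have "t * (int m)\<^sup>2 < 0" using t m by (simp add: mult_neg_pos)
  hence "bqf_disc S < 0" using e q by (simp add: mult_less_0_iff)
  then obtain t' m' where d: "disc_decomp (- bqf_disc S) (t', m')"
    using disc_decomp_exists[of "- bqf_disc S"] bqf_disc_mod_4[of S] by auto
  have "disc_decomp (- (t * (int m)\<^sup>2)) (t', q * m')"
    using d q unfolding e by (auto simp: disc_decomp_def power_mult_distrib)
  moreover have "disc_decomp (- (t * (int m)\<^sup>2)) (t, m)" using t m by (simp add: disc_decomp_def)
  ultimately have "m = q * m'" using disc_decomp_unique by blast
  thus False using qm by simp
qed

abbreviation chi_real :: "int \<Rightarrow> nat \<Rightarrow> real" where
  "chi_real t n \<equiv> of_int (kronecker t n)"

lemma chi_real_prime_mult: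
  "prime q \<Longrightarrow> d > 0 \<Longrightarrow> chi_real t (q * d) = chi_real t q * chi_real t d"
  by (simp add: kronecker_mult_right prime_gt_0_nat)

text \<open>Both sides are 2 at N = 1 and satisfy the same recursion in every prime, because forms
  of fundamental discriminant are not divisible by any prime.\<close>

theorem rep_mass_eq:
  assumes t: "fundamental_discriminant t" "t < 0" and N: "N > 0"
  shows "rep_mass t N = 2 * divisor_sum (chi_real t) N"
  using N
proof (induction N rule: less_induct)
  case (less N)
  show ?case
  proof (cases "N = 1")
    case True
    have "t mod 4 = 0 \<or> t mod 4 = 1" by (rule fundamental_discriminant_mod_4[OF t(1)])
    thus ?thesis using rep_mass_1[OF t(2)] True by (simp add: divisor_sum_def)
  next
    case False
    then obtain q where q: "prime q" "q dvd N" using prime_factor_nat by blast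
    then obtain k where k: "N = q * k" by blast
    have k0: "k > 0" using less.prems k by auto
    have q1: "q > 1" using prime_gt_1_nat[OF q(1)] .
    have kN: "k < N" using k k0 q1 by simp
    have prim: "\<not> bqf_dvd (int q) Q" if "bqf_disc Q = t" for Q
      using primitive_at_prime[OF t, of q 1 Q] that q1 by simp
    have IH: "rep_mass t k = 2 * divisor_sum (chi_real t) k" using less.IH[OF kN k0] .
    have IH2: "rep_mass t (k div q) = 2 * divisor_sum (chi_real t) (k div q)" if qk: "q dvd k"
    proof -
      obtain j where j: "k = q * j" using qk by blast
      have "j > 0" "j \<le> k" using k0 j q1 by auto
      moreover from this have "j < N" using kN by simp
      ultimately show ?thesis using less.IH[of j] j q1 by simp
    qed
    have "rep_mass t (q * k) = (1 + chi_real t q) * rep_mass t k -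
        chi_real t q * (if q dvd k then rep_mass t (k div q) else 0)"
      using rep_mass_step[OF q(1) t(2) prim, of k] by (simp add: kronecker_prime_eq[OF q(1)])
    also have "\<dots> = 2 * ((1 + chi_real t q) * divisor_sum (chi_real t) k -
        chi_real t q * (if q dvd k then divisor_sum (chi_real t) (k div q) else 0))"
      unfolding IH using IH2 by (cases "q dvd k") (simp_all add: algebra_simps)
    also have "\<dots> = 2 * divisor_sum (chi_real t) (q * k)"
      using divisor_sum_prime_mult[OF q(1) k0, of "chi_real t"] chi_real_prime_mult[OF q(1)] by simp
    finally show ?thesis by (simp only: k)
  qed
qed

section \<open>Theta series of a form\<close>

definition form_theta :: "bqf \<Rightarrow> real \<Rightarrow> real" where
  "form_theta Q \<epsilon> = (\<Sum>\<^sub>\<infinity>v. exp (- \<epsilon> * real_of_int \<bar>bqf_eval Q (fst v) (snd v)\<bar>))"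

lemma definite_form_abs:
  assumes "bqf_disc Q < 0"
  obtains a b c :: real where "a > 0" "c > 0" "b\<^sup>2 + 1 \<le> 4 * a * c"
    "\<And>\<epsilon>. (\<lambda>v. exp (- \<epsilon> * real_of_int \<bar>bqf_eval Q (fst v) (snd v)\<bar>)) = gauss a b c \<epsilon>"
proof -
  obtain a b c where abc: "Q = (a, b, c)" by (cases Q)
  have d: "b\<^sup>2 + 1 \<le> 4 * a * c" using assms by (simp add: abc)
  define s where "s = sgn a"
  have "a * c > 0" using d zero_le_power2[of b] by linarith
  hence a0: "a \<noteq> 0" and sa: "s * a > 0" and sc: "s * c > 0" and s2: "s * s = 1"
    by (auto simp: s_def sgn_if zero_less_mult_iff)
  have abs: "\<bar>bqf_eval Q x y\<bar> = s * a * x\<^sup>2 + s * b * x * y + s * c * y\<^sup>2" for x y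
  proof -
    have "4 * a * bqf_eval Q x y = (2 * a * x + b * y)\<^sup>2 + (4 * a * c - b\<^sup>2) * y\<^sup>2"
      by (simp add: abc bqf_eval.simps power2_eq_square algebra_simps)
    also have "\<dots> \<ge> 0" using d by (intro add_nonneg_nonneg mult_nonneg_nonneg) auto
    finally have "0 \<le> a * bqf_eval Q x y" by (simp add: mult.assoc)
    hence "\<bar>bqf_eval Q x y\<bar> = s * bqf_eval Q x y"
      using a0 by (auto simp: s_def sgn_if zero_le_mult_iff abs_if split: if_splits)
    thus ?thesis by (simp add: abc bqf_eval.simps algebra_simps)
  qed
  have "(real_of_int (s * b))\<^sup>2 + 1 \<le> 4 * real_of_int (s * a) * real_of_int (s * c)"
  proof -
    have e: "(s * b)\<^sup>2 = (s * s) * b\<^sup>2" "4 * (s * a) * (s * c) = (s * s) * (4 * a * c)"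
      by (simp_all add: power2_eq_square algebra_simps)
    have "(s * b)\<^sup>2 + 1 \<le> 4 * (s * a) * (s * c)" unfolding e s2 using d by simp
    hence "real_of_int ((s * b)\<^sup>2 + 1) \<le> real_of_int (4 * (s * a) * (s * c))" by (simp only: of_int_le_iff)
    thus ?thesis by simp
  qed
  moreover from this have pos: "real_of_int (s * a) > 0" "real_of_int (s * c) > 0"
    "(real_of_int (s * b))\<^sup>2 + 1 \<le> 4 * real_of_int (s * a) * real_of_int (s * c)"
    using sa sc by (simp_all only: of_int_0_less_iff)
  have "exp (- \<epsilon> * real_of_int \<bar>bqf_eval Q (fst v) (snd v)\<bar>) =
      gauss (real_of_int (s * a)) (real_of_int (s * b)) (real_of_int (s * c)) \<epsilon> v" for \<epsilon> v
    unfolding gauss_def[OF pos] qf_def[OF pos] abs by simp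
  ultimately show thesis using sa sc
    by (intro that[of "real_of_int (s * a)" "real_of_int (s * c)" "real_of_int (s * b)"]) (auto simp only: of_int_0_less_iff)
qed

lemma form_theta_dilation_bound:
  assumes "bqf_disc Q < 0"
  shows "\<exists>C. \<forall>\<epsilon>. 0 < \<epsilon> \<longrightarrow> \<epsilon> \<le> 1 \<longrightarrow> \<bar>4 * form_theta Q (4 * \<epsilon>) - form_theta Q \<epsilon>\<bar> \<le> C * sqrt \<epsilon>"
proof (rule definite_form_abs[OF assms])
  fix a b c :: real
  assume abc: "a > 0" "c > 0" "b\<^sup>2 + 1 \<le> 4 * a * c"
    "\<And>\<epsilon>. (\<lambda>v. exp (- \<epsilon> * real_of_int \<bar>bqf_eval Q (fst v) (snd v)\<bar>)) = gauss a b c \<epsilon>"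
  show ?thesis
  proof (rule gauss_dilation_bound[OF abc(1-3)])
    fix C assume C: "\<And>\<epsilon>. 0 < \<epsilon> \<Longrightarrow> \<epsilon> \<le> 1 \<Longrightarrow>
      \<bar>4 * (\<Sum>\<^sub>\<infinity>v. gauss a b c (4 * \<epsilon>) v) - (\<Sum>\<^sub>\<infinity>v. gauss a b c \<epsilon> v)\<bar> \<le> C * sqrt \<epsilon>"
    show ?thesis unfolding form_theta_def abc(4) using C by blast
  qed
qed

lemma num_reps_0:
  assumes "bqf_disc Q < 0"
  shows "num_reps 0 Q = 1"
proof -
  obtain a b c where abc: "Q = (a, b, c)" by (cases Q)
  have d: "0 < 4 * a * c - b\<^sup>2" using assms by (simp add: abc)
  have "bqf_eval Q x y = 0 \<longleftrightarrow> x = 0 \<and> y = 0" for x y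
  proof
    assume e: "bqf_eval Q x y = 0"
    have "4 * a * bqf_eval Q x y = (2 * a * x + b * y)\<^sup>2 + (4 * a * c - b\<^sup>2) * y\<^sup>2"
      "4 * c * bqf_eval Q x y = (2 * c * y + b * x)\<^sup>2 + (4 * a * c - b\<^sup>2) * x\<^sup>2"
      by (simp_all add: abc bqf_eval.simps power2_eq_square algebra_simps)
    hence "(2 * a * x + b * y)\<^sup>2 + (4 * a * c - b\<^sup>2) * y\<^sup>2 = 0"
      "(2 * c * y + b * x)\<^sup>2 + (4 * a * c - b\<^sup>2) * x\<^sup>2 = 0" using e by simp_all
    moreover have "0 \<le> (4 * a * c - b\<^sup>2) * y\<^sup>2" "0 \<le> (4 * a * c - b\<^sup>2) * x\<^sup>2"
      using d by (intro mult_nonneg_nonneg; simp)+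
    ultimately have "(4 * a * c - b\<^sup>2) * y\<^sup>2 = 0" "(4 * a * c - b\<^sup>2) * x\<^sup>2 = 0"
      using zero_le_power2[of "2 * a * x + b * y"] zero_le_power2[of "2 * c * y + b * x"] by linarith+
    thus "x = 0 \<and> y = 0" using d by simp
  qed (simp add: abc bqf_eval.simps)
  hence "{v :: int \<times> int. \<bar>bqf_eval Q (fst v) (snd v)\<bar> = int 0} = {(0, 0)}" by (auto simp: prod_eq_iff)
  thus ?thesis unfolding num_reps_def by (simp only:) simp
qed

text \<open>Lattice vectors grouped by |Q(v)|. The 1 subtracted is the zero vector, the only one of
  value 0.\<close>

lemma form_theta_expansion:
  assumes Q: "bqf_disc Q < 0" and \<epsilon>: "\<epsilon> > 0"
  shows "((\<lambda>N. real (num_reps N Q) * exp (- \<epsilon> * real N)) has_sum (form_theta Q \<epsilon> - 1)) {1..}"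
proof -
  let ?g = "\<lambda>v. exp (- \<epsilon> * real_of_int \<bar>bqf_eval Q (fst v) (snd v)\<bar>)"
  have "?g summable_on UNIV"
  proof (rule definite_form_abs[OF Q])
    fix a b c :: real
    assume abc: "a > 0" "c > 0" "b\<^sup>2 + 1 \<le> 4 * a * c"
      "\<And>\<epsilon>. (\<lambda>v. exp (- \<epsilon> * real_of_int \<bar>bqf_eval Q (fst v) (snd v)\<bar>)) = gauss a b c \<epsilon>"
    show ?thesis unfolding abc(4) by (rule gauss_summable[OF abc(1-3) \<epsilon>])
  qed
  hence "(?g has_sum form_theta Q \<epsilon>) UNIV" unfolding form_theta_def by (rule has_sum_infsum)
  also have "?this \<longleftrightarrow> ((\<lambda>(N, v). exp (- \<epsilon> * real N)) has_sum form_theta Q \<epsilon>)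
      (Sigma UNIV (\<lambda>N. {v. \<bar>bqf_eval Q (fst v) (snd v)\<bar> = int N}))"
    by (rule has_sum_reindex_bij_witness[where i = snd and j = "\<lambda>v. (nat \<bar>bqf_eval Q (fst v) (snd v)\<bar>, v)"]) auto
  finally have S: "((\<lambda>(N, v). exp (- \<epsilon> * real N)) has_sum form_theta Q \<epsilon>)
      (Sigma UNIV (\<lambda>N. {v. \<bar>bqf_eval Q (fst v) (snd v)\<bar> = int N}))" .
  let ?r = "\<lambda>N. real (num_reps N Q) * exp (- \<epsilon> * real N)"
  have all: "(?r has_sum form_theta Q \<epsilon>) UNIV"
  proof (rule has_sum_SigmaD[OF S])
    fix N :: nat
    show "((\<lambda>v. case (N, v) of (N, v) \<Rightarrow> exp (- \<epsilon> * real N)) has_sum ?r N) {v. \<bar>bqf_eval Q (fst v) (snd v)\<bar> = int N}"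
      using finite_reps[OF Q, of "int N"] by (intro has_sum_finiteI) (auto simp: num_reps_def)
  qed
  have "?r summable_on {1..}"
    using all summable_on_subset_banach[of ?r UNIV "{1..}"] by (auto simp: summable_on_def)
  then obtain U where U: "(?r has_sum U) {1..}" by (auto simp: summable_on_def)
  have "(?r has_sum 1) {0}" using num_reps_0[OF Q] by (intro has_sum_finiteI) auto
  from has_sum_Un_disjoint[OF this U] have "(?r has_sum (1 + U)) ({0} \<union> {1..})" by simp
  moreover have "{0} \<union> {1..} = (UNIV :: nat set)" by auto
  ultimately have "1 + U = form_theta Q \<epsilon>" using all has_sum_unique by metis
  thus ?thesis using U by (metis add_diff_cancel_left')
qed

lemma has_sum_sum:
  fixes f :: "'i \<Rightarrow> 'a \<Rightarrow> 'b :: topological_comm_monoid_add"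
  assumes "\<And>i. i \<in> I \<Longrightarrow> (f i has_sum s i) A"
  shows "((\<lambda>x. \<Sum>i\<in>I. f i x) has_sum (\<Sum>i\<in>I. s i)) A"
  using assms by (induction I rule: infinite_finite_induct) (auto intro!: has_sum_add)

lemma has_sum_class_sum:
  assumes "\<And>Q. Q \<in> bqf_level l n \<Longrightarrow> (f Q has_sum g Q) A"
  shows "((\<lambda>x. class_sum l n (\<lambda>Q. f Q x)) has_sum class_sum l n g) A"
  unfolding class_sum_def divide_inverse
  by (intro has_sum_sum has_sum_cmult_left assms class_rep_level)

text \<open>Stands in for a limit: x does not depend on \<epsilon>, although the estimate for it
  does.\<close>

lemma eq_zero_of_sqrt_bound:
  fixes x :: real
  assumes "\<And>\<epsilon>. 0 < \<epsilon> \<Longrightarrow> \<epsilon> \<le> 1 \<Longrightarrow> \<bar>x\<bar> \<le> C * sqrt \<epsilon>"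
  shows "x = 0"
proof (rule ccontr)
  assume x: "x \<noteq> 0"
  define D where "D = max C 1"
  have D: "D \<ge> 1" "C \<le> D" by (simp_all add: D_def)
  define \<epsilon> where "\<epsilon> = min 1 ((\<bar>x\<bar> / (2 * D))\<^sup>2)"
  have e: "0 < \<epsilon>" "\<epsilon> \<le> 1" using x D by (auto simp: \<epsilon>_def)
  have "sqrt \<epsilon> \<le> sqrt ((\<bar>x\<bar> / (2 * D))\<^sup>2)" unfolding \<epsilon>_def by (rule real_sqrt_le_mono) simp
  also have "\<dots> = \<bar>x\<bar> / (2 * D)" using D by simp
  finally have s: "sqrt \<epsilon> \<le> \<bar>x\<bar> / (2 * D)" .
  have "\<bar>x\<bar> \<le> C * sqrt \<epsilon>" by (rule assms[OF e])
  also have "\<dots> \<le> D * sqrt \<epsilon>" using D e by (intro mult_right_mono) auto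
  also have "\<dots> \<le> D * (\<bar>x\<bar> / (2 * D))" using s D by (intro mult_left_mono) auto
  also have "\<dots> = \<bar>x\<bar> / 2" using D by simp
  finally show False using x by simp
qed

theorem class_number_formula:
  assumes t: "fundamental_discriminant t" "t < 0"
  shows "dirichlet_L (kronecker t) 0 = of_real (mass t)"
proof -
  obtain M where M: "M > 0" "\<And>n. n > 0 \<Longrightarrow> kronecker t (n + M) = kronecker t n"
    "(\<Sum>n=1..M. kronecker t n) = 0"
    using kronecker_periodic_zero_sum[OF t] by blast
  \<comment> \<open>Periodicity of the symbol is available at positive arguments only; f takes the
    value at M also at 0, so that it is periodic from 0 on.\<close>
  define f where "f = (\<lambda>n. if n = 0 then chi_real t M else chi_real t n)"
  have per: "f (n + M) = f n" for n using M by (simp add: f_def)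
  have "(\<Sum>n<M. f n) = (\<Sum>n=1..M. chi_real t n)"
  proof -
    have "(\<Sum>n<M. f n) + f M = f 0 + (\<Sum>n<M. f (Suc n))"
      by (metis sum.lessThan_Suc sum.lessThan_Suc_shift)
    hence "(\<Sum>n<M. f n) = (\<Sum>n<M. f (Suc n))" using per[of 0] by simp
    also have "\<dots> = (\<Sum>n=1..M. f n)" by (simp add: One_nat_def sum.atLeast1_atMost_eq)
    also have "\<dots> = (\<Sum>n=1..M. chi_real t n)" by (intro sum.cong) (auto simp: f_def)
    finally show ?thesis .
  qed
  also have "\<dots> = of_int (\<Sum>n=1..M. kronecker t n)" by (simp only: of_int_sum)
  finally have "(\<Sum>n<M. f n) = 0" by (simp only: M(3) of_int_0)
  hence zmp: "zero_mean_periodic M f" using M(1) per by (simp add: zero_mean_periodic_def)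
  define h where "h = antidiff M f 0"
  have L: "dirichlet_L (kronecker t) 0 = - of_real h"
    unfolding h_def by (rule dirichlet_L_0[OF zmp]) (simp add: f_def)
  obtain C where C: "\<And>\<epsilon>. 0 < \<epsilon> \<Longrightarrow> \<exists>S.
    ((\<lambda>N. (\<Sum>d | d dvd N. f d) * (exp (- \<epsilon> * real N) - 4 * exp (- 4 * \<epsilon> * real N))) has_sum S) {1..} \<and>
    \<bar>S + 3 / 2 * h\<bar> \<le> C * \<epsilon>"
    by (rule divisor_sum_asymptotics[OF zmp, folded h_def]) (rule that, blast)
  have "\<forall>Q\<in>bqf_level 1 t. \<exists>C. \<forall>\<epsilon>. 0 < \<epsilon> \<longrightarrow> \<epsilon> \<le> 1 \<longrightarrow>
      \<bar>4 * form_theta Q (4 * \<epsilon>) - form_theta Q \<epsilon>\<bar> \<le> C * sqrt \<epsilon>"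
  proof
    fix Q assume "Q \<in> bqf_level 1 t"
    hence "bqf_disc Q < 0" using t(2) by (simp add: bqf_level_1_iff)
    thus "\<exists>C. \<forall>\<epsilon>. 0 < \<epsilon> \<longrightarrow> \<epsilon> \<le> 1 \<longrightarrow> \<bar>4 * form_theta Q (4 * \<epsilon>) - form_theta Q \<epsilon>\<bar> \<le> C * sqrt \<epsilon>"
      by (rule form_theta_dilation_bound)
  qed
  from bchoice[OF this] obtain B where "\<forall>Q\<in>bqf_level 1 t. \<forall>\<epsilon>. 0 < \<epsilon> \<longrightarrow> \<epsilon> \<le> 1 \<longrightarrow>
      \<bar>4 * form_theta Q (4 * \<epsilon>) - form_theta Q \<epsilon>\<bar> \<le> B Q * sqrt \<epsilon>" by blast
  hence B: "\<bar>4 * form_theta Q (4 * \<epsilon>) - form_theta Q \<epsilon>\<bar> \<le> B Q * sqrt \<epsilon>"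
    if "Q \<in> bqf_level 1 t" "0 < \<epsilon>" "\<epsilon> \<le> 1" for Q \<epsilon> using that by blast
  have "\<bar>3 * mass t + 3 * h\<bar> \<le> (class_sum 1 t B + 2 * \<bar>C\<bar>) * sqrt \<epsilon>" if \<epsilon>: "0 < \<epsilon>" "\<epsilon> \<le> 1" for \<epsilon>
  proof -
    let ?w = "\<lambda>N. 4 * exp (- (4 * \<epsilon>) * real N) - exp (- \<epsilon> * real N)"
    define D where "D = class_sum 1 t (\<lambda>Q. 4 * form_theta Q (4 * \<epsilon>) - form_theta Q \<epsilon>)"
    have "((\<lambda>N. class_sum 1 t (\<lambda>Q. real (num_reps N Q) * ?w N)) has_sum
        class_sum 1 t (\<lambda>Q. 4 * (form_theta Q (4 * \<epsilon>) - 1) - (form_theta Q \<epsilon> - 1))) {1..}"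
    proof (rule has_sum_class_sum)
      fix Q assume "Q \<in> bqf_level 1 t"
      hence Q: "bqf_disc Q < 0" using t(2) by (simp add: bqf_level_1_iff)
      have "((\<lambda>N. 4 * (real (num_reps N Q) * exp (- (4 * \<epsilon>) * real N)) - real (num_reps N Q) * exp (- \<epsilon> * real N))
          has_sum (4 * (form_theta Q (4 * \<epsilon>) - 1) - (form_theta Q \<epsilon> - 1))) {1..}"
        using \<epsilon> by (intro has_sum_diff has_sum_cmult_right form_theta_expansion Q) auto
      thus "((\<lambda>N. real (num_reps N Q) * ?w N) has_sum (4 * (form_theta Q (4 * \<epsilon>) - 1) - (form_theta Q \<epsilon> - 1))) {1..}"
        by (simp add: algebra_simps)
    qed
    also have "(\<lambda>Q. 4 * (form_theta Q (4 * \<epsilon>) - 1) - (form_theta Q \<epsilon> - 1)) =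
        (\<lambda>Q. (4 * form_theta Q (4 * \<epsilon>) - form_theta Q \<epsilon>) - 3 * 1)" by (simp add: algebra_simps)
    also have "class_sum 1 t \<dots> = D - 3 * mass t"
      unfolding class_sum_diff class_sum_cmult D_def mass_def ..
    also have "(\<lambda>N. class_sum 1 t (\<lambda>Q. real (num_reps N Q) * ?w N)) = (\<lambda>N. ?w N * rep_mass t N)"
      by (simp only: mult.commute[of "real _" "_ - _"] class_sum_cmult rep_mass_def)
    finally have 1: "((\<lambda>N. ?w N * rep_mass t N) has_sum (D - 3 * mass t)) {1..}" .
    obtain S where S: "((\<lambda>N. (\<Sum>d | d dvd N. f d) * (exp (- \<epsilon> * real N) - 4 * exp (- 4 * \<epsilon> * real N))) has_sum S) {1..}"
      "\<bar>S + 3 / 2 * h\<bar> \<le> C * \<epsilon>" using C[OF \<epsilon>(1)] by blast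
    have "((\<lambda>N. - 2 * ((\<Sum>d | d dvd N. f d) * (exp (- \<epsilon> * real N) - 4 * exp (- 4 * \<epsilon> * real N)))) has_sum (- 2 * S)) {1..}"
      by (rule has_sum_cmult_right[OF S(1)])
    also have "?this \<longleftrightarrow> ((\<lambda>N. ?w N * rep_mass t N) has_sum (- 2 * S)) {1..}"
    proof (rule has_sum_cong)
      fix N :: nat assume N: "N \<in> {1..}"
      have "(\<Sum>d | d dvd N. f d) = divisor_sum (chi_real t) N"
        unfolding divisor_sum_def using N by (intro sum.cong) (auto simp: f_def)
      thus "- 2 * ((\<Sum>d | d dvd N. f d) * (exp (- \<epsilon> * real N) - 4 * exp (- 4 * \<epsilon> * real N))) = ?w N * rep_mass t N"
        using rep_mass_eq[OF t, of N] N by (simp add: algebra_simps)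
    qed
    finally have "D - 3 * mass t = - 2 * S" using 1 has_sum_unique by blast
    \<comment> \<open>D is O(sqrt \<epsilon>) by the theta estimate and S + 3/2 h is O(\<epsilon>)
      by the Lambert estimate, while the left side is independent of \<epsilon>.\<close>
    hence e: "3 * mass t + 3 * h = D + 2 * (S + 3 / 2 * h)" by simp
    have "\<bar>D\<bar> \<le> class_sum 1 t (\<lambda>Q. B Q * sqrt \<epsilon>)"
    proof -
      have "\<bar>D\<bar> \<le> class_sum 1 t (\<lambda>Q. \<bar>4 * form_theta Q (4 * \<epsilon>) - form_theta Q \<epsilon>\<bar>)"
        unfolding D_def class_sum_def by (rule order_trans[OF sum_abs]) (simp add: abs_divide)
      also have "\<dots> \<le> class_sum 1 t (\<lambda>Q. B Q * sqrt \<epsilon>)"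
        unfolding class_sum_def by (intro sum_mono divide_right_mono B class_rep_level \<epsilon>) auto
      finally show ?thesis .
    qed
    also have "\<dots> = class_sum 1 t B * sqrt \<epsilon>"
      using class_sum_cmult[of 1 t "sqrt \<epsilon>" B] by (simp add: mult.commute)
    finally have DB: "\<bar>D\<bar> \<le> class_sum 1 t B * sqrt \<epsilon>" .
    have "\<epsilon> \<le> sqrt \<epsilon>" using \<epsilon> by (simp add: real_le_rsqrt power2_eq_square mult_le_cancel_left1)
    hence "\<bar>C\<bar> * \<epsilon> \<le> \<bar>C\<bar> * sqrt \<epsilon>" by (intro mult_left_mono) auto
    moreover have "C * \<epsilon> \<le> \<bar>C\<bar> * \<epsilon>" using \<epsilon> by (intro mult_right_mono) auto
    ultimately have SB: "\<bar>S + 3 / 2 * h\<bar> \<le> \<bar>C\<bar> * sqrt \<epsilon>" using S(2) by linarith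
    have "\<bar>3 * mass t + 3 * h\<bar> \<le> \<bar>D\<bar> + 2 * \<bar>S + 3 / 2 * h\<bar>"
      unfolding e using abs_triangle_ineq[of D "2 * (S + 3 / 2 * h)"] by (simp only: abs_mult abs_numeral)
    also have "\<dots> \<le> class_sum 1 t B * sqrt \<epsilon> + 2 * (\<bar>C\<bar> * sqrt \<epsilon>)" by (intro add_mono mult_left_mono DB SB) auto
    finally show ?thesis by (simp add: algebra_simps)
  qed
  hence "3 * mass t + 3 * h = 0" by (rule eq_zero_of_sqrt_bound)
  hence "h = - mass t" by simp
  thus ?thesis using L by simp
qed

section \<open>Conductors and level p\<close>

lemma fundamental_mult_square_mod_4:
  assumes "fundamental_discriminant t"
  shows "t * (int m)\<^sup>2 mod 4 = 0 \<or> t * (int m)\<^sup>2 mod 4 = 1"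
proof -
  have "t mod 4 = 0 \<or> t mod 4 = 1" by (rule fundamental_discriminant_mod_4[OF assms])
  then obtain b0 where "b0\<^sup>2 = t mod 4" by (metis power_zero_numeral one_power2)
  hence "bqf_disc (- (t div 4), b0, 1) = t" using div_mult_mod_eq[of t 4] by simp
  hence "bqf_disc (bqf_scale (int m) (- (t div 4), b0, 1)) = t * (int m)\<^sup>2"
    by (simp only: bqf_disc_scale mult.commute)
  thus ?thesis using bqf_disc_mod_4 by metis
qed

lemma kronecker_prime_mult_square:
  assumes q: "prime q" and qm: "\<not> q dvd m"
  shows "kronecker_prime (t * (int m)\<^sup>2) q = kronecker_prime t q"
proof -
  have nz: "kronecker_prime (int m) q \<in> {-1, 1}"
    using qm by (auto simp: kronecker_prime_def Legendre_def cong_0_iff)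
  have "kronecker_prime (t * (int m)\<^sup>2) q = kronecker_prime t q * (kronecker_prime (int m) q * kronecker_prime (int m) q)"
    unfolding power2_eq_square by (simp only: kronecker_prime_mult[OF q])
  thus ?thesis using nz by auto
qed

lemma kronecker_prime_dvd: "prime q \<Longrightarrow> int q dvd n \<Longrightarrow> kronecker_prime n q = 0"
  by (auto simp: kronecker_prime_def Legendre_def cong_0_iff)

lemma mass_dvd_eq_0:
  assumes "\<And>Q. bqf_disc Q = n \<Longrightarrow> \<not> bqf_dvd d Q"
  shows "mass_dvd d n = 0"
proof -
  have "mass_dvd d n = class_sum 1 n (\<lambda>_. 0)"
    unfolding mass_dvd_def by (rule class_sum_cong) (simp add: assms bqf_level_1_iff)
  thus ?thesis by (simp add: class_sum_def)
qed

text \<open>No form of discriminant t m^2 is divisible by q, so only the primitive terms of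
  \<open>mass_step\<close> survive.\<close>

lemma mass_prime_coprime:
  assumes t: "fundamental_discriminant t" "t < 0" and q: "prime q" and m: "m > 0" and qm: "\<not> q dvd m"
  shows "mass_dvd (int q) (t * (int m)\<^sup>2) = 0"
    "mass (t * (int (q * m))\<^sup>2) = (1 + real q - chi_real t q) * mass (t * (int m)\<^sup>2)"
proof -
  let ?n = "t * (int m)\<^sup>2"
  show md: "mass_dvd (int q) ?n = 0"
    using primitive_at_prime[OF t prime_gt_0_nat[OF q] m qm] by (rule mass_dvd_eq_0)
  have n: "?n < 0" using t m by (simp add: mult_neg_pos)
  from mass_step[OF q n fundamental_mult_square_mod_4[OF t(1)]]
  have "mass (?n * (int q)\<^sup>2) = (1 + real q - chi_real t q) * mass ?n"
    by (simp add: md kronecker_prime_mult_square[OF q qm] kronecker_prime_eq[OF q] algebra_simps)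
  moreover have "?n * (int q)\<^sup>2 = t * (int (q * m))\<^sup>2" by (simp add: power_mult_distrib)
  ultimately show "mass (t * (int (q * m))\<^sup>2) = (1 + real q - chi_real t q) * mass ?n" by simp
qed

text \<open>Now q divides the discriminant, so the symbol vanishes, and the forms divisible by q are
  q times the forms of discriminant t l^2.\<close>

lemma mass_prime_dvd:
  assumes t: "fundamental_discriminant t" "t < 0" and q: "prime q" and l: "l > 0"
  shows "mass_dvd (int q) (t * (int (q * l))\<^sup>2) = mass (t * (int l)\<^sup>2)"
    "mass (t * (int (q * (q * l)))\<^sup>2) = (1 + real q) * mass (t * (int (q * l))\<^sup>2) - real q * mass (t * (int l)\<^sup>2)"
proof -
  let ?n = "t * (int (q * l))\<^sup>2"
  have q0: "q > 0" using prime_gt_0_nat[OF q] .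
  have nl: "t * (int l)\<^sup>2 < 0" using t l by (simp add: mult_neg_pos)
  have e: "?n = t * (int l)\<^sup>2 * (int q)\<^sup>2" by (simp add: power_mult_distrib)
  show md: "mass_dvd (int q) ?n = mass (t * (int l)\<^sup>2)"
    unfolding e using mass_dvd_scale[OF nl, of "int q" 1] q0 by (simp add: mass_dvd_1)
  have n: "?n < 0" using t l q0 by (simp add: mult_neg_pos)
  have k: "kronecker_prime ?n q = 0" using q by (intro kronecker_prime_dvd) (simp_all add: power2_eq_square)
  have "(real q + 1) * mass ?n = mass (?n * (int q)\<^sup>2) - mass ?n + (mass ?n - mass (t * (int l)\<^sup>2)) +
      (real q + 1) * mass (t * (int l)\<^sup>2)"
    using mass_step[OF q n fundamental_mult_square_mod_4[OF t(1)]] unfolding md k by simp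
  hence step: "mass (?n * (int q)\<^sup>2) = (1 + real q) * mass ?n - real q * mass (t * (int l)\<^sup>2)"
    by (simp add: algebra_simps)
  have e2: "t * (int (q * (q * l)))\<^sup>2 = ?n * (int q)\<^sup>2" by (simp add: power_mult_distrib)
  show "mass (t * (int (q * (q * l)))\<^sup>2) = (1 + real q) * mass ?n - real q * mass (t * (int l)\<^sup>2)"
    unfolding e2 by (rule step)
qed

text \<open>Induction on one prime factor of m: \<open>mass_prime_coprime\<close> and
  \<open>mass_prime_dvd\<close> mirror \<open>conductor_sum_coprime\<close> and
  \<open>conductor_sum_dvd\<close>.\<close>

theorem mass_conductor:
  assumes t: "fundamental_discriminant t" "t < 0" and m: "m > 0"
  shows "mass (t * (int m)\<^sup>2) = mass t * conductor_sum (chi_real t) m"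
  using m
proof (induction m rule: less_induct)
  case (less m)
  show ?case
  proof (cases "m = 1")
    case True
    thus ?thesis using conductor_sum_1[of "chi_real t"] by simp
  next
    case False
    then obtain q where q: "prime q" "q dvd m" using prime_factor_nat by blast
    then obtain k where k: "m = q * k" by blast
    have k0: "k > 0" using less.prems k by auto
    have q1: "q > 1" using prime_gt_1_nat[OF q(1)] .
    have km: "k < m" using k k0 q1 by simp
    note IH = less.IH[OF km k0]
    show ?thesis
    proof (cases "q dvd k")
      case False
      thus ?thesis
        using mass_prime_coprime(2)[OF t q(1) k0 False] IH
          conductor_sum_coprime[OF q(1) k0 False, of "chi_real t"] chi_real_prime_mult[OF q(1)]
        by (simp add: k)
    next
      case True
      then obtain j where j: "k = q * j" by blast
      have j0: "j > 0" using k0 j by auto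
      have "1 * j < q * j" using q1 j0 by (intro mult_strict_right_mono) auto
      hence "j < m" using j km by linarith
      note IH2 = less.IH[OF this j0]
      have kq: "k div q = j" using j q1 by simp
      have "mass (t * (int m)\<^sup>2) = (1 + real q) * mass (t * (int k)\<^sup>2) - real q * mass (t * (int j)\<^sup>2)"
        unfolding k j by (rule mass_prime_dvd(2)[OF t q(1) j0])
      also have "\<dots> = mass t * ((1 + real q) * conductor_sum (chi_real t) k - real q * conductor_sum (chi_real t) j)"
        unfolding IH IH2 by (simp add: algebra_simps)
      also have "(1 + real q) * conductor_sum (chi_real t) k - real q * conductor_sum (chi_real t) j =
          conductor_sum (chi_real t) m"
        using conductor_sum_dvd[OF q(1) k0 True, of "chi_real t"] unfolding kq k by simp
      finally show ?thesis .
    qed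
  qed
qed

text \<open>The recurrence of \<open>mass_prime_dvd\<close> has characteristic roots 1 and p; this
  is its solution for the values at k = 0 and k = 1, cleared of the denominator p - 1.\<close>

lemma mass_prime_power:
  assumes t: "fundamental_discriminant t" "t < 0" and p: "prime p" and m: "m > 0" and pm: "\<not> p dvd m"
  shows "(real p - 1) * mass (t * (int (p ^ k * m))\<^sup>2) =
    (real p ^ Suc k - 1 - chi_real t p * (real p ^ k - 1)) * mass (t * (int m)\<^sup>2)"
proof (induction k rule: induct_nat_012)
  case 1
  have e: "p ^ 1 * m = p * m" "p ^ Suc 0 * m = p * m" by simp_all
  show ?case unfolding e mass_prime_coprime(2)[OF t p m pm] by (simp add: algebra_simps)
next
  case (ge2 k)
  have p0: "p > 0" using prime_gt_0_nat[OF p] .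
  define E where "E = (\<lambda>k. mass (t * (int (p ^ k * m))\<^sup>2))"
  define M where "M = mass (t * (int m)\<^sup>2)"
  have IH: "(real p - 1) * E k = (real p ^ Suc k - 1 - chi_real t p * (real p ^ k - 1)) * M"
    "(real p - 1) * E (Suc k) = (real p ^ Suc (Suc k) - 1 - chi_real t p * (real p ^ Suc k - 1)) * M"
    unfolding E_def M_def by (rule ge2)+
  have rec: "E (Suc (Suc k)) = (1 + real p) * E (Suc k) - real p * E k"
    using mass_prime_dvd(2)[OF t p, of "p ^ k * m"] p0 m by (simp add: E_def mult.assoc)
  have "(real p - 1) * E (Suc (Suc k)) =
      (1 + real p) * ((real p - 1) * E (Suc k)) - real p * ((real p - 1) * E k)"
    unfolding rec by (simp add: algebra_simps)
  hence "(real p - 1) * E (Suc (Suc k)) =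
      (real p ^ Suc (Suc (Suc k)) - 1 - chi_real t p * (real p ^ Suc (Suc k) - 1)) * M"
    unfolding IH by (simp add: algebra_simps)
  thus ?case unfolding E_def M_def .
qed simp

text \<open>No matrix of determinant 1 equals its negative, so every class modulo sign has two
  elements.\<close>

lemma double_card_Gamma0_stab:
  assumes "bqf_disc Q < 0"
  shows "card (transporter l Q Q) = 2 * card (Gamma0_stab l Q)"
proof -
  let ?r = "{(A, B). B = A \<or> B = - A} :: ((int ^ 2 ^ 2) \<times> (int ^ 2 ^ 2)) set"
  have cl: "?r `` {A} = {A, - A}" for A by auto
  have st: "Gamma0_stab l Q = (\<lambda>A. {A, - A}) ` transporter l Q Q"
    unfolding Gamma0_stab_def transporter_def quotient_def cl by auto
  have neg: "- A \<in> transporter l Q Q" if "A \<in> transporter l Q Q" for A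
    using that by (simp add: transporter_def Gamma0_def det_2)
  have ne: "A \<noteq> - A" if "A \<in> transporter l Q Q" for A
  proof
    assume "A = - A"
    hence "A$1$1 = 0 \<and> A$1$2 = 0" by (auto simp: mat22_eq_iff)
    hence "det A = 0" by (simp add: det_2)
    thus False using that by (simp add: transporter_def Gamma0_def)
  qed
  have un: "\<Union> (Gamma0_stab l Q) = transporter l Q Q" unfolding st using neg by auto
  have "2 * card (Gamma0_stab l Q) = card (\<Union> (Gamma0_stab l Q))"
  proof (rule card_partition)
    show "finite (Gamma0_stab l Q)" by (rule finite_Gamma0_stab[OF assms])
    show "finite (\<Union> (Gamma0_stab l Q))" unfolding un by (rule finite_stabilizer[OF assms])
    show "card c = 2" if "c \<in> Gamma0_stab l Q" for c using that ne unfolding st by auto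
    show "c1 \<inter> c2 = {}" if "c1 \<in> Gamma0_stab l Q" "c2 \<in> Gamma0_stab l Q" "c1 \<noteq> c2" for c1 c2
      using that unfolding st by auto
  qed
  thus ?thesis unfolding un by simp
qed

lemma stabilizer_class_sum:
  assumes "n < 0"
  shows "(\<Sum>C\<in>bqf_classes l n. 1 / of_nat (card (Gamma0_stab l (SOME Q. Q \<in> C)))) =
    complex_of_real (2 * class_sum l n (\<lambda>_. 1))"
proof -
  have "(\<Sum>C\<in>bqf_classes l n. 1 / of_nat (card (Gamma0_stab l (SOME Q. Q \<in> C)))) =
    (\<Sum>C\<in>bqf_classes l n. complex_of_real (2 * (1 / real (card (transporter l (class_rep C) (class_rep C))))))"
  proof (rule sum.cong)
    fix C assume "C \<in> bqf_classes l n"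
    hence "bqf_disc (class_rep C) < 0" using class_rep_level bqf_level_disc assms by blast
    from double_card_Gamma0_stab[OF this, of l]
    show "1 / of_nat (card (Gamma0_stab l (SOME Q. Q \<in> C))) =
      complex_of_real (2 * (1 / real (card (transporter l (class_rep C) (class_rep C)))))"
      by (simp add: class_rep_def[symmetric])
  qed simp
  thus ?thesis by (simp add: class_sum_def sum_distrib_left)
qed

section \<open>The sums in the Hurwitz numbers\<close>

lemma coprime_divisors:
  fixes p k m :: nat
  assumes p: "prime p" and pm: "\<not> p dvd m"
  shows "{a. a dvd p ^ k * m \<and> coprime a p} = {a. a dvd m}"
proof (intro equalityI subsetI)
  fix a assume a: "a \<in> {a. a dvd p ^ k * m \<and> coprime a p}"
  hence "coprime a (p ^ k)" by simp
  thus "a \<in> {a. a dvd m}" using a coprime_dvd_mult_right_iff by blast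
next
  fix a assume a: "a \<in> {a. a dvd m}"
  hence "\<not> p dvd a" using pm by (auto dest: dvd_trans)
  hence "coprime a p" using p prime_imp_coprime coprime_commute by blast
  thus "a \<in> {a. a dvd p ^ k * m \<and> coprime a p}" using a by auto
qed

text \<open>The cofactor of d has to be prime to p, so d absorbs the whole power p^k.\<close>

lemma full_power_divisors:
  fixes p k m a l :: nat
  assumes p: "prime p" and pm: "\<not> p dvd m" and m: "m > 0" and l: "m = a * l"
  shows "{d. d dvd p ^ k * l \<and> coprime (p ^ k * m div (a * d)) p} = (\<lambda>e. p ^ k * e) ` {e. e dvd l}"
proof -
  have a0: "a > 0" and l0: "l > 0" using m l by auto
  have p0: "p ^ k > 0" using prime_gt_0_nat[OF p] by simp
  have pl: "\<not> p dvd l" using pm l by (metis dvd_mult)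
  have quot: "p ^ k * m div (a * d) = w" if "p ^ k * l = d * w" for d w
  proof -
    have "d > 0" using that p0 l0 by (metis gr0I mult_is_0 nat_0_less_mult_iff)
    have "p ^ k * m = (a * d) * w" using that l by (metis mult.assoc mult.left_commute)
    thus ?thesis using a0 \<open>d > 0\<close> by simp
  qed
  show ?thesis
  proof (intro equalityI subsetI)
    fix d assume d: "d \<in> {d. d dvd p ^ k * l \<and> coprime (p ^ k * m div (a * d)) p}"
    then obtain w where w: "p ^ k * l = d * w" by (auto elim: dvdE)
    have "coprime w p" using d quot[OF w] by simp
    hence "coprime (p ^ k) w" by (simp add: coprime_commute)
    moreover have "p ^ k dvd d * w" by (metis dvd_triv_left w)
    ultimately have "p ^ k dvd d" using coprime_dvd_mult_left_iff by blast
    then obtain e where e: "d = p ^ k * e" by blast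
    have "p ^ k * l = p ^ k * (e * w)" using w e by (simp add: mult.assoc)
    hence "l = e * w" using p0 by (metis mult_cancel1 less_irrefl)
    hence "e dvd l" by simp
    thus "d \<in> (\<lambda>e. p ^ k * e) ` {e. e dvd l}" using e by blast
  next
    fix d assume "d \<in> (\<lambda>e. p ^ k * e) ` {e. e dvd l}"
    then obtain e where "d = p ^ k * e" "e dvd l" by blast
    then obtain w where e: "d = p ^ k * e" "l = e * w" by blast
    hence dw: "p ^ k * l = d * w" by simp
    have "\<not> p dvd w" using pl e by (metis dvd_mult)
    hence "coprime w p" using p prime_imp_coprime coprime_commute by blast
    thus "d \<in> {d. d dvd p ^ k * l \<and> coprime (p ^ k * m div (a * d)) p}"
      using quot[OF dw] dw by auto
  qed
qed

text \<open>The two sums treat the p-part of the conductor in opposite ways: d contains all of p^k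
  in the first and no factor p in the second. What is left is the same sum over the divisors of
  m.\<close>

lemma hurwitz_sums:
  fixes p k m :: nat and chi :: "nat \<Rightarrow> int"
  assumes p: "prime p" and pm: "\<not> p dvd m" and m: "m > 0"
  defines "cs \<equiv> complex_of_real (conductor_sum (\<lambda>a. of_int (chi a)) m)"
  shows "(\<Sum>a | a dvd p ^ k * m \<and> coprime a p. of_int (moebius a) * of_int (chi a) *
         (\<Sum>d | d dvd p ^ k * m div a \<and> coprime (p ^ k * m div (a * d)) p. of_nat d)) = of_nat p ^ k * cs"
    "(\<Sum>a | a dvd p ^ k * m \<and> coprime a p. of_int (moebius a) * of_int (chi a) *
         (\<Sum>d | d dvd p ^ k * m div a \<and> coprime d p. of_nat d)) = cs"
proof -
  have p0: "p ^ k > 0" using prime_gt_0_nat[OF p] by simp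
  have inj: "inj_on (\<lambda>e. p ^ k * e) X" for X using p0 by (auto simp: inj_on_def)
  have cs: "cs = (\<Sum>a | a dvd m. of_int (moebius a) * of_int (chi a) * (\<Sum>d | d dvd m div a. of_nat d))"
    by (simp add: cs_def conductor_sum_def sigma_def divisor_sum_def)
  have "(\<Sum>a | a dvd p ^ k * m \<and> coprime a p. of_int (moebius a) * of_int (chi a) *
         (\<Sum>d | d dvd p ^ k * m div a \<and> coprime (p ^ k * m div (a * d)) p. complex_of_nat d)) =
      (\<Sum>a | a dvd m. of_nat p ^ k * (of_int (moebius a) * of_int (chi a) * (\<Sum>d | d dvd m div a. of_nat d)))"
    unfolding coprime_divisors[OF p pm]
  proof (rule sum.cong)
    fix a assume "a \<in> {a. a dvd m}"
    then obtain l where l: "m = a * l" by auto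
    have a0: "a > 0" using m l by auto
    have e: "p ^ k * m div a = p ^ k * l" "m div a = l" using a0 by (simp_all add: l)
    have "(\<Sum>d | d dvd p ^ k * m div a \<and> coprime (p ^ k * m div (a * d)) p. complex_of_nat d) =
        of_nat p ^ k * (\<Sum>d | d dvd m div a. of_nat d)"
      unfolding e full_power_divisors[OF p pm m l] by (simp add: sum.reindex[OF inj] sum_distrib_left)
    thus "of_int (moebius a) * of_int (chi a) *
        (\<Sum>d | d dvd p ^ k * m div a \<and> coprime (p ^ k * m div (a * d)) p. complex_of_nat d) =
      of_nat p ^ k * (of_int (moebius a) * of_int (chi a) * (\<Sum>d | d dvd m div a. of_nat d))"
      by simp
  qed simp
  also have "\<dots> = of_nat p ^ k * cs" unfolding cs by (rule sum_distrib_left[symmetric])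
  finally show "(\<Sum>a | a dvd p ^ k * m \<and> coprime a p. of_int (moebius a) * of_int (chi a) *
         (\<Sum>d | d dvd p ^ k * m div a \<and> coprime (p ^ k * m div (a * d)) p. of_nat d)) = of_nat p ^ k * cs" .
  show "(\<Sum>a | a dvd p ^ k * m \<and> coprime a p. of_int (moebius a) * of_int (chi a) *
         (\<Sum>d | d dvd p ^ k * m div a \<and> coprime d p. of_nat d)) = cs"
    unfolding coprime_divisors[OF p pm] cs
  proof (rule sum.cong)
    fix a assume "a \<in> {a. a dvd m}"
    then obtain l where l: "m = a * l" by auto
    have a0: "a > 0" using m l by auto
    have e: "p ^ k * m div a = p ^ k * l" "m div a = l" using a0 by (simp_all add: l)
    have pl: "\<not> p dvd l" using pm l by (metis dvd_mult)
    show "of_int (moebius a) * of_int (chi a) * (\<Sum>d | d dvd p ^ k * m div a \<and> coprime d p. complex_of_nat d) =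
      of_int (moebius a) * of_int (chi a) * (\<Sum>d | d dvd m div a. of_nat d)"
      unfolding e coprime_divisors[OF p pl] ..
  qed simp
qed

text \<open>For k = 0 no form is divisible by p and there are 1 + \<chi>_t(p) roots; for k > 0 the
  symbol vanishes and the sum is M(n) + p M(n/p^2). With \<open>mass_prime_power\<close> both cases
  take one shape, in which the part with p^k belongs to \<open>hurwitz_1p\<close> and the rest to
  \<open>hurwitz_pp\<close>.\<close>

lemma level_mass_prime_power:
  assumes t: "fundamental_discriminant t" "t < 0" and p: "prime p" and m: "m > 0" and pm: "\<not> p dvd m"
  shows "(real p - 1) * class_sum p (t * (int (p ^ k * m))\<^sup>2) (\<lambda>_. 1) =
    (2 * (real p - chi_real t p) * real p ^ k - (real p + 1) * (1 - chi_real t p)) * mass (t * (int m)\<^sup>2)"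
proof -
  let ?n = "t * (int (p ^ k * m))\<^sup>2"
  have p0: "p > 0" using prime_gt_0_nat[OF p] .
  have n: "?n < 0" using t m p0 by (simp add: mult_neg_pos)
  show ?thesis
  proof (cases k)
    case 0
    have "class_sum p ?n (\<lambda>_. 1) = (1 + chi_real t p) * mass (t * (int m)\<^sup>2)"
      using level_mass[OF p n] mass_prime_coprime(1)[OF t p m pm] kronecker_prime_mult_square[OF p pm, of t]
      by (simp add: 0 kronecker_prime_eq[OF p])
    thus ?thesis by (simp add: 0 algebra_simps)
  next
    case (Suc j)
    have e: "p ^ k * m = p * (p ^ j * m)" by (simp add: Suc mult.assoc)
    have l0: "p ^ j * m > 0" using p0 m by simp
    have "kronecker_prime ?n p = 0"
      using p unfolding e by (intro kronecker_prime_dvd) (simp_all add: power2_eq_square)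
    hence "class_sum p ?n (\<lambda>_. 1) = mass ?n + real p * mass (t * (int (p ^ j * m))\<^sup>2)"
      using level_mass[OF p n] mass_prime_dvd(1)[OF t p l0] unfolding e by (simp add: algebra_simps)
    hence "(real p - 1) * class_sum p ?n (\<lambda>_. 1) =
        (real p - 1) * mass ?n + real p * ((real p - 1) * mass (t * (int (p ^ j * m))\<^sup>2))"
      by (simp add: algebra_simps)
    thus ?thesis unfolding mass_prime_power[OF t p m pm] by (simp add: Suc algebra_simps)
  qed
qed

theorem theorem1p4:
  fixes p :: nat and n :: int
  assumes "prime p" and "odd p"
    and "n < 0" and "[n = 0] (mod 4) \<or> [n = 1] (mod 4)"
  shows "(\<Sum>C\<in>bqf_classes p n. 1 / of_nat (card (Gamma0_stab p (SOME Q. Q \<in> C)))) =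
           4 * (of_nat p + 1) / of_nat p * hurwitz_1p p (- n) -
           2 * (of_nat p + 1) / (of_nat p - 1) * hurwitz_pp p (- n)"
proof -
  note p = assms(1)
  have p1: "real p > 1" using prime_gt_1_nat[OF p] by simp
  have "- (- n) mod 4 = 0 \<or> - (- n) mod 4 = 1" using assms(4) by (auto simp: cong_def)
  then obtain t c where tc: "disc_decomp (- n) (t, c)" using disc_decomp_exists[of "- n"] assms(3) by auto
  have the: "(THE tm. disc_decomp (- n) tm) = (t, c)"
    using tc disc_decomp_unique by (intro the_equality) auto
  have fund: "disc_fund (- n) = t" "disc_cond (- n) = c"
    unfolding disc_fund_def disc_cond_def the by simp_all
  have t: "fundamental_discriminant t" and c: "c > 0" and n: "n = t * (int c)\<^sup>2"
    using tc by (auto simp: disc_decomp_def)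
  have t0: "t < 0" using assms(3) n by (simp add: mult_less_0_iff)
  \<comment> \<open>The p-part of the conductor is split off: p^k survives only as a factor of
    \<open>hurwitz_1p\<close>, and both Hurwitz numbers are otherwise expressed through M(t
    m^2).\<close>
  obtain k m where km: "c = p ^ k * m" "\<not> p dvd m"
    using multiplicity_decompose'[of c p] c p by (metis not_prime_unit neq0_conv)
  have m: "m > 0" using c km by auto
  define x where "x = chi_real t p"
  define M where "M = mass (t * (int m)\<^sup>2)"
  have M: "M = mass t * conductor_sum (chi_real t) m"
    unfolding M_def by (rule mass_conductor[OF t t0 m])
  have L: "dirichlet_L (kronecker t) 0 * complex_of_real (conductor_sum (chi_real t) m) = complex_of_real M"
    unfolding M class_number_formula[OF t t0] by simp
  have H1: "hurwitz_1p p (- n) = complex_of_real (((1 - x / real p) / (1 - 1 / (real p)\<^sup>2)) * (real p ^ k * M))"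
    unfolding hurwitz_1p_def Let_def fund km(1) hurwitz_sums(1)[OF p km(2) m]
    unfolding of_real_mult L[symmetric] x_def by simp
  have H2: "hurwitz_pp p (- n) = complex_of_real ((1 - x) * M)"
    unfolding hurwitz_pp_def Let_def fund km(1) hurwitz_sums(2)[OF p km(2) m]
    unfolding of_real_mult L[symmetric] x_def by simp
  define S where "S = class_sum p n (\<lambda>_. 1)"
  have S: "(real p - 1) * S = (2 * (real p - x) * real p ^ k - (real p + 1) * (1 - x)) * M"
    unfolding S_def n km(1) M_def x_def by (rule level_mass_prime_power[OF t t0 p m km(2)])
  \<comment> \<open>The factor p + 1 of 1 - 1/p^2 = (p - 1) (p + 1)/p^2 cancels against the outer
    one.\<close>
  have "4 * (real p + 1) / real p * (((1 - x / real p) / (1 - 1 / (real p)\<^sup>2)) * (real p ^ k * M)) =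
      4 * (real p - x) * real p ^ k * M / (real p - 1)"
  proof -
    have "1 - 1 / (real p)\<^sup>2 = (real p - 1) * (real p + 1) / (real p)\<^sup>2"
      using p1 by (simp add: field_simps power2_eq_square)
    moreover have "1 - x / real p = (real p - x) / real p" using p1 by (simp add: field_simps)
    moreover have "(a / b) / (c / b\<^sup>2) = b * a / c" if "b \<noteq> 0" for a b c :: real
      using that by (simp add: power2_eq_square)
    ultimately have "(1 - x / real p) / (1 - 1 / (real p)\<^sup>2) =
        real p * (real p - x) / ((real p - 1) * (real p + 1))"
      using p1 by simp
    moreover have "4 * (P + 1) / P * (P * y / ((P - 1) * (P + 1)) * z) = 4 * y * z / (P - 1)"
      if "P > 1" for P y z :: real
      using that by (simp add: divide_simps)
    ultimately show ?thesis using p1 by (simp add: mult.assoc)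
  qed
  \<comment> \<open>The factor 2 comes from taking stabilizers modulo sign.\<close>
  moreover have "2 * S = 4 * (real p - x) * real p ^ k * M / (real p - 1) -
      2 * (real p + 1) / (real p - 1) * ((1 - x) * M)"
  proof -
    have "S = ((2 * (real p - x) * real p ^ k - (real p + 1) * (1 - x)) * M) / (real p - 1)"
      using S p1 by (simp add: eq_divide_eq mult.commute)
    thus ?thesis using p1 by (simp add: diff_divide_distrib[symmetric] algebra_simps)
  qed
  ultimately have "2 * S = 4 * (real p + 1) / real p * (((1 - x / real p) / (1 - 1 / (real p)\<^sup>2)) * (real p ^ k * M)) -
      2 * (real p + 1) / (real p - 1) * ((1 - x) * M)" by simp
  hence "complex_of_real (2 * S) = 4 * (of_nat p + 1) / of_nat p * hurwitz_1p p (- n) -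
      2 * (of_nat p + 1) / (of_nat p - 1) * hurwitz_pp p (- n)"
    unfolding H1 H2 by simp
  thus ?thesis unfolding stabilizer_class_sum[OF assms(3)] S_def .
qed

end
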